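(* Let $\mu\in\mathbb{R}$, $s>1$, and let $f\in H^s(\mathbb{S}^2)$ with Fourier–Laplace expansion $f=\sum_{\ell=0}^{+\infty}\sum_{m=-\ell}^{\ell}f_{\ell,m}Y_{\ell,m}$. Then the abstract Cauchy problem in $H^s(\mathbb{S}^2)$ $$\frac{d^{\Phi}u}{dt^{\Phi}}(t)=\mathcal{G}_\mu u(t)\quad (t>0),\qquad u(0)=f,$$ admits a unique strong solution $u$, in the sense that: (i) $u\in C([0,\infty);H^s(\mathbb{S}^2))\cap C((0,\infty);H^{s+2}(\mathbb{S}^2))$; (ii) $\frac{d^{\Phi}u}{dt^{\Phi}}(t)$ is well-defined in $H^s(\mathbb{S}^2)$ for any $t>0$; (iii) $\frac{d^{\Phi}u}{dt^{\Phi}}\in C((0,\infty);H^s(\mathbb{S}^2))$; (iv) $u$ satisfies the two equalities of the Cauchy problem. In particular, this solution is given by $$u(t)=\sum_{\ell=0}^{+\infty}\sum_{m=-\ell}^{\ell}f_{\ell,m}\,\mathfrak{e}_\Phi(t;i\mu m-\ell(\ell+1))\,Y_{\ell,m},$$ where the equality holds in $H^s(\mathbb{S}^2)$.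
   Context: Sphere. $\mathbb{S}^2\subset\mathbb{R}^3$ is the unit sphere with the round metric $g$, surface measure $\sigma$ and spherical coordinates $(\sin\theta\cos\varphi,\sin\theta\sin\varphi,\cos\theta)$, $\theta\in[0,\pi]$, $\varphi\in[0,2\pi)$. Functions are complex-valued. $\Delta_g$ is the Laplace–Beltrami operator, $X_\mu$ is the smooth vector field equal to $\mu\,\partial/\partial\varphi$ in spherical coordinates (and zero at the poles), and $\mathcal{G}_\mu=\Delta_g+X_\mu$. The spherical harmonics are $Y_{\ell,m}(\theta,\varphi)=\sqrt{\frac{(2\ell+1)(\ell-m)!}{4\pi(\ell+m)!}}P_\ell^m(\cos\theta)e^{im\varphi}$, $\ell=0,1,\dots$, $m=-\ell,\dots,\ell$, with $P_\ell^m(x)=\frac{(-1)^m}{2^\ell\ell!}(1-x^2)^{m/2}\frac{d^{\ell+m}}{dx^{\ell+m}}(x^2-1)^\ell$; they form an orthonormal basis of $L^2(\mathbb{S}^2)=L^2(\mathbb{S}^2,\sigma)$ and $\mathcal{G}_\mu Y_{\ell,m}=(i\mu m-\ell(\ell+1))Y_{\ell,m}$. The Fourier–Laplace coefficients of $f\in L^2(\mathbb{S}^2)$ are $f_{\ell,m}=\int_{\mathbb{S}^2}f\,\overline{Y}_{\ell,m}\,d\sigma$, and $A_\ell(f)=\sum_{m=-\ell}^{\ell}|f_{\ell,m}|^2$. For $s\ge 0$, $H^s(\mathbb{S}^2)$ is the set of $f\in L^2(\mathbb{S}^2)$ with $[f]_{H^s(\mathbb{S}^2)}^2:=\sum_{\ell\ge0}\ell^{2s}A_\ell(f)<\infty$,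 with norm $\|f\|_{H^s(\mathbb{S}^2)}=\|f\|_{L^2(\mathbb{S}^2)}+[f]_{H^s(\mathbb{S}^2)}$. For $u\in H^{2}(\mathbb{S}^2)$, $\mathcal{G}_\mu u$ is understood in the weak sense, i.e. $\mathcal{G}_\mu u=\sum_{\ell,m}(i\mu m-\ell(\ell+1))u_{\ell,m}Y_{\ell,m}$. Subordinator. $\Phi(\lambda)=\int_0^{+\infty}(1-e^{-\lambda t})\nu_\Phi(dt)$, $\lambda\ge0$, where $\nu_\Phi$ is a measure on $(0,+\infty)$ with $\int_0^{+\infty}(1\wedge t)\nu_\Phi(dt)<\infty$ and $\nu_\Phi(0,+\infty)=+\infty$; $\overline{\nu}_\Phi(t)=\nu_\Phi(t,+\infty)$. $S_\Phi$ is a subordinator (increasing Lévy process with $S_\Phi(0)=0$) with $\mathbb{E}[e^{-\lambda S_\Phi(t)}]=e^{-t\Phi(\lambda)}$, $L_\Phi(t)=\inf\{s>0:S_\Phi(s)>t\}$ is its inverse, and $\mathfrak{e}_\Phi(t;\lambda)=\mathbb{E}[e^{\lambda L_\Phi(t)}]$ for $\lambda\in\mathbb{C}$, $t\ge0$ (this is finite under these assumptions). Nonlocal derivative. For a Banach space $\mathfrak{B}$ and $u:[0,\infty)\to\mathfrak{B}$, $\frac{d^{\Phi}u}{dt^{\Phi}}(t)=\frac{d}{dt}\int_0^t\overline{\nu}_\Phi(t-\tau)(u(\tau)-u(0^+))\,d\tau$, $t>0$, where the integral is a Bochner integral and the derivative is a strong limit in $\mathfrak{B}$, provided it exists. Here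 $\mathfrak{B}=H^s(\mathbb{S}^2)$. *)

theory Defs
  imports "HOL-Probability.Probability"
begin

section \<open>The sphere and its spherical harmonics\<close>

definition sph_coord :: "real \<Rightarrow> real \<Rightarrow> real ^ 3" where
  "sph_coord \<theta> \<phi> = vector [sin \<theta> * cos \<phi>, sin \<theta> * sin \<phi>, cos \<theta>]"

text \<open>The surface measure of the unit sphere, whose area element in spherical coordinates is
  \<open>sin \<theta> d\<theta> d\<phi>\<close>.\<close>

definition sphere_measure :: "(real ^ 3) measure" where
  "sphere_measure =
    distr
      (density (restrict_space (lborel :: (real \<times> real) measure) ({0..pi} \<times> {0..<2*pi}))
        (\<lambda>(\<theta>, \<phi>). ennreal (sin \<theta>)))
      (restrict_space borel (sphere 0 1))
      (\<lambda>(\<theta>, \<phi>). sph_coord \<theta> \<phi>)"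

text \<open>In \<open>(1 - x\<^sup>2)\<^bsup>m/2\<^esup>\<close> the exponent may be negative; \<open>sqrt (1 - x\<^sup>2) powi m\<close> equals it for
  \<open>\<bar>x\<bar> < 1\<close>, and gives the right values \<open>1\<close> (if \<open>m = 0\<close>) and \<open>0\<close> (if \<open>m \<noteq> 0\<close>) at the poles.\<close>

definition assoc_legendre :: "nat \<Rightarrow> int \<Rightarrow> real \<Rightarrow> real" where
  "assoc_legendre l m x =
    (-1) powi m / (2 ^ l * fact l) * sqrt (1 - x\<^sup>2) powi m
      * (deriv ^^ nat (int l + m)) (\<lambda>y. (y\<^sup>2 - 1) ^ l) x"

definition sph_harm_coord :: "nat \<Rightarrow> int \<Rightarrow> real \<Rightarrow> real \<Rightarrow> complex" where
  "sph_harm_coord l m \<theta> \<phi> =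
    complex_of_real
      (sqrt ((2 * real l + 1) * fact (nat (int l - m)) / (4 * pi * fact (nat (int l + m))))
        * assoc_legendre l m (cos \<theta>))
    * exp (\<i> * of_int m * complex_of_real \<phi>)"

definition sph_harm_fun :: "nat \<Rightarrow> int \<Rightarrow> real ^ 3 \<Rightarrow> complex" where
  "sph_harm_fun l m p = sph_harm_coord l m (arccos (p $ 3)) (Arg2pi (Complex (p $ 1) (p $ 2)))"

lemma sph_coord_in_sphere: "sph_coord \<theta> \<phi> \<in> sphere 0 1"
proof -
  have "(sin \<theta> * cos \<phi>)\<^sup>2 + (sin \<theta> * sin \<phi>)\<^sup>2 + (cos \<theta>)\<^sup>2
      = (sin \<theta>)\<^sup>2 * ((cos \<phi>)\<^sup>2 + (sin \<phi>)\<^sup>2) + (cos \<theta>)\<^sup>2"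
    by (simp only: power_mult_distrib distrib_left)
  also have "\<dots> = 1" by simp
  finally show ?thesis
    by (simp add: sph_coord_def norm_vec_def L2_set_def sum_3)
qed

lemma sph_harm_fun_sph_coord:
  assumes "0 \<le> \<theta>" "\<theta> \<le> pi" "0 \<le> \<phi>" "\<phi> < 2 * pi" "\<bar>m\<bar> \<le> int l"
  shows "sph_harm_fun l m (sph_coord \<theta> \<phi>) = sph_harm_coord l m \<theta> \<phi>"
proof (cases "sin \<theta> = 0")
  case True
  then have c: "(cos \<theta>)\<^sup>2 = 1"
    by (metis add_0 power_zero_numeral sin_cos_squared_add)
  show ?thesis
    using assms True c
    by (cases "m = 0")
      (simp_all add: sph_harm_fun_def sph_harm_coord_def sph_coord_def arccos_cos
        assoc_legendre_def power_int_0_left_if)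
next
  case False
  then have "sin \<theta> > 0"
    using assms sin_ge_zero[of \<theta>] by linarith
  then have "Arg2pi (Complex (sin \<theta> * cos \<phi>) (sin \<theta> * sin \<phi>)) = \<phi>"
    using assms
    by (intro Arg2pi_unique[of "sin \<theta>"])
      (auto simp: complex_eq_iff Re_exp Im_exp)
  then show ?thesis
    using assms by (simp add: sph_harm_fun_def sph_coord_def arccos_cos)
qed

lemma measurable_sph_coord:
  "(\<lambda>(\<theta>, \<phi>). sph_coord \<theta> \<phi>)
    \<in> measurable (restrict_space (lborel :: (real \<times> real) measure) A) (restrict_space borel (sphere 0 1))"
proof (rule measurable_restrict_space2)
  show "(\<lambda>(\<theta>, \<phi>). sph_coord \<theta> \<phi>) \<in> space (restrict_space (lborel :: (real \<times> real) measure) A) \<rightarrow> sphere 0 1"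
    using sph_coord_in_sphere by auto
  have "(\<lambda>p::real \<times> real. sph_coord (fst p) (snd p)) \<in> borel_measurable borel"
  proof (rule borel_measurable_continuous_onI)
    have "sph_coord \<theta> \<phi>
        = (sin \<theta> * cos \<phi>) *\<^sub>R axis 1 1 + (sin \<theta> * sin \<phi>) *\<^sub>R axis 2 1 + cos \<theta> *\<^sub>R axis 3 1" for \<theta> \<phi>
      by (simp add: sph_coord_def vec_eq_iff forall_3 axis_def)
    then show "continuous_on UNIV (\<lambda>p::real \<times> real. sph_coord (fst p) (snd p))"
      by (simp only:) (intro continuous_intros)
  qed
  then show "(\<lambda>(\<theta>, \<phi>). sph_coord \<theta> \<phi>) \<in> borel_measurable (restrict_space (lborel :: (real \<times> real) measure) A)"
    by (intro measurable_restrict_space1) (simp add: case_prod_beta)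
qed

lemma space_sphere_measure [simp]: "space sphere_measure = sphere 0 1"
  by (simp add: sphere_measure_def space_restrict_space)

lemma sets_sphere_measure [measurable_cong]:
  "sets sphere_measure = sets (restrict_space borel (sphere 0 1))"
  by (simp add: sphere_measure_def)

lemma finite_measure_sphere_measure: "finite_measure sphere_measure"
proof
  let ?B = "{0..pi} \<times> {0..<2*pi} :: (real \<times> real) set"
  let ?R = "restrict_space (lborel :: (real \<times> real) measure) ?B"
  have B: "?B \<in> sets borel" by (simp add: borel_Times)
  have "emeasure sphere_measure (space sphere_measure) \<le> emeasure (density ?R (\<lambda>(\<theta>, \<phi>). ennreal (sin \<theta>))) (space ?R)"
    unfolding space_sphere_measure unfolding sphere_measure_def
    using measurable_sph_coord[of ?B] sets.top[of ?R]
      sets.top[of "restrict_space borel (sphere 0 1 :: (real ^ 3) set)"]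
    by (subst emeasure_distr) (auto intro!: emeasure_mono sets.top simp: space_restrict_space)
  also have "\<dots> = (\<integral>\<^sup>+p. (\<lambda>(\<theta>, \<phi>). ennreal (sin \<theta>)) p * indicator (space ?R) p \<partial>?R)"
  proof (subst emeasure_density)
    have "(\<lambda>p::real \<times> real. ennreal (sin (fst p))) \<in> borel_measurable borel"
      by (intro measurable_compose[OF _ measurable_ennreal] borel_measurable_continuous_onI continuous_intros)
    then show "(\<lambda>(\<theta>, \<phi>). ennreal (sin \<theta>)) \<in> borel_measurable ?R"
      by (intro measurable_restrict_space1) (simp add: case_prod_beta')
  qed auto
  also have "\<dots> \<le> (\<integral>\<^sup>+p. 1 \<partial>?R)"
    by (intro nn_integral_mono) (auto simp: indicator_def)
  also have "\<dots> = emeasure lborel ?B"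
    using B by (simp add: emeasure_restrict_space space_restrict_space)
  also have "\<dots> \<le> emeasure lborel (cbox (0, 0) (pi, 2*pi))"
    by (intro emeasure_mono) (auto simp: cbox_Pair_eq borel_Times)
  also have "\<dots> < \<infinity>"
    by (rule emeasure_lborel_cbox_finite)
  finally show "emeasure sphere_measure (space sphere_measure) \<noteq> \<infinity>"
    by simp
qed

section \<open>The space of square integrable functions\<close>

definition square_integrable :: "'a measure \<Rightarrow> ('a \<Rightarrow> complex) \<Rightarrow> bool" where
  "square_integrable M f \<longleftrightarrow> f \<in> borel_measurable M \<and> integrable M (\<lambda>x. (cmod (f x))\<^sup>2)"

lemma square_integrable_scale:
  "square_integrable M f \<Longrightarrow> square_integrable M (\<lambda>x. c * f x)"
  by (auto simp: square_integrable_def norm_mult power_mult_distrib)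

lemma square_integrable_mult:
  assumes "square_integrable M f" "square_integrable M g"
  shows "integrable M (\<lambda>x. cmod (f x) * cmod (g x))"
proof (rule Bochner_Integration.integrable_bound)
  show "integrable M (\<lambda>x. (cmod (f x))\<^sup>2 + (cmod (g x))\<^sup>2)"
    using assms by (auto simp: square_integrable_def)
  show "(\<lambda>x. cmod (f x) * cmod (g x)) \<in> borel_measurable M"
    using assms by (auto simp: square_integrable_def)
  have "a * b \<le> a\<^sup>2 + b\<^sup>2" if "0 \<le> a" "0 \<le> b" for a b :: real
    using sum_squares_bound[of a b] that mult_nonneg_nonneg[of a b] by linarith
  then show "AE x in M. norm (cmod (f x) * cmod (g x)) \<le> norm ((cmod (f x))\<^sup>2 + (cmod (g x))\<^sup>2)"
    by (auto simp: abs_mult)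
qed

lemma square_integrable_add:
  assumes "square_integrable M f" "square_integrable M g"
  shows "square_integrable M (\<lambda>x. f x + g x)"
  unfolding square_integrable_def
proof
  show m: "(\<lambda>x. f x + g x) \<in> borel_measurable M"
    using assms by (auto simp: square_integrable_def)
  show "integrable M (\<lambda>x. (cmod (f x + g x))\<^sup>2)"
  proof (rule Bochner_Integration.integrable_bound)
    show "integrable M (\<lambda>x. (cmod (f x))\<^sup>2 + (cmod (g x))\<^sup>2 + 2 * (cmod (f x) * cmod (g x)))"
      using assms square_integrable_mult[OF assms] by (auto simp: square_integrable_def)
    show "(\<lambda>x. (cmod (f x + g x))\<^sup>2) \<in> borel_measurable M"
      using m by measurable
    have "(cmod (a + b))\<^sup>2 \<le> (cmod a)\<^sup>2 + (cmod b)\<^sup>2 + 2 * (cmod a * cmod b)" for a b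
      using power_mono[OF norm_triangle_ineq[of a b], of 2] by (simp add: power2_sum)
    then show "AE x in M. norm ((cmod (f x + g x))\<^sup>2)
        \<le> norm ((cmod (f x))\<^sup>2 + (cmod (g x))\<^sup>2 + 2 * (cmod (f x) * cmod (g x)))"
      by (auto intro: order_trans[OF _ abs_ge_self])
  qed
qed

lemma square_integrable_triangle:
  assumes f: "square_integrable M f" and g: "square_integrable M g"
  shows "sqrt (\<integral>x. (cmod (f x + g x))\<^sup>2 \<partial>M)
    \<le> sqrt (\<integral>x. (cmod (f x))\<^sup>2 \<partial>M) + sqrt (\<integral>x. (cmod (g x))\<^sup>2 \<partial>M)"
proof -
  define a where "a = (\<integral>x. (cmod (f x))\<^sup>2 \<partial>M)"
  define b where "b = (\<integral>x. (cmod (g x))\<^sup>2 \<partial>M)"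
  define c where "c = (\<integral>x. cmod (f x) * cmod (g x) \<partial>M)"
  have int: "integrable M (\<lambda>x. (cmod (f x))\<^sup>2)" "integrable M (\<lambda>x. (cmod (g x))\<^sup>2)"
      "integrable M (\<lambda>x. cmod (f x) * cmod (g x))" "integrable M (\<lambda>x. (cmod (f x + g x))\<^sup>2)"
    using f g square_integrable_mult[OF f g] square_integrable_add[OF f g]
    by (auto simp: square_integrable_def)
  have nn: "0 \<le> a" "0 \<le> b" "0 \<le> c"
    by (auto simp: a_def b_def c_def)
  have quad: "0 \<le> a * t\<^sup>2 - 2 * c * t + b" for t
  proof -
    have "0 \<le> (\<integral>x. (t * cmod (f x) - cmod (g x))\<^sup>2 \<partial>M)"
      by simp
    also have "\<dots> = (\<integral>x. t\<^sup>2 * (cmod (f x))\<^sup>2 - 2 * t * (cmod (f x) * cmod (g x)) + (cmod (g x))\<^sup>2 \<partial>M)"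
      by (intro Bochner_Integration.integral_cong) (auto simp: power2_eq_square algebra_simps)
    also have "\<dots> = a * t\<^sup>2 - 2 * c * t + b"
      using int by (simp add: a_def b_def c_def)
    finally show ?thesis .
  qed
  have "c\<^sup>2 \<le> a * b"
  proof (cases "a = 0")
    case True
    have "c = 0"
    proof (rule ccontr)
      assume "c \<noteq> 0"
      with quad[of "(b + 1) / (2 * c)"] True show False by simp
    qed
    then show ?thesis using True by simp
  next
    case False
    have "a * (c / a)\<^sup>2 - 2 * c * (c / a) + b = b - c\<^sup>2 / a"
      using False by (simp add: power2_eq_square field_simps)
    with quad[of "c / a"] have "c\<^sup>2 / a \<le> b" by simp
    then show ?thesis
      using False nn by (simp add: field_simps)
  qed
  then have "c \<le> sqrt (a * b)"
    by (rule real_le_rsqrt)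
  have "(\<integral>x. (cmod (f x + g x))\<^sup>2 \<partial>M)
      \<le> (\<integral>x. (cmod (f x))\<^sup>2 + (cmod (g x))\<^sup>2 + 2 * (cmod (f x) * cmod (g x)) \<partial>M)"
  proof (rule integral_mono)
    show "integrable M (\<lambda>x. (cmod (f x))\<^sup>2 + (cmod (g x))\<^sup>2 + 2 * (cmod (f x) * cmod (g x)))"
      using int by auto
    show "(cmod (f x + g x))\<^sup>2 \<le> (cmod (f x))\<^sup>2 + (cmod (g x))\<^sup>2 + 2 * (cmod (f x) * cmod (g x))" for x
      using power_mono[OF norm_triangle_ineq[of "f x" "g x"], of 2] by (simp add: power2_sum)
  qed (use int in auto)
  also have "\<dots> = a + b + 2 * c"
    using int by (simp add: a_def b_def c_def)
  also have "\<dots> \<le> (sqrt a + sqrt b)\<^sup>2"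
    using \<open>c \<le> sqrt (a * b)\<close> nn by (simp add: power2_sum real_sqrt_mult)
  finally show ?thesis
    using nn by (intro real_le_lsqrt) (auto simp: a_def b_def)
qed

quotient_type l2_sphere = "real ^ 3 \<Rightarrow> complex" / partial:
  "\<lambda>f g. square_integrable sphere_measure f \<and> square_integrable sphere_measure g
      \<and> (AE p in sphere_measure. f p = g p)"
proof (rule part_equivpI)
  show "\<exists>f. square_integrable sphere_measure f \<and> square_integrable sphere_measure f
      \<and> (AE p in sphere_measure. f p = f p)"
    by (rule exI[of _ "\<lambda>_. 0"]) (simp add: square_integrable_def)
  show "symp (\<lambda>f g. square_integrable sphere_measure f \<and> square_integrable sphere_measure g
      \<and> (AE p in sphere_measure. f p = g p))"
    by (auto intro!: sympI elim: AE_mp)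
  show "transp (\<lambda>f g. square_integrable sphere_measure f \<and> square_integrable sphere_measure g
      \<and> (AE p in sphere_measure. f p = g p))"
  proof (intro transpI conjI; elim conjE)
    fix f g h :: "real ^ 3 \<Rightarrow> complex"
    assume "AE p in sphere_measure. f p = g p" "AE p in sphere_measure. g p = h p"
    then show "AE p in sphere_measure. f p = h p" by eventually_elim simp
  qed
qed

instantiation l2_sphere :: real_normed_vector
begin

lift_definition zero_l2_sphere :: l2_sphere is "\<lambda>_. 0"
  by (simp add: square_integrable_def)

lift_definition plus_l2_sphere :: "l2_sphere \<Rightarrow> l2_sphere \<Rightarrow> l2_sphere" is "\<lambda>f g p. f p + g p"
  by (auto intro!: square_integrable_add elim: eventually_elim2)

lift_definition uminus_l2_sphere :: "l2_sphere \<Rightarrow> l2_sphere" is "\<lambda>f p. - f p"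
  by (auto simp: square_integrable_def)

lift_definition scaleR_l2_sphere :: "real \<Rightarrow> l2_sphere \<Rightarrow> l2_sphere" is "\<lambda>r f p. r *\<^sub>R f p"
  by (auto simp: scaleR_conv_of_real intro!: square_integrable_scale elim: eventually_mono)

lift_definition norm_l2_sphere :: "l2_sphere \<Rightarrow> real" is
  "\<lambda>f. sqrt (\<integral>p. (cmod (f p))\<^sup>2 \<partial>sphere_measure)"
  by (auto simp: square_integrable_def intro!: integral_cong_AE elim: eventually_mono)

definition minus_l2_sphere :: "l2_sphere \<Rightarrow> l2_sphere \<Rightarrow> l2_sphere" where
  "f - g = f + (- g)" for f g :: l2_sphere

definition dist_l2_sphere :: "l2_sphere \<Rightarrow> l2_sphere \<Rightarrow> real" where
  "dist_l2_sphere f g = norm (f - g)"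

definition sgn_l2_sphere :: "l2_sphere \<Rightarrow> l2_sphere" where
  "sgn_l2_sphere f = inverse (norm f) *\<^sub>R f"

definition uniformity_l2_sphere :: "(l2_sphere \<times> l2_sphere) filter" where
  "uniformity_l2_sphere = (INF e\<in>{0<..}. principal {(x, y). dist x y < e})"

definition open_l2_sphere :: "l2_sphere set \<Rightarrow> bool" where
  "open_l2_sphere U \<longleftrightarrow> (\<forall>x\<in>U. \<forall>\<^sub>F (x', y) in uniformity. x' = x \<longrightarrow> y \<in> U)"

instance
proof
  fix a b :: real and x y z :: l2_sphere
  show "x + y + z = x + (y + z)"
    by transfer (auto simp: add.assoc intro!: square_integrable_add)
  show "x + y = y + x"
    by transfer (auto simp: add.commute intro!: square_integrable_add)
  show "0 + x = x"
    by transfer auto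
  show "- x + x = 0"
    by transfer (auto simp: square_integrable_def)
  show "x - y = x + - y"
    by (rule minus_l2_sphere_def)
  show "a *\<^sub>R (x + y) = a *\<^sub>R x + a *\<^sub>R y"
    by transfer
      (auto simp: scaleR_conv_of_real distrib_left intro!: square_integrable_add square_integrable_scale)
  show "(a + b) *\<^sub>R x = a *\<^sub>R x + b *\<^sub>R x"
    by transfer
      (auto simp: scaleR_conv_of_real distrib_right intro!: square_integrable_add square_integrable_scale)
  show "a *\<^sub>R b *\<^sub>R x = (a * b) *\<^sub>R x"
    by transfer (auto simp: scaleR_conv_of_real mult.assoc intro!: square_integrable_scale)
  show "1 *\<^sub>R x = x"
    by transfer auto
  show "dist x y = norm (x - y)"
    by (rule dist_l2_sphere_def)
  show "sgn x = inverse (norm x) *\<^sub>R x"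
    by (rule sgn_l2_sphere_def)
  show "(uniformity :: (l2_sphere \<times> l2_sphere) filter)
      = (INF e\<in>{0<..}. principal {(x, y). dist x y < e})"
    by (rule uniformity_l2_sphere_def)
  show "open U \<longleftrightarrow> (\<forall>x\<in>U. \<forall>\<^sub>F (x', y) in uniformity. x' = x \<longrightarrow> y \<in> U)" for U :: "l2_sphere set"
    by (rule open_l2_sphere_def)
  show "norm x = 0 \<longleftrightarrow> x = 0"
    by transfer (auto simp: square_integrable_def integral_nonneg_eq_0_iff_AE)
  show "norm (x + y) \<le> norm x + norm y"
    by transfer (auto intro: square_integrable_triangle)
  show "norm (a *\<^sub>R x) = \<bar>a\<bar> * norm x"
    by transfer (auto simp: power_mult_distrib real_sqrt_mult)
qed

end

lift_definition scaleC_l2 :: "complex \<Rightarrow> l2_sphere \<Rightarrow> l2_sphere"  (infixr \<open>*\<^sub>C\<close> 75) is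
  "\<lambda>c f p. c * f p"
  by (auto intro!: square_integrable_scale elim: eventually_mono)

lemma borel_measurable_cnj [measurable]: "cnj \<in> borel_measurable borel"
  by (intro borel_measurable_continuous_onI continuous_intros)

lift_definition inner_l2 :: "l2_sphere \<Rightarrow> l2_sphere \<Rightarrow> complex" is
  "\<lambda>f g. \<integral>p. f p * cnj (g p) \<partial>sphere_measure"
  by (rule integral_cong_AE)
    (auto simp: square_integrable_def intro!: borel_measurable_times
      intro: measurable_compose[OF _ borel_measurable_cnj])

lemma deriv_funpow_poly:
  fixes p :: "real poly"
  shows "(deriv ^^ n) (poly p) = poly ((pderiv ^^ n) p)"
proof (induction n)
  case (Suc n)
  have "deriv (poly q) = poly (pderiv q)" for q :: "real poly"
    by (auto intro!: DERIV_imp_deriv poly_DERIV)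
  with Suc show ?case by simp
qed simp

lemma power_dvd_pderiv_funpow:
  fixes c :: "real poly"
  assumes "n \<le> l"
  shows "c ^ (l - n) dvd (pderiv ^^ n) (c ^ l)"
  using assms
proof (induction n)
  case (Suc n)
  define k where "k = l - Suc n"
  have "l - n = Suc k" using Suc.prems by (simp add: k_def)
  with Suc obtain q where q: "(pderiv ^^ n) (c ^ l) = c ^ Suc k * q"
    by (auto elim: dvdE)
  have "(pderiv ^^ Suc n) (c ^ l) = c ^ k * (c * pderiv q + smult (of_nat (Suc k)) (pderiv c * q))"
    unfolding funpow.simps comp_def q pderiv_mult pderiv_power_Suc
    by (simp add: algebra_simps del: of_nat_Suc)
  then show ?case by (simp add: k_def)
qed simp

lemma legendre_derivative_poly:
  "(deriv ^^ n) (\<lambda>y::real. (y\<^sup>2 - 1) ^ l) = poly ((pderiv ^^ n) ([:-1, 0, 1:] ^ l))"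
proof -
  have "(\<lambda>y::real. (y\<^sup>2 - 1) ^ l) = poly ([:-1, 0, 1:] ^ l)"
    by (rule ext) (simp add: poly_power power2_eq_square)
  then show ?thesis by (simp add: deriv_funpow_poly)
qed

lemma poly_bounded_on_Icc: "\<exists>B. \<forall>x::real. \<bar>x\<bar> \<le> 1 \<longrightarrow> \<bar>poly q x\<bar> \<le> B"
proof -
  have "compact (poly q ` {-1..1})"
    by (intro compact_continuous_image continuous_intros) auto
  then have "bounded (poly q ` {-1..1})"
    by (rule compact_imp_bounded)
  then obtain B where "\<forall>x\<in>{-1..1}. \<bar>poly q x\<bar> \<le> B"
    by (auto simp: bounded_iff)
  then show ?thesis
    by (intro exI[of _ B]) (simp add: abs_le_iff)
qed

lemma assoc_legendre_bounded:
  assumes "\<bar>m\<bar> \<le> int l"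
  shows "\<exists>B. \<forall>x. \<bar>x\<bar> \<le> 1 \<longrightarrow> \<bar>assoc_legendre l m x\<bar> \<le> B"
proof -
  define w where "w x = sqrt (1 - x\<^sup>2) powi m * poly ((pderiv ^^ nat (int l + m)) ([:-1, 0, 1:] ^ l)) x"
    for x :: real
  have "\<exists>B. \<forall>x. \<bar>x\<bar> \<le> 1 \<longrightarrow> \<bar>w x\<bar> \<le> B"
  proof (cases "m \<ge> 0")
    case True
    obtain B where B: "\<bar>poly ((pderiv ^^ nat (int l + m)) ([:-1, 0, 1:] ^ l)) x\<bar> \<le> B" if "\<bar>x\<bar> \<le> 1" for x :: real
      using poly_bounded_on_Icc by blast
    show ?thesis
    proof (intro exI allI impI)
      fix x :: real assume x: "\<bar>x\<bar> \<le> 1"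
      then have "0 \<le> sqrt (1 - x\<^sup>2)" "sqrt (1 - x\<^sup>2) \<le> 1"
        by (auto simp: abs_square_le_1)
      then have "\<bar>sqrt (1 - x\<^sup>2) powi m\<bar> \<le> 1"
        using True by (auto simp: power_int_def power_le_one)
      then show "\<bar>w x\<bar> \<le> 1 * B"
        unfolding w_def abs_mult using B[OF x] by (intro mult_mono) auto
    qed
  next
    case False
    define k where "k = nat (- m)"
    have k: "m = - int k" "k \<le> l" "nat (int l + m) = l - k" "k > 0"
      using False assms by (auto simp: k_def)
    obtain q where q: "(pderiv ^^ (l - k)) ([:-1, 0, 1:] ^ l) = [:-1, 0, 1::real:] ^ k * q"
      using power_dvd_pderiv_funpow[of "l - k" l "[:-1, 0, 1::real:]"] k by (auto elim: dvdE)
    obtain B where B: "\<bar>poly q x\<bar> \<le> B" if "\<bar>x\<bar> \<le> 1" for x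
      using poly_bounded_on_Icc by blast
    show ?thesis
    proof (intro exI allI impI)
      fix x :: real assume x: "\<bar>x\<bar> \<le> 1"
      define r where "r = sqrt (1 - x\<^sup>2)"
      have r: "0 \<le> r" "r \<le> 1" "r\<^sup>2 = 1 - x\<^sup>2"
        using x by (auto simp: r_def abs_square_le_1)
      have "\<bar>r powi m * (x\<^sup>2 - 1) ^ k\<bar> \<le> 1"
      proof (cases "r = 0")
        case True then show ?thesis using k by (simp add: power_int_0_left_if)
      next
        case False
        have "x\<^sup>2 - 1 = - r\<^sup>2" using r by simp
        then have "\<bar>r powi m * (x\<^sup>2 - 1) ^ k\<bar> = inverse (r ^ k) * (r ^ k * r ^ k)"
          using r by (simp add: k power_int_minus abs_mult power_abs power_mult_distrib
              power2_eq_square)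
        also have "\<dots> = r ^ k" using False by simp
        also have "\<dots> \<le> 1" using r by (simp add: power_le_one)
        finally show ?thesis .
      qed
      moreover have "w x = (r powi m * (x\<^sup>2 - 1) ^ k) * poly q x"
        unfolding w_def k(3) q by (simp add: r_def poly_power power2_eq_square)
      ultimately show "\<bar>w x\<bar> \<le> 1 * B"
        unfolding abs_mult using B[OF x] by (simp only: abs_mult) (intro mult_mono, auto)
    qed
  qed
  then obtain B where B: "\<bar>w x\<bar> \<le> B" if "\<bar>x\<bar> \<le> 1" for x by metis
  define K where "K = (-1) powi m / (2 ^ l * fact l :: real)"
  have "assoc_legendre l m x = K * w x" for x
    by (simp add: assoc_legendre_def legendre_derivative_poly w_def K_def)
  then have "\<bar>assoc_legendre l m x\<bar> \<le> \<bar>K\<bar> * B" if "\<bar>x\<bar> \<le> 1" for x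
    using B[OF that] by (simp add: abs_mult mult_left_mono)
  then show ?thesis by blast
qed

lemma sphere_component_le_1: "p \<in> sphere 0 1 \<Longrightarrow> \<bar>p $ i\<bar> \<le> 1" for p :: "real ^ 3"
  using component_le_norm_cart[of p i] by simp

lemma square_integrable_sph_harm:
  assumes "\<bar>m\<bar> \<le> int l"
  shows "square_integrable sphere_measure (sph_harm_fun l m)"
proof -
  define K where
    "K = sqrt ((2 * real l + 1) * fact (nat (int l - m)) / (4 * pi * fact (nat (int l + m))))"
  define e where "e z = (if z = 0 then 1 else z / complex_of_real (cmod z))" for z
  define F where "F p = complex_of_real (K * assoc_legendre l m (p $ 3)) * e (Complex (p $ 1) (p $ 2)) powi m"
    for p :: "real ^ 3"
  have e: "exp (\<i> * of_int m * complex_of_real (Arg2pi z)) = e z powi m" for z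
  proof -
    have "exp (\<i> * complex_of_real (Arg2pi z)) = e z"
      using Arg2pi_eq[of z] by (auto simp: e_def field_simps)
    moreover have "\<i> * of_int m * complex_of_real (Arg2pi z) = of_int m * (\<i> * complex_of_real (Arg2pi z))"
      by simp
    ultimately show ?thesis
      by (simp only: exp_power_int[symmetric])
  qed
  have eq: "sph_harm_fun l m p = F p" if "p \<in> sphere 0 1" for p
    using sphere_component_le_1[OF that, of 3]
    by (simp add: sph_harm_fun_def sph_harm_coord_def F_def K_def e cos_arccos abs_le_iff)
  have powi [measurable (raw)]: "(\<lambda>x. g x powi k) \<in> borel_measurable N"
    if "g \<in> borel_measurable N" for g :: "'b \<Rightarrow> 'c::{real_normed_div_algebra, second_countable_topology}" and k N
    using that by (cases "k \<ge> 0") (auto simp: power_int_def)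
  have [measurable]: "poly q \<in> borel_measurable borel" for q :: "real poly"
    by (intro borel_measurable_continuous_onI continuous_intros)
  have [measurable]: "(\<lambda>p. p $ i) \<in> borel_measurable (borel :: (real ^ 3) measure)" for i
    by (intro borel_measurable_continuous_onI continuous_intros)
  have [measurable]: "e \<in> borel_measurable borel"
    unfolding e_def[abs_def] by measurable
  have [measurable]: "assoc_legendre l m \<in> borel_measurable borel"
    unfolding assoc_legendre_def[abs_def] legendre_derivative_poly by measurable
  have "F \<in> borel_measurable borel"
    unfolding F_def[abs_def] Complex_eq by measurable
  then have "F \<in> borel_measurable sphere_measure"
    unfolding measurable_cong_sets[OF sets_sphere_measure refl] by (rule measurable_restrict_space1)
  then have meas: "sph_harm_fun l m \<in> borel_measurable sphere_measure"
    by (subst measurable_cong[OF eq]) auto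
  obtain B where B: "\<bar>assoc_legendre l m x\<bar> \<le> B" if "\<bar>x\<bar> \<le> 1" for x
    using assoc_legendre_bounded[OF assms] by blast
  have "cmod (sph_harm_fun l m p) \<le> \<bar>K\<bar> * B" if "p \<in> sphere 0 1" for p
  proof -
    have "cmod (e z powi m) = 1" for z
      by (simp add: e[symmetric])
    then show ?thesis
      using B[OF sphere_component_le_1[OF that, of 3]]
      by (simp add: eq[OF that] F_def norm_mult abs_mult mult_left_mono)
  qed
  then have "(cmod (sph_harm_fun l m p))\<^sup>2 \<le> (\<bar>K\<bar> * B)\<^sup>2" if "p \<in> sphere 0 1" for p
    using that by (intro power_mono) auto
  then have "integrable sphere_measure (\<lambda>p. (cmod (sph_harm_fun l m p))\<^sup>2)"
    using meas by (intro finite_measure.integrable_const_bound[OF finite_measure_sphere_measure, where B = "(\<bar>K\<bar> * B)\<^sup>2"]) auto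
  with meas show ?thesis
    by (simp add: square_integrable_def)
qed

lift_definition sph_harm :: "nat \<Rightarrow> int \<Rightarrow> l2_sphere" is
  "\<lambda>l m. if \<bar>m\<bar> \<le> int l then sph_harm_fun l m else (\<lambda>_. 0)"
  by (auto simp: square_integrable_sph_harm) (simp add: square_integrable_def)

section \<open>Sobolev spaces and the operator\<close>

definition fl_coeff :: "l2_sphere \<Rightarrow> nat \<Rightarrow> int \<Rightarrow> complex" where
  "fl_coeff f l m = inner_l2 f (sph_harm l m)"

definition power_spectrum :: "nat \<Rightarrow> l2_sphere \<Rightarrow> real" where
  "power_spectrum l f = (\<Sum>m\<in>{- int l..int l}. (cmod (fl_coeff f l m))\<^sup>2)"

definition sobolev :: "real \<Rightarrow> l2_sphere set" where
  "sobolev s = {f. summable (\<lambda>l. real l powr (2 * s) * power_spectrum l f)}"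

definition sobolev_norm :: "real \<Rightarrow> l2_sphere \<Rightarrow> real" where
  "sobolev_norm s f = norm f + sqrt (\<Sum>l. real l powr (2 * s) * power_spectrum l f)"

definition gen_eigenvalue :: "real \<Rightarrow> nat \<Rightarrow> int \<Rightarrow> complex" where
  "gen_eigenvalue \<mu> l m = \<i> * of_real \<mu> * of_int m - of_nat l * (of_nat l + 1)"

text \<open>The operator \<open>\<Delta> + \<mu> \<partial>/\<partial>\<phi>\<close> in the weak sense; meaningful for \<open>u \<in> sobolev 2\<close>, where the series
  converges in \<open>L\<^sup>2\<close>.\<close>

definition sphere_gen :: "real \<Rightarrow> l2_sphere \<Rightarrow> l2_sphere" where
  "sphere_gen \<mu> u =
    (\<Sum>l. \<Sum>m\<in>{- int l..int l}. (gen_eigenvalue \<mu> l m * fl_coeff u l m) *\<^sub>C sph_harm l m)"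

section \<open>Calculus in a normed space given by a carrier and a norm\<close>

text \<open>The Sobolev spaces depend on a real parameter, so they cannot be types. The following notions
  refer to a subspace \<open>V\<close> of a real vector space, with a norm \<open>N\<close> on \<open>V\<close>.\<close>

definition tendsto_in ::
  "'v::real_vector set \<Rightarrow> ('v \<Rightarrow> real) \<Rightarrow> ('a \<Rightarrow> 'v) \<Rightarrow> 'v \<Rightarrow> 'a filter \<Rightarrow> bool" where
  "tendsto_in V N f x F \<longleftrightarrow>
    x \<in> V \<and> (\<forall>\<^sub>F a in F. f a \<in> V) \<and> ((\<lambda>a. N (f a - x)) \<longlongrightarrow> 0) F"

definition continuous_on_in ::
  "'v::real_vector set \<Rightarrow> ('v \<Rightarrow> real) \<Rightarrow> real set \<Rightarrow> (real \<Rightarrow> 'v) \<Rightarrow> bool" where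
  "continuous_on_in V N T u \<longleftrightarrow>
    (\<forall>t\<in>T. u t \<in> V) \<and> (\<forall>t\<in>T. tendsto_in V N u (u t) (at t within T))"

text \<open>The Bochner integral, as in \<^const>\<open>has_bochner_integral\<close>. Measurability of the functions
  \<open>N (f y - s i y)\<close>, together with the convergence of their integrals to \<open>0\<close>, makes \<open>f\<close> the
  almost everywhere limit of a subsequence of \<open>s\<close>, hence strongly measurable.\<close>

definition has_bochner_integral_in ::
  "'v::real_vector set \<Rightarrow> ('v \<Rightarrow> real) \<Rightarrow> 'a measure \<Rightarrow> ('a \<Rightarrow> 'v) \<Rightarrow> 'v \<Rightarrow> bool" where
  "has_bochner_integral_in V N M f x \<longleftrightarrow>
    f ` space M \<subseteq> V \<and>
    (\<exists>s. (\<forall>i. Bochner_Integration.simple_bochner_integrable M (s i) \<and> s i ` space M \<subseteq> V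
            \<and> (\<lambda>y. N (f y - s i y)) \<in> borel_measurable M)
       \<and> (\<lambda>i. \<integral>\<^sup>+y. ennreal (N (f y - s i y)) \<partial>M) \<longlonglongrightarrow> 0
       \<and> tendsto_in V N (\<lambda>i. Bochner_Integration.simple_bochner_integral M (s i)) x sequentially)"

section \<open>Subordinators and the nonlocal derivative\<close>

definition levy_measure :: "real measure \<Rightarrow> bool" where
  "levy_measure \<nu> \<longleftrightarrow>
    sets \<nu> = sets (restrict_space borel {0<..})
    \<and> (\<integral>\<^sup>+t. ennreal (min 1 t) \<partial>\<nu>) < \<infinity>
    \<and> emeasure \<nu> {0<..} = \<infinity>"

definition laplace_exponent :: "real measure \<Rightarrow> real \<Rightarrow> real" where
  "laplace_exponent \<nu> x = (\<integral>t. (1 - exp (- x * t)) \<partial>\<nu>)"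

definition levy_tail :: "real measure \<Rightarrow> real \<Rightarrow> real" where
  "levy_tail \<nu> t = measure \<nu> {t<..}"

text \<open>Left limits of the paths need not be required, as the paths are nondecreasing.\<close>

definition subordinator :: "'w measure \<Rightarrow> (real \<Rightarrow> 'w \<Rightarrow> real) \<Rightarrow> (real \<Rightarrow> real) \<Rightarrow> bool" where
  "subordinator M S \<Phi> \<longleftrightarrow>
    prob_space M
    \<and> (\<forall>t\<ge>0. S t \<in> borel_measurable M)
    \<and> (\<forall>\<omega>\<in>space M. S 0 \<omega> = 0)
    \<and> (\<forall>\<omega>\<in>space M. mono_on {0..} (\<lambda>t. S t \<omega>))
    \<and> (\<forall>\<omega>\<in>space M. \<forall>t\<ge>0. continuous (at_right t) (\<lambda>t. S t \<omega>))
    \<and> (\<forall>n t. 0 \<le> t 0 \<and> mono t \<longrightarrow>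
          prob_space.indep_vars M (\<lambda>_. borel) (\<lambda>i \<omega>. S (t (Suc i)) \<omega> - S (t i) \<omega>) {..<n::nat})
    \<and> (\<forall>r\<ge>0. \<forall>t\<ge>0. distr M borel (\<lambda>\<omega>. S (r + t) \<omega> - S r \<omega>) = distr M borel (S t))
    \<and> (\<forall>t\<ge>0. \<forall>x\<ge>0. (\<integral>\<omega>. exp (- x * S t \<omega>) \<partial>M) = exp (- t * \<Phi> x))"

text \<open>The infimum is over a nonempty set for almost every \<open>\<omega>\<close>, because \<open>S\<close> is almost surely
  unbounded.\<close>

definition inverse_subordinator :: "(real \<Rightarrow> 'w \<Rightarrow> real) \<Rightarrow> real \<Rightarrow> 'w \<Rightarrow> real" where
  "inverse_subordinator S t \<omega> = Inf {r. 0 < r \<and> t < S r \<omega>}"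

definition e_fun :: "'w measure \<Rightarrow> (real \<Rightarrow> 'w \<Rightarrow> real) \<Rightarrow> real \<Rightarrow> complex \<Rightarrow> complex" where
  "e_fun M S t z = (\<integral>\<omega>. exp (z * complex_of_real (inverse_subordinator S t \<omega>)) \<partial>M)"

text \<open>\<open>has_nonlocal_derivative V N \<nu> u w t\<close>: the nonlocal derivative of \<open>u\<close> at \<open>t > 0\<close> exists in
  \<open>(V, N)\<close> and equals \<open>w\<close>. Here \<open>u0\<close> is \<open>u(0\<^sup>+)\<close> and \<open>J\<close> is the integral to be differentiated.\<close>

definition has_nonlocal_derivative ::
  "'v::real_vector set \<Rightarrow> ('v \<Rightarrow> real) \<Rightarrow> real measure \<Rightarrow> (real \<Rightarrow> 'v) \<Rightarrow> 'v \<Rightarrow> real \<Rightarrow> bool" where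
  "has_nonlocal_derivative V N \<nu> u w t \<longleftrightarrow>
    (\<exists>u0 J. tendsto_in V N u u0 (at_right 0)
      \<and> (\<forall>\<^sub>F r in nhds t. has_bochner_integral_in V N (lebesgue_on {0<..<r})
            (\<lambda>\<tau>. levy_tail \<nu> (r - \<tau>) *\<^sub>R (u \<tau> - u0)) (J r))
      \<and> tendsto_in V N (\<lambda>h. (1 / h) *\<^sub>R (J (t + h) - J t)) w (at 0))"

definition nonlocal_derivative ::
  "'v::real_vector set \<Rightarrow> ('v \<Rightarrow> real) \<Rightarrow> real measure \<Rightarrow> (real \<Rightarrow> 'v) \<Rightarrow> real \<Rightarrow> 'v" where
  "nonlocal_derivative V N \<nu> u t = (THE w. has_nonlocal_derivative V N \<nu> u w t)"

definition strong_solution ::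
  "real measure \<Rightarrow> real \<Rightarrow> real \<Rightarrow> l2_sphere \<Rightarrow> (real \<Rightarrow> l2_sphere) \<Rightarrow> bool" where
  "strong_solution \<nu> \<mu> s f u \<longleftrightarrow>
    continuous_on_in (sobolev s) (sobolev_norm s) {0..} u
    \<and> continuous_on_in (sobolev (s + 2)) (sobolev_norm (s + 2)) {0<..} u
    \<and> (\<forall>t>0. \<exists>w. has_nonlocal_derivative (sobolev s) (sobolev_norm s) \<nu> u w t)
    \<and> continuous_on_in (sobolev s) (sobolev_norm s) {0<..}
        (nonlocal_derivative (sobolev s) (sobolev_norm s) \<nu> u)
    \<and> (\<forall>t>0. nonlocal_derivative (sobolev s) (sobolev_norm s) \<nu> u t = sphere_gen \<mu> (u t))
    \<and> u 0 = f"

end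

theory Submission
  imports Defs
begin

text \<open>
In the basis of spherical harmonics the problem decouples. The coefficient \<open>a = u\<^sub>l\<^sub>m\<close> of a solution
has to satisfy the scalar equation \<open>d\<^sup>\<Phi> a / dt\<^sup>\<Phi> = z a\<close>, \<open>a 0 = f\<^sub>l\<^sub>m\<close>, where
\<open>z = i \<mu> m - l (l + 1)\<close> has real part at most \<open>0\<close>. It remains to solve this equation with bounds that
are uniform in \<open>z\<close>, and to pass between scalar calculus and calculus in the Sobolev space.

\<^bold>\<open>The scalar equation.\<close> Write \<open>e(t)\<close> for \<open>E (exp (z L t))\<close>, \<open>tail\<close> for the tail of the Levy measure and
\<open>*\<close> for convolution on \<open>[0, t]\<close>. At an independent exponential time \<open>T\<close> of rate \<open>x\<close> the events \<open>a < L T\<close>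
and \<open>S a < T\<close> agree up to null sets, so \<open>L T\<close> is exponential of rate \<open>\<Phi> x\<close>; hence the Laplace transform
of \<open>e\<close> at \<open>x\<close> is \<open>\<Phi> x / (x (\<Phi> x - z))\<close> (\<open>laplace_e\<close>). That of \<open>tail\<close> is \<open>\<Phi> x / x\<close>, so the two sides of
\<open>tail * (1 - e) = - z (1 * e)\<close> have the same transform, and they agree because a continuous function is
determined by its Laplace transform (\<open>e_relaxation_equation\<close>). This is the scalar equation, integrated
once. Two consequences carry the rest of the proof.

\<^item> For \<open>z = - c\<close> the function \<open>e\<close> is nonincreasing and at most \<open>1\<close>, so the equation gives
  \<open>c t e(t) \<le> c (1 * e)(t) \<le> \<integral>\<^sub>0\<^sup>t tail\<close> (\<open>er_decay\<close>). The bound does not depend on \<open>c\<close>. In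
  general \<open>|e|\<close> is at most the function for the exponent \<open>Re z\<close>, and \<open>|z| \<le> (1 + |\<mu>|) |Re z|\<close>; so on
  \<open>[a, \<infinity>)\<close>, \<open>a > 0\<close>, all the functions \<open>z e\<close> are bounded by one constant. This is the gain of two derivatives for
  positive times.
\<^item> The difference \<open>w\<close> of two solutions satisfies \<open>tail * w = z (1 * w)\<close>. Convolving with \<open>e\<close> in two ways
  gives \<open>z (1 * 1 * w) = 0\<close>, whence \<open>w = 0\<close> (\<open>relaxation_equation_unique\<close>).

\<^bold>\<open>From scalars to the Sobolev space.\<close> The spherical harmonics are an orthonormal basis
(\<open>sph_harm_orthonormal\<close>, \<open>sph_harm_complete\<close>) and \<open>L\<^sup>2\<close> is complete, so functions are the same as square
summable families of coefficients. If the coefficients converge and are dominated by those of a fixed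
element of the Sobolev space, then there is convergence in the Sobolev norm (\<open>sobolev_tendstoI\<close>), and a
function whose coefficients are integrable and dominated in the same way has a Bochner integral, which is
computed coefficientwise (\<open>has_bochner_integral_in_sobolevI\<close>).

Existence: the integral in the nonlocal derivative of \<open>u\<close> has the coefficients
\<open>f\<^sub>l\<^sub>m z \<integral>\<^sub>0\<^sup>r e\<close>; the uniform bound on \<open>z e\<close> makes their difference quotients dominated, so they may be
differentiated term by term, which gives \<open>f\<^sub>l\<^sub>m z e(t)\<close>, the coefficients of the generator applied to \<open>u t\<close>.
Uniqueness: the coefficients are continuous functionals, so those of any strong solution satisfy the
integrated scalar equation.
\<close>

section \<open>The Hilbert space of square integrable functions on the sphere\<close>

lemma square_integrable_times_cnj:
  assumes "square_integrable M f" "square_integrable M g"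
  shows "integrable M (\<lambda>x. f x * cnj (g x))"
proof (rule Bochner_Integration.integrable_bound[OF square_integrable_mult[OF assms]])
  show "(\<lambda>x. f x * cnj (g x)) \<in> borel_measurable M"
    using assms by (auto simp: square_integrable_def intro!: borel_measurable_times
      intro: measurable_compose[OF _ borel_measurable_cnj])
qed (auto simp: norm_mult)

lemma inner_l2_add_left: "inner_l2 (f + g) h = inner_l2 f h + inner_l2 g h"
  by transfer (auto simp: distrib_right square_integrable_times_cnj)

lemma inner_l2_scaleC_left: "inner_l2 (c *\<^sub>C f) h = c * inner_l2 f h"
  by transfer (simp add: mult.assoc)

lemma inner_l2_commute: "inner_l2 f g = cnj (inner_l2 g f)"
proof transfer
  fix f g :: "real ^ 3 \<Rightarrow> complex"
  have "cnj (\<integral>p. g p * cnj (f p) \<partial>sphere_measure) = (\<integral>p. cnj (g p * cnj (f p)) \<partial>sphere_measure)"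
    by (rule Bochner_Integration.integral_cnj[symmetric])
  then show "(\<integral>p. f p * cnj (g p) \<partial>sphere_measure) = cnj (\<integral>p. g p * cnj (f p) \<partial>sphere_measure)"
    by (simp add: mult.commute)
qed

lemma inner_l2_self: "inner_l2 f f = complex_of_real ((norm f)\<^sup>2)"
proof transfer
  fix f :: "real ^ 3 \<Rightarrow> complex"
  have "(\<integral>p. f p * cnj (f p) \<partial>sphere_measure) = (\<integral>p. complex_of_real ((cmod (f p))\<^sup>2) \<partial>sphere_measure)"
    by (simp only: complex_norm_square)
  then show "(\<integral>p. f p * cnj (f p) \<partial>sphere_measure)
      = complex_of_real ((sqrt (\<integral>p. (cmod (f p))\<^sup>2 \<partial>sphere_measure))\<^sup>2)"
    by (simp del: of_real_power)
qed

lemma scaleC_l2_add_left: "(c + d) *\<^sub>C f = c *\<^sub>C f + d *\<^sub>C f"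
  by transfer
    (auto simp: distrib_right intro!: square_integrable_add square_integrable_scale)

lemma scaleC_l2_scaleC: "c *\<^sub>C d *\<^sub>C f = (c * d) *\<^sub>C f"
  by transfer (auto simp: mult.assoc intro!: square_integrable_scale)

lemma scaleC_l2_scaleR: "of_real r *\<^sub>C f = r *\<^sub>R f"
  by transfer (auto simp: scaleR_conv_of_real intro!: square_integrable_scale)

lemma inner_l2_scaleR_left: "inner_l2 (r *\<^sub>R f) h = r *\<^sub>R inner_l2 f h"
  by (simp add: inner_l2_scaleC_left scaleR_conv_of_real flip: scaleC_l2_scaleR)

lemma inner_l2_minus_left: "inner_l2 (- f) h = - inner_l2 f h"
  using inner_l2_scaleR_left[of "-1" f h] by simp

lemma inner_l2_diff_left: "inner_l2 (f - g) h = inner_l2 f h - inner_l2 g h"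
  using inner_l2_add_left[of f "- g" h] by (simp add: inner_l2_minus_left)

lemma inner_l2_zero_left [simp]: "inner_l2 0 h = 0"
  using inner_l2_diff_left[of h h h] by simp

lemma inner_l2_sum_left: "inner_l2 (\<Sum>i\<in>A. f i) h = (\<Sum>i\<in>A. inner_l2 (f i) h)"
  by (induction A rule: infinite_finite_induct) (simp_all add: inner_l2_add_left)

lemma inner_l2_diff_right: "inner_l2 h (f - g) = inner_l2 h f - inner_l2 h g"
  by (metis inner_l2_commute inner_l2_diff_left complex_cnj_diff)

lemma norm_diff_l2_sphere_squared:
  "(norm (f - g))\<^sup>2 = (norm f)\<^sup>2 + (norm g)\<^sup>2 - 2 * Re (inner_l2 f g)"
proof -
  have "(norm (f - g))\<^sup>2 = Re (inner_l2 (f - g) (f - g))"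
    by (simp add: inner_l2_self)
  also have "\<dots> = Re (inner_l2 f f) + Re (inner_l2 g g) - (Re (inner_l2 f g) + Re (inner_l2 g f))"
    by (simp add: inner_l2_diff_left inner_l2_diff_right)
  also have "Re (inner_l2 g f) = Re (inner_l2 f g)"
    by (subst inner_l2_commute) simp
  finally show ?thesis by (simp add: inner_l2_self)
qed

lemma l2_sphere_representative:
  obtains g where "square_integrable sphere_measure g" "f = abs_l2_sphere g"
proof
  show "f = abs_l2_sphere (rep_l2_sphere f)"
    using Quotient_abs_rep[OF Quotient_l2_sphere] by simp
  show "square_integrable sphere_measure (rep_l2_sphere f)"
    using Quotient_rep_reflp[OF Quotient_l2_sphere, of f] by simp
qed

lemma norm_abs_l2_sphere_diff:
  assumes f: "square_integrable sphere_measure f" and g: "square_integrable sphere_measure g"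
  shows "norm (abs_l2_sphere f - abs_l2_sphere g) = sqrt (\<integral>p. (cmod (f p - g p))\<^sup>2 \<partial>sphere_measure)"
proof -
  have mg: "square_integrable sphere_measure (\<lambda>p. - g p)"
    using g by (auto simp: square_integrable_def)
  have "abs_l2_sphere f - abs_l2_sphere g = abs_l2_sphere (\<lambda>p. f p + - g p)"
    unfolding minus_l2_sphere_def using f g mg
    by (simp add: uminus_l2_sphere.abs_eq plus_l2_sphere.abs_eq)
  then show ?thesis
    using square_integrable_add[OF f mg] by (simp add: norm_l2_sphere.abs_eq)
qed

text \<open>The estimate \<open>2 d \<le> 2\<^sup>k d\<^sup>2 + 2\<^sup>-\<^sup>k\<close> turns the bounds on the squares of the increments into summable
  bounds on their integrals, because the measure is finite. So the increments are summable almost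
  everywhere and \<open>y\<close> converges almost everywhere; Fatou's lemma bounds the distance to the limit.\<close>

lemma (in finite_measure) square_integrable_Cauchy_subseq_limit:
  fixes y :: "nat \<Rightarrow> 'a \<Rightarrow> complex"
  assumes sq: "\<And>k. square_integrable M (y k)"
    and close: "\<And>j k. k \<le> j \<Longrightarrow> (\<integral>p. (cmod (y j p - y k p))\<^sup>2 \<partial>M) \<le> (1/4) ^ k"
  obtains g where "square_integrable M g"
    and "\<And>k. (\<integral>p. (cmod (g p - y k p))\<^sup>2 \<partial>M) \<le> (1/4) ^ k"
proof -
  have [measurable]: "y k \<in> borel_measurable M" for k
    using sq by (auto simp: square_integrable_def)
  have sqd: "square_integrable M (\<lambda>p. y j p - y k p)" for j k
    using square_integrable_add[OF sq[of j] square_integrable_scale[OF sq[of k], of "-1"]] by simp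
  define d where "d k p = cmod (y (Suc k) p - y k p)" for k p
  have [measurable]: "d k \<in> borel_measurable M" for k
    unfolding d_def[abs_def] by measurable
  define c where "c = (1 + measure M (space M)) / 2"
  have dint: "(\<integral>\<^sup>+p. ennreal (d k p) \<partial>M) \<le> ennreal (c * (1/2) ^ k)" for k
  proof -
    have i: "integrable M (\<lambda>p. (d k p)\<^sup>2)"
      using sqd[of "Suc k" k] by (simp add: d_def square_integrable_def)
    have *: "d k p \<le> (2 ^ k * (d k p)\<^sup>2 + (1/2) ^ k) / 2" for p
    proof -
      have "0 \<le> (1/2) ^ k * (2 ^ k * d k p - 1)\<^sup>2" by simp
      also have "\<dots> = ((1/2) ^ k * 2 ^ k) * (2 ^ k * (d k p)\<^sup>2) - 2 * ((1/2) ^ k * 2 ^ k) * d k p + (1/2) ^ k"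
        by (simp add: power2_eq_square algebra_simps)
      also have "(1/2) ^ k * 2 ^ k = (1::real)" by (simp flip: power_mult_distrib)
      finally show ?thesis by simp
    qed
    have "(\<integral>\<^sup>+p. ennreal (d k p) \<partial>M) \<le> (\<integral>\<^sup>+p. ennreal ((2 ^ k * (d k p)\<^sup>2 + (1/2) ^ k) / 2) \<partial>M)"
      by (intro nn_integral_mono ennreal_leI *)
    also have "\<dots> = ennreal (\<integral>p. (2 ^ k * (d k p)\<^sup>2 + (1/2) ^ k) / 2 \<partial>M)"
      using i by (intro nn_integral_eq_integral) auto
    also have "(\<integral>p. (2 ^ k * (d k p)\<^sup>2 + (1/2) ^ k) / 2 \<partial>M)
        = (2 ^ k * (\<integral>p. (d k p)\<^sup>2 \<partial>M) + (1/2) ^ k * measure M (space M)) / 2"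
      using i by simp
    also have "\<dots> \<le> (2 ^ k * (1/4) ^ k + (1/2) ^ k * measure M (space M)) / 2"
      using close[of k "Suc k"] by (simp add: d_def)
    also have "2 ^ k * (1/4) ^ k = ((1/2) ^ k :: real)" by (simp flip: power_mult_distrib)
    also have "((1/2) ^ k + (1/2) ^ k * measure M (space M)) / 2 = c * (1/2) ^ k"
      by (simp add: c_def field_simps)
    finally show ?thesis by (simp add: ennreal_leI)
  qed
  have c0: "0 \<le> c" by (simp add: c_def)
  have "(\<integral>\<^sup>+p. (\<Sum>k. ennreal (d k p)) \<partial>M) = (\<Sum>k. \<integral>\<^sup>+p. ennreal (d k p) \<partial>M)"
    by (intro nn_integral_suminf) auto
  also have "\<dots> \<le> (\<Sum>k. ennreal (c * (1/2) ^ k))"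
    by (intro suminf_le dint) auto
  also have "\<dots> = ennreal (\<Sum>k. c * (1/2) ^ k)"
    using c0 by (intro suminf_ennreal2) auto
  also have "\<dots> < \<infinity>" by simp
  finally have "(\<integral>\<^sup>+p. (\<Sum>k. ennreal (d k p)) \<partial>M) \<noteq> \<infinity>" by simp
  then have "AE p in M. (\<Sum>k. ennreal (d k p)) \<noteq> \<infinity>"
    by (intro nn_integral_noteq_infinite) auto
  then have conv: "AE p in M. convergent (\<lambda>k. y k p)"
  proof eventually_elim
    case (elim p)
    have "summable (\<lambda>k. d k p)"
      by (rule summable_suminf_not_top) (use elim in \<open>auto simp: d_def\<close>)
    then have "summable (\<lambda>k. y (Suc k) p - y k p)"
      unfolding d_def by (rule summable_norm_cancel)
    then have "convergent (\<lambda>n. y n p - y 0 p)"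
      by (simp add: summable_iff_convergent sum_lessThan_telescope[of "\<lambda>k. y k p"])
    then have "convergent (\<lambda>n. (y n p - y 0 p) + y 0 p)"
      by (intro convergent_add convergent_const)
    then show ?case by simp
  qed
  define g where "g p = lim (\<lambda>k. y k p)" for p
  have [measurable]: "g \<in> borel_measurable M"
    unfolding g_def[abs_def] by measurable
  have nn: "(\<integral>\<^sup>+p. ennreal ((cmod (g p - y k p))\<^sup>2) \<partial>M) \<le> ennreal ((1/4) ^ k)" for k
  proof -
    have "(\<integral>\<^sup>+p. ennreal ((cmod (g p - y k p))\<^sup>2) \<partial>M)
        = (\<integral>\<^sup>+p. liminf (\<lambda>j. ennreal ((cmod (y j p - y k p))\<^sup>2)) \<partial>M)"
    proof (rule nn_integral_cong_AE, use conv in eventually_elim)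
      case (elim p)
      then have "(\<lambda>j. y j p) \<longlonglongrightarrow> g p" by (simp add: g_def convergent_LIMSEQ_iff)
      then have "(\<lambda>j. ennreal ((cmod (y j p - y k p))\<^sup>2)) \<longlonglongrightarrow> ennreal ((cmod (g p - y k p))\<^sup>2)"
        by (intro tendsto_ennrealI tendsto_intros)
      from lim_imp_Liminf[OF _ this] show ?case by simp
    qed
    also have "\<dots> \<le> liminf (\<lambda>j. \<integral>\<^sup>+p. ennreal ((cmod (y j p - y k p))\<^sup>2) \<partial>M)"
      by (intro nn_integral_liminf) auto
    also have "\<dots> \<le> liminf (\<lambda>j. ennreal ((1/4) ^ k))"
    proof (rule Liminf_mono, use eventually_ge_at_top[of k] in eventually_elim)
      case (elim j)
      have "(\<integral>\<^sup>+p. ennreal ((cmod (y j p - y k p))\<^sup>2) \<partial>M) = ennreal (\<integral>p. (cmod (y j p - y k p))\<^sup>2 \<partial>M)"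
        using sqd[of j k] by (intro nn_integral_eq_integral) (auto simp: square_integrable_def)
      with close[OF elim] show ?case by (simp add: ennreal_leI)
    qed
    also have "\<dots> = ennreal ((1/4) ^ k)" by (simp add: Liminf_const)
    finally show ?thesis .
  qed
  have int: "integrable M (\<lambda>p. (cmod (g p - y k p))\<^sup>2)" for k
    using nn[of k] by (intro integrableI_nonneg) (auto intro: order_le_less_trans)
  have "square_integrable M (\<lambda>p. g p - y 0 p)"
    using int by (simp add: square_integrable_def)
  from square_integrable_add[OF this sq[of 0]] have "square_integrable M g" by simp
  moreover have "(\<integral>p. (cmod (g p - y k p))\<^sup>2 \<partial>M) \<le> (1/4) ^ k" for k
    using nn[of k] int[of k] by (subst (asm) nn_integral_eq_integral) auto
  ultimately show thesis by (rule that)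
qed

text \<open>A Cauchy sequence has a subsequence with geometrically small increments, and it converges as soon as
  the subsequence does.\<close>

instance l2_sphere :: banach
proof
  fix X :: "nat \<Rightarrow> l2_sphere"
  assume "Cauchy X"
  have "\<exists>N. \<forall>m\<ge>N. \<forall>n\<ge>N. norm (X m - X n) < (1/2) ^ k" for k
    by (rule CauchyD[OF \<open>Cauchy X\<close>]) simp
  then obtain N where N: "\<And>k m n. N k \<le> m \<Longrightarrow> N k \<le> n \<Longrightarrow> norm (X m - X n) < (1/2) ^ k"
    by metis
  define r where "r k = (\<Sum>i\<le>k. N i)" for k
  have Nr: "N k \<le> r j" if "k \<le> j" for j k
    unfolding r_def using that by (intro member_le_sum) auto
  have "\<exists>y. square_integrable sphere_measure y \<and> X (r k) = abs_l2_sphere y" for k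
    by (metis l2_sphere_representative)
  then obtain y where y: "\<And>k. square_integrable sphere_measure (y k)" "\<And>k. X (r k) = abs_l2_sphere (y k)"
    by metis
  have sq4: "sqrt ((1/4) ^ k) = (1/2 :: real) ^ k" for k
    by (simp add: real_sqrt_power real_sqrt_divide)
  interpret finite_measure sphere_measure by (rule finite_measure_sphere_measure)
  obtain g where g: "square_integrable sphere_measure g"
      "\<And>k. (\<integral>p. (cmod (g p - y k p))\<^sup>2 \<partial>sphere_measure) \<le> (1/4) ^ k"
  proof (rule square_integrable_Cauchy_subseq_limit[OF y(1)])
    fix j k :: nat assume "k \<le> j"
    then have "norm (X (r j) - X (r k)) \<le> (1/2) ^ k"
      using N[of k "r j" "r k"] Nr[of k j] Nr[of k k] by simp
    then have "sqrt (\<integral>p. (cmod (y j p - y k p))\<^sup>2 \<partial>sphere_measure) \<le> sqrt ((1/4) ^ k)"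
      by (simp add: y norm_abs_l2_sphere_diff sq4)
    then show "(\<integral>p. (cmod (y j p - y k p))\<^sup>2 \<partial>sphere_measure) \<le> (1/4) ^ k" by simp
  qed blast
  have close: "norm (abs_l2_sphere g - X (r k)) \<le> (1/2) ^ k" for k
    using real_sqrt_le_mono[OF g(2)[of k]] by (simp add: y norm_abs_l2_sphere_diff[OF g(1)] sq4)
  have "X \<longlonglongrightarrow> abs_l2_sphere g"
  proof (rule LIMSEQ_I)
    fix e :: real assume "0 < e"
    then obtain k where k: "(1/2) ^ k < e / 2"
      using real_arch_pow_inv[of "e/2" "1/2"] by auto
    show "\<exists>no. \<forall>n\<ge>no. norm (X n - abs_l2_sphere g) < e"
    proof (intro exI allI impI)
      fix n assume "N k \<le> n"
      then have "norm (X n - X (r k)) < (1/2) ^ k"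
        using N Nr by blast
      moreover have "norm (X n - abs_l2_sphere g) \<le> norm (X n - X (r k)) + norm (abs_l2_sphere g - X (r k))"
        using norm_triangle_ineq4[of "X n - X (r k)" "abs_l2_sphere g - X (r k)"] by simp
      ultimately show "norm (X n - abs_l2_sphere g) < e"
        using close[of k] k by linarith
    qed
  qed
  then show "convergent X" by (rule convergentI)
qed

section \<open>Rodrigues polynomials\<close>

definition Lquad :: "real poly" where "Lquad = [:-1, 0, 1:]"

definition pX :: "real poly" where "pX = [:0, 1:]"

lemma pderiv_Lquad [simp]: "pderiv Lquad = smult 2 pX"
  and pderiv_pX [simp]: "pderiv pX = 1"
  and poly_Lquad [simp]: "poly Lquad x = x\<^sup>2 - 1"
  and poly_pX [simp]: "poly pX x = x"
  by (simp_all add: Lquad_def pX_def pderiv_pCons power2_eq_square)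

lemma degree_Lquad [simp]: "degree Lquad = 2"
  and lead_coeff_Lquad [simp]: "coeff Lquad 2 = 1"
  and Lquad_nonzero [simp]: "Lquad \<noteq> 0"
  by (simp_all add: Lquad_def numeral_2_eq_2)

text \<open>By Rodrigues' formula, \<open>rodrigues l (l + n)\<close> is the \<open>n\<close>-th derivative of the Legendre polynomial of
  degree \<open>l\<close>, times \<open>2\<^sup>l l!\<close>. The values \<open>rodrigues l n\<close> for \<open>n < l\<close> occur for harmonics of negative order.\<close>

definition rodrigues :: "nat \<Rightarrow> nat \<Rightarrow> real poly" where
  "rodrigues l n = (pderiv ^^ n) (Lquad ^ l)"

lemma rodrigues_Suc: "rodrigues l (Suc n) = pderiv (rodrigues l n)"
  by (simp add: rodrigues_def)

lemma pderiv_funpow_commute: "(pderiv ^^ n) (pderiv p) = pderiv ((pderiv ^^ n) p)"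
  by (metis comp_apply funpow_Suc_right funpow.simps(2))

text \<open>Differentiating \<open>(x\<^sup>2 - 1) v' = 2 l x v\<close>, where \<open>v = (x\<^sup>2 - 1)\<^sup>l\<close>, \<open>n + 1\<close> times.\<close>

lemma rodrigues_ode:
  "Lquad * rodrigues l (n + 2) = smult (2 * (of_nat l - of_nat n - 1)) (pX * rodrigues l (n + 1))
     + smult ((of_nat n + 1) * (2 * of_nat l - of_nat n)) (rodrigues l n)"
proof (induction n)
  case 0
  have base: "Lquad * pderiv (Lquad ^ l) = smult (2 * of_nat l) (pX * Lquad ^ l)"
  proof (cases l)
    case (Suc k)
    have "pderiv (Lquad ^ Suc k) = smult (2 * (of_nat k + 1)) (Lquad ^ k * pX)"
      by (simp add: pderiv_power_Suc algebra_simps del: power_Suc)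
    then show ?thesis
      using Suc by (simp add: algebra_simps)
  qed simp
  have "pderiv (Lquad * pderiv (Lquad ^ l)) = pderiv (smult (2 * of_nat l) (pX * Lquad ^ l))"
    by (simp only: base)
  then show ?case
    by (simp add: rodrigues_def numeral_2_eq_2 pderiv_mult pderiv_smult pderiv_pCons poly_eq_poly_eq_iff[symmetric] fun_eq_iff algebra_simps)
next
  case (Suc n)
  have "pderiv (Lquad * rodrigues l (n + 2)) = pderiv (smult (2 * (of_nat l - of_nat n - 1)) (pX * rodrigues l (n + 1))
     + smult ((of_nat n + 1) * (2 * of_nat l - of_nat n)) (rodrigues l n))"
    by (simp only: Suc.IH)
  then show ?case
    by (simp add: rodrigues_Suc pderiv_mult pderiv_smult pderiv_add pderiv_pCons poly_eq_poly_eq_iff[symmetric] fun_eq_iff algebra_simps)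
qed

text \<open>As functions of \<open>k\<close>, both sides obey the recursion of order two that \<open>rodrigues_ode\<close> provides, read
  upwards from \<open>l\<close> on the left and downwards from \<open>l\<close> on the right, and they agree for \<open>k = 0\<close> and \<open>k = 1\<close>.
  The identity relates the harmonics of orders \<open>k\<close> and \<open>- k\<close>, and it removes the weight \<open>(1 - x\<^sup>2)\<^sup>k\<close> from
  the integrals of products of associated Legendre functions.\<close>

lemma rodrigues_reflection:
  assumes "k \<le> l"
  shows "smult (fact (l - k)) (Lquad ^ k * rodrigues l (l + k)) = smult (fact (l + k)) (rodrigues l (l - k))"
  using assms
proof (induction k rule: less_induct)
  case (less k)
  consider "k = 0" | "k = 1" | j where "k = j + 2" by (metis One_nat_def add_2_eq_Suc' not0_implies_Suc)
  then show ?case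
  proof cases
    case 2
    then obtain n where l: "l = Suc n" using less.prems by (cases l) auto
    have "Lquad * rodrigues l (n + 2) = smult ((of_nat n + 1) * (of_nat n + 2)) (rodrigues l n)"
      unfolding rodrigues_ode by (simp add: l algebra_simps)
    then show ?thesis
      by (simp add: 2 l algebra_simps)
  next
    case (3 j)
    then obtain i where l: "l = i + j + 2" using less.prems by (metis add.assoc add.commute le_Suc_ex)
    \<comment> \<open>\<open>N\<close> is \<open>l + j\<close>. Below, \<open>1\<close> and \<open>2\<close> are the differential equation at the orders \<open>l + j\<close> and \<open>l - j - 2\<close>, and \<open>3\<close> and \<open>4\<close> are the induction hypotheses.\<close>
    define N where "N = real (i + 2 * j + 2)"
    have IH1: "smult (fact (i + 1)) (Lquad ^ (j + 1) * rodrigues l (l + j + 1)) = smult (fact (l + j + 1)) (rodrigues l (i + 1))"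
      using less.IH[of "j + 1"] 3 l by (simp add: add.assoc)
    have IH2: "smult (fact (i + 2)) (Lquad ^ j * rodrigues l (l + j)) = smult (fact (l + j)) (rodrigues l (i + 2))"
      using less.IH[of j] 3 l by simp
    have "poly (smult (fact i) (Lquad ^ (j + 2) * rodrigues l (l + j + 2))) x
        = poly (smult (fact (l + j + 2)) (rodrigues l i)) x" for x
    proof -
      define V where "V = poly Lquad x"
      define W where "W = V ^ j"
      define F :: real where "F = fact i"
      define G :: real where "G = fact (l + j)"
      define a where "a = poly (rodrigues l (l + j + 2)) x"
      define b where "b = poly (rodrigues l (l + j + 1)) x"
      define c where "c = poly (rodrigues l (l + j)) x"
      define p where "p = poly (rodrigues l (i + 2)) x"
      define q where "q = poly (rodrigues l (i + 1)) x"
      define r where "r = poly (rodrigues l i) x"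
      note defs = V_def W_def F_def G_def a_def b_def c_def p_def q_def r_def N_def
      have 1: "V * a = - 2 * (real j + 1) * x * b + (N + 1) * (real i + 2) * c"
        using arg_cong[OF rodrigues_ode[of l "l + j"], of "\<lambda>p. poly p x"]
        by (simp add: defs l algebra_simps)
      have 2: "V * p = 2 * (real j + 1) * x * q + (real i + 1) * (N + 2) * r"
        using arg_cong[OF rodrigues_ode[of l i], of "\<lambda>p. poly p x"]
        by (simp add: defs l algebra_simps)
      have 3: "(real i + 1) * F * (V * W * b) = (N + 1) * G * q"
        using arg_cong[OF IH1, of "\<lambda>p. poly p x"] by (simp add: defs poly_power l algebra_simps)
      have 4: "(real i + 2) * (real i + 1) * F * (W * c) = G * p"
        using arg_cong[OF IH2, of "\<lambda>p. poly p x"] by (simp add: defs poly_power l algebra_simps)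
      have "(real i + 1) * (F * (V * V * W * a)) = (real i + 1) * F * V * W * (V * a)"
        by (simp add: algebra_simps)
      also have "\<dots> = - 2 * (real j + 1) * x * ((real i + 1) * F * (V * W * b))
          + (N + 1) * V * ((real i + 2) * (real i + 1) * F * (W * c))"
        unfolding 1 by (simp add: algebra_simps)
      also have "\<dots> = (N + 1) * G * (V * p - 2 * (real j + 1) * x * q)"
        unfolding 3 4 by (simp add: algebra_simps)
      also have "\<dots> = (real i + 1) * ((N + 2) * (N + 1) * G * r)"
        unfolding 2 by (simp add: algebra_simps)
      finally have "F * (V * V * W * a) = (N + 2) * (N + 1) * G * r" by simp
      then show ?thesis
        by (simp add: defs poly_power l algebra_simps)
    qed
    then show ?thesis
      unfolding poly_eq_poly_eq_iff[symmetric] fun_eq_iff using 3 l by (simp add: add.assoc)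
  qed simp
qed

text \<open>The integral of \<open>p\<close> over \<open>[-1, 1]\<close> after the substitution \<open>x = cos \<theta>\<close>, the form in which spherical
  coordinates produce it.\<close>

definition poly_integral :: "real poly \<Rightarrow> real" where
  "poly_integral p = (\<integral>\<theta>. indicator {0..pi} \<theta> *\<^sub>R (poly p (cos \<theta>) * sin \<theta>) \<partial>lborel)"

lemma poly_integral_integrable:
  "integrable lborel (\<lambda>\<theta>. indicator {0..pi} \<theta> *\<^sub>R (poly p (cos \<theta>) * sin \<theta>))"
  by (intro borel_integrable_compact continuous_intros) auto

lemma poly_integral_add: "poly_integral (p + q) = poly_integral p + poly_integral q"
  unfolding poly_integral_def
  by (subst Bochner_Integration.integral_add[OF poly_integral_integrable poly_integral_integrable, symmetric])
    (simp add: algebra_simps)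

lemma poly_integral_smult: "poly_integral (smult c p) = c * poly_integral p"
  unfolding poly_integral_def
  by (subst integral_mult_right_zero[symmetric]) (simp add: algebra_simps)

lemma poly_integral_neg_power: "poly_integral ((- 1) ^ k * p) = (- 1) ^ k * poly_integral p"
proof -
  have "(- 1) ^ k * p = smult ((- 1) ^ k) p" by (cases "even k") auto
  then show ?thesis by (simp only: poly_integral_smult)
qed

lemma poly_integral_pderiv: "poly_integral (pderiv p) = poly p 1 - poly p (- 1)"
proof -
  have "poly_integral (pderiv p) = - poly p (cos pi) - (- poly p (cos 0))"
    unfolding poly_integral_def
  proof (rule integral_FTC_Icc)
    show "((\<lambda>\<theta>. - poly p (cos \<theta>)) has_vector_derivative poly (pderiv p) (cos \<theta>) * sin \<theta>) (at \<theta> within {0..pi})" for \<theta>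
      unfolding has_real_derivative_iff_has_vector_derivative[symmetric]
      by (rule DERIV_subset[where s=UNIV]) (auto intro!: derivative_eq_intros)
  qed (auto intro!: continuous_intros)
  then show ?thesis by simp
qed

lemma rodrigues_boundary:
  assumes "n < l" "x\<^sup>2 = 1"
  shows "poly (rodrigues l n) x = 0"
proof -
  have "Lquad ^ (l - n) dvd rodrigues l n"
    unfolding rodrigues_def using assms by (intro power_dvd_pderiv_funpow) auto
  then obtain q where "rodrigues l n = Lquad ^ (l - n) * q" by (auto elim: dvdE)
  moreover have "poly Lquad x = 0" using assms by simp
  ultimately show ?thesis using assms by (simp add: poly_power zero_power)
qed

text \<open>Integration by parts. When one derivative is moved, the total order in the boundary terms is
  \<open>l + k - 1\<close>, so that one factor is differentiated too few times to lose its zeros at \<open>\<plusminus>1\<close>.\<close>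

lemma poly_integral_rodrigues_shift:
  assumes "a + b = l + k"
  shows "poly_integral (rodrigues l a * rodrigues k b) = (- 1) ^ b * poly_integral (rodrigues l (l + k) * Lquad ^ k)"
  using assms
proof (induction b arbitrary: a)
  case 0
  then show ?case by (simp add: rodrigues_def)
next
  case (Suc b)
  let ?P = "rodrigues l a * rodrigues k b"
  have "poly ?P x = 0" if "x\<^sup>2 = 1" for x
  proof (cases "a < l")
    case False
    then have "b < k" using Suc.prems by simp
    then show ?thesis using that by (simp add: rodrigues_boundary)
  qed (use that in \<open>simp add: rodrigues_boundary\<close>)
  then have "poly ?P 1 = 0" "poly ?P (- 1) = 0"
    by (simp_all del: poly_mult)
  then have "poly_integral (pderiv ?P) = 0"
    by (simp add: poly_integral_pderiv del: poly_mult)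
  then have "poly_integral (rodrigues l a * rodrigues k (Suc b)) = - poly_integral (rodrigues l (Suc a) * rodrigues k b)"
    by (simp add: pderiv_mult poly_integral_add rodrigues_Suc mult.commute)
  then show ?case using Suc.IH[of "Suc a"] Suc.prems by simp
qed

text \<open>The recursion comes from integrating the derivative of \<open>x (x\<^sup>2 - 1)\<^sup>l\<^sup>+\<^sup>1\<close>, which vanishes at both
  end points.\<close>

lemma poly_integral_Lquad_power:
  "poly_integral (Lquad ^ l) = (- 1) ^ l * 2 ^ (2 * l + 1) * (fact l)\<^sup>2 / fact (2 * l + 1)"
proof (induction l)
  case 0
  have "poly_integral (pderiv pX) = 2" unfolding poly_integral_pderiv by simp
  then show ?case by (simp add: pderiv_pCons one_pCons)
next
  case (Suc l)
  have "pderiv (pX * Lquad ^ Suc l) = smult (2 * real l + 3) (Lquad ^ Suc l) + smult (2 * (real l + 1)) (Lquad ^ l)"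
    unfolding pderiv_mult pderiv_power_Suc
    by (simp add: poly_eq_poly_eq_iff[symmetric] fun_eq_iff poly_power power2_eq_square algebra_simps)
  moreover have "poly_integral (pderiv (pX * Lquad ^ Suc l)) = 0"
    unfolding poly_integral_pderiv by (simp add: poly_power)
  ultimately have "(2 * real l + 3) * poly_integral (Lquad ^ Suc l) + (2 * (real l + 1)) * poly_integral (Lquad ^ l) = 0"
    by (simp only: poly_integral_add poly_integral_smult)
  then have "(2 * real l + 3) * poly_integral (Lquad ^ Suc l) = - (2 * (real l + 1)) * poly_integral (Lquad ^ l)"
    by linarith
  then have "poly_integral (Lquad ^ Suc l) = - (2 * (real l + 1)) / (2 * real l + 3) * poly_integral (Lquad ^ l)"
    by (simp add: field_simps)
  also have "\<dots> = (- 1) ^ Suc l * 2 ^ (2 * Suc l + 1) * (fact (Suc l))\<^sup>2 / fact (2 * Suc l + 1)"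
  proof -
    define F G p q :: real where defs: "F = fact l" "G = fact (2 * l + 1)" "p = 2 ^ (2 * l + 1)" "q = (- 1) ^ l"
    define a where "a = real l + 1"
    have G: "G \<noteq> 0" "a \<noteq> 0" "2 * a + 1 \<noteq> 0" by (auto simp: defs a_def)
    have "fact (2 * Suc l + 1) = (2 * a + 1) * (2 * a) * G"
      by (simp add: algebra_simps defs a_def)
    moreover have "fact (Suc l) = a * F" "2 ^ (2 * Suc l + 1) = 4 * p" "(- 1) ^ Suc l = - q"
      by (simp_all add: defs a_def)
    moreover have "- (2 * (real l + 1)) / (2 * real l + 3) = - (2 * a) / (2 * a + 1)"
      by (simp add: a_def)
    ultimately have *: "- (2 * (real l + 1)) / (2 * real l + 3) * poly_integral (Lquad ^ l) = - (2 * a) / (2 * a + 1) * (q * p * F\<^sup>2 / G)"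
      "(- 1) ^ Suc l * 2 ^ (2 * Suc l + 1) * (fact (Suc l))\<^sup>2 / fact (2 * Suc l + 1) = - q * (4 * p) * (a * F)\<^sup>2 / ((2 * a + 1) * (2 * a) * G)"
      unfolding Suc.IH by (simp_all only: defs)
    show ?thesis unfolding * using G by (simp add: divide_simps power2_eq_square)
  qed
  finally show ?case .
qed

lemma degree_pderiv_funpow: "degree ((pderiv ^^ n) p) = degree p - n" for p :: "real poly"
  by (induction n) (simp_all add: degree_pderiv)

lemma degree_Lquad_power: "degree (Lquad ^ l) = 2 * l"
  by (simp add: degree_power_eq)

lemma rodrigues_degree: "degree (rodrigues l n) = 2 * l - n"
  by (simp add: rodrigues_def degree_pderiv_funpow degree_Lquad_power)

lemma lead_coeff_pderiv_funpow:
  fixes p :: "real poly"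
  assumes "n \<le> degree p"
  shows "lead_coeff ((pderiv ^^ n) p) * fact (degree p - n) = fact (degree p) * lead_coeff p"
  using assms
proof (induction n)
  case (Suc n)
  have "lead_coeff ((pderiv ^^ Suc n) p) = real (degree p - n) * lead_coeff ((pderiv ^^ n) p)"
    using Suc.prems by (simp add: degree_pderiv degree_pderiv_funpow coeff_pderiv Suc_diff_Suc del: of_nat_Suc)
  moreover have "fact (degree p - n) = real (degree p - n) * fact (degree p - Suc n)"
    using Suc.prems by (metis Suc_diff_Suc Suc_le_lessD fact_Suc)
  ultimately have "lead_coeff ((pderiv ^^ Suc n) p) * fact (degree p - Suc n)
      = lead_coeff ((pderiv ^^ n) p) * fact (degree p - n)"
    by (simp only: mult.commute mult.left_commute)
  then show ?case using Suc by simp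
qed simp

lemma rodrigues_top: "rodrigues l (2 * l) = [:fact (2 * l):]"
proof -
  have "degree (rodrigues l (2 * l)) = 0" by (simp add: rodrigues_degree)
  then obtain c where c: "rodrigues l (2 * l) = [:c:]" by (metis degree_eq_zeroE)
  have "lead_coeff (rodrigues l (2 * l)) = fact (2 * l) * lead_coeff (Lquad ^ l)"
    using lead_coeff_pderiv_funpow[of "2 * l" "Lquad ^ l"] by (simp add: rodrigues_def degree_Lquad_power)
  also have "lead_coeff (Lquad ^ l) = 1" by (simp add: lead_coeff_power)
  finally show ?thesis using c by simp
qed

text \<open>The reflection formula replaces the weighted first factor by \<open>rodrigues l (l - k)\<close>. After integration
  by parts, \<open>(x\<^sup>2 - 1)\<^sup>l\<close> carries \<open>l + l'\<close> derivatives, more than its degree \<open>2 l\<close> if \<open>l < l'\<close>.\<close>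

lemma poly_integral_rodrigues_orthogonal:
  assumes "k \<le> l" "k \<le> l'" "l \<noteq> l'"
  shows "poly_integral ((- Lquad) ^ k * rodrigues l (l + k) * rodrigues l' (l' + k)) = 0"
  using assms
proof (induction l l' rule: linorder_wlog)
  case (le l l')
  then have l: "l < l'" by simp
  have "rodrigues l (l + l') = 0"
  proof -
    have "rodrigues l (l + l') = (pderiv ^^ (l' - l)) (rodrigues l (2 * l))"
      using l unfolding rodrigues_def by (metis (no_types, lifting) add_diff_inverse_nat add.commute add.assoc comp_apply funpow_add less_imp_not_less mult_2)
    also have "\<dots> = 0"
    proof -
      obtain n where n: "l' - l = Suc n" using l by (metis Suc_diff_Suc)
      have "(pderiv ^^ n) 0 = (0 :: real poly)" for n by (induction n) auto
      then show ?thesis by (simp add: n rodrigues_top pderiv_funpow_commute[symmetric] pderiv_pCons del: funpow.simps add: funpow_Suc_right)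
    qed
    finally show ?thesis .
  qed
  then have 0: "poly_integral (rodrigues l (l - k) * rodrigues l' (l' + k)) = 0"
    using poly_integral_rodrigues_shift[of "l - k" "l' + k" l l'] le by (simp add: poly_integral_def)
  have "fact (l - k) * poly_integral ((- Lquad) ^ k * rodrigues l (l + k) * rodrigues l' (l' + k))
      = (- 1) ^ k * poly_integral (smult (fact (l - k)) (Lquad ^ k * rodrigues l (l + k)) * rodrigues l' (l' + k))"
    by (subst power_minus) (simp add: poly_integral_smult poly_integral_neg_power mult.assoc)
  also have "\<dots> = 0"
    using 0 le by (simp add: rodrigues_reflection poly_integral_smult)
  finally show ?case by simp
next
  case (sym l l')
  then show ?case by (simp add: ac_simps)
qed

text \<open>For equal degrees the \<open>2 l\<close> derivatives of \<open>(x\<^sup>2 - 1)\<^sup>l\<close> are the constant \<open>(2 l)!\<close>, and the integral of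
  \<open>(x\<^sup>2 - 1)\<^sup>l\<close> remains.\<close>

lemma poly_integral_rodrigues_norm:
  assumes "k \<le> l"
  shows "poly_integral ((- Lquad) ^ k * rodrigues l (l + k) * rodrigues l (l + k))
    = fact (l + k) / fact (l - k) * 2 * (2 ^ l * fact l)\<^sup>2 / (2 * real l + 1)"
proof -
  have "fact (l - k) * poly_integral ((- Lquad) ^ k * rodrigues l (l + k) * rodrigues l (l + k))
      = (- 1) ^ k * poly_integral (smult (fact (l - k)) (Lquad ^ k * rodrigues l (l + k)) * rodrigues l (l + k))"
    by (subst power_minus) (simp add: poly_integral_smult poly_integral_neg_power mult.assoc)
  also have "\<dots> = (- 1) ^ k * fact (l + k) * poly_integral (rodrigues l (l - k) * rodrigues l (l + k))"
    using assms by (simp add: rodrigues_reflection poly_integral_smult)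
  also have "poly_integral (rodrigues l (l - k) * rodrigues l (l + k)) = (- 1) ^ (l + k) * (fact (2 * l) * poly_integral (Lquad ^ l))"
    using assms by (subst poly_integral_rodrigues_shift) (auto simp: rodrigues_top poly_integral_smult simp flip: mult_2)
  also have "fact (2 * l) * poly_integral (Lquad ^ l) = (- 1) ^ l * (2 * (2 ^ l * fact l)\<^sup>2 / (2 * real l + 1))"
    unfolding poly_integral_Lquad_power by (simp add: power_mult_distrib power_mult[symmetric] ac_simps)
  also have "(- 1) ^ k * fact (l + k) * ((- 1) ^ (l + k) * ((- 1) ^ l * (2 * (2 ^ l * fact l)\<^sup>2 / (2 * real l + 1))))
      = fact (l + k) * (2 * (2 ^ l * fact l)\<^sup>2 / (2 * real l + 1))"
    by (cases "even k"; cases "even l") (simp_all add: power_add)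
  finally have *: "fact (l - k) * poly_integral ((- Lquad) ^ k * rodrigues l (l + k) * rodrigues l (l + k))
      = fact (l + k) * (2 * (2 ^ l * fact l)\<^sup>2 / (2 * real l + 1))" .
  then have "poly_integral ((- Lquad) ^ k * rodrigues l (l + k) * rodrigues l (l + k))
      = fact (l + k) * (2 * (2 ^ l * fact l)\<^sup>2 / (2 * real l + 1)) / fact (l - k)"
    by (metis fact_nonzero nonzero_mult_div_cancel_left)
  then show ?thesis by (simp add: ac_simps)
qed

section \<open>Orthonormality of the spherical harmonics\<close>

text \<open>On the sphere this is \<open>(sin \<theta>)\<^sup>|\<^sup>m\<^sup>| exp (i m \<phi>)\<close>. The Cartesian form is polynomial, so it has no
  singularity at the poles.\<close>

definition azimuth :: "int \<Rightarrow> real ^ 3 \<Rightarrow> complex" where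
  "azimuth m p = (if m \<ge> 0 then Complex (p $ 1) (p $ 2) ^ nat m else cnj (Complex (p $ 1) (p $ 2)) ^ nat (- m))"

text \<open>The sign \<open>(-1)\<^sup>m\<close> in the definition of the associated Legendre functions survives only for \<open>m \<ge> 0\<close>;
  for negative \<open>m\<close> it cancels against the sign that the reflection formula produces.\<close>

definition harm_const :: "nat \<Rightarrow> int \<Rightarrow> real" where
  "harm_const l m = (if m \<ge> 0 then (-1) ^ nat m else 1)
    * sqrt ((2 * real l + 1) * fact (l - nat \<bar>m\<bar>) / (4 * pi * fact (l + nat \<bar>m\<bar>))) / (2 ^ l * fact l)"

lemma unit_sphere_coordinates:
  fixes p :: "real ^ 3"
  assumes "p \<in> sphere 0 1"
  shows "(p $ 1)\<^sup>2 + (p $ 2)\<^sup>2 = 1 - (p $ 3)\<^sup>2"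
  using assms by (simp add: norm_vec_def L2_set_def sum_3)

lemma rodrigues_eq_deriv: "(deriv ^^ n) (\<lambda>y::real. (y\<^sup>2 - 1) ^ l) = poly (rodrigues l n)"
  by (simp add: legendre_derivative_poly rodrigues_def Lquad_def)

text \<open>The reflection formula turns the factor \<open>(1 - x\<^sup>2)\<^sup>-\<^sup>k\<^sup>/\<^sup>2\<close> of the definition into
  \<open>(1 - x\<^sup>2)\<^sup>k\<^sup>/\<^sup>2\<close>. At \<open>x = \<plusminus>1\<close> both sides are \<open>0\<close>, on the left because negative powers of \<open>0\<close> are \<open>0\<close>.\<close>

lemma assoc_legendre_negative:
  assumes "k \<le> l" "0 < k" "\<bar>x\<bar> \<le> 1"
  shows "assoc_legendre l (- int k) x
    = fact (l - k) / fact (l + k) / (2 ^ l * fact l) * sqrt (1 - x\<^sup>2) ^ k * poly (rodrigues l (l + k)) x"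
proof (cases "sqrt (1 - x\<^sup>2) = 0")
  case True
  then show ?thesis using assms by (simp add: assoc_legendre_def power_int_0_left_if zero_power)
next
  case False
  define r where "r = sqrt (1 - x\<^sup>2)"
  have r: "r \<noteq> 0" "r\<^sup>2 = 1 - x\<^sup>2" using False assms by (auto simp: r_def abs_square_le_1)
  have "fact (l - k) * ((x\<^sup>2 - 1) ^ k * poly (rodrigues l (l + k)) x) = fact (l + k) * poly (rodrigues l (l - k)) x"
    using arg_cong[OF rodrigues_reflection[OF assms(1)], of "\<lambda>p. poly p x"] by (simp add: poly_power)
  then have R: "poly (rodrigues l (l - k)) x = fact (l - k) / fact (l + k) * ((x\<^sup>2 - 1) ^ k * poly (rodrigues l (l + k)) x)"
    by (simp add: field_simps)
  have "x\<^sup>2 - 1 = - (r * r)" using r by (simp add: power2_eq_square)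
  then have "(x\<^sup>2 - 1) ^ k = (- 1) ^ k * (r ^ k * r ^ k)"
    by (simp only: power_minus[of "r * r"] power_mult_distrib)
  moreover have "r powi (- int k) = inverse (r ^ k)"
    by (simp add: power_int_minus)
  moreover have "(- 1) powi (- int k) = ((- 1) ^ k :: real)"
    by (simp add: power_int_minus flip: power_inverse)
  ultimately have "(- 1) powi (- int k) / (2 ^ l * fact l) * r powi (- int k) * poly (rodrigues l (l - k)) x
      = (- 1) ^ k / (2 ^ l * fact l) * inverse (r ^ k) * (fact (l - k) / fact (l + k) * (((- 1) ^ k * (r ^ k * r ^ k)) * poly (rodrigues l (l + k)) x))"
    by (simp only: R)
  also have "\<dots> = ((- 1) ^ k * (- 1) ^ k) * (inverse (r ^ k) * r ^ k) * (fact (l - k) / fact (l + k) / (2 ^ l * fact l) * r ^ k * poly (rodrigues l (l + k)) x)"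
    by (simp add: field_simps)
  also have "(- 1) ^ k * (- 1) ^ k = (1::real)" by (simp flip: power_mult_distrib)
  also have "inverse (r ^ k) * r ^ k = 1" using r by simp
  finally show ?thesis
    using assms by (simp add: assoc_legendre_def rodrigues_eq_deriv r_def nat_diff_distrib' of_nat_diff flip: of_nat_diff)
qed

text \<open>In this form the harmonics are restrictions of polynomials in the Cartesian coordinates, and the
  orders \<open>m\<close> and \<open>- m\<close> are treated alike; orthonormality and completeness are both read off from it.\<close>

lemma sph_harm_fun_polynomial:
  assumes p: "p \<in> sphere 0 1" and m: "\<bar>m\<bar> \<le> int l"
  shows "sph_harm_fun l m p
    = complex_of_real (harm_const l m) * azimuth m p * complex_of_real (poly (rodrigues l (l + nat \<bar>m\<bar>)) (p $ 3))"
proof -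
  define w where "w = Complex (p $ 1) (p $ 2)"
  define E where "E = exp (\<i> * complex_of_real (Arg2pi w))"
  have x: "\<bar>p $ 3\<bar> \<le> 1" by (rule sphere_component_le_1[OF p])
  have r: "sqrt (1 - (p $ 3)\<^sup>2) = cmod w"
    using unit_sphere_coordinates[OF p] by (simp add: w_def complex_norm)
  have w: "w = complex_of_real (cmod w) * E"
    using Arg2pi_eq[of w] by (simp add: E_def)
  have cE: "cnj E = inverse E"
    by (simp add: E_def exp_minus[symmetric] exp_cnj)
  have expE: "exp (\<i> * of_int m * complex_of_real (Arg2pi w)) = E powi m"
  proof -
    have "\<i> * of_int m * complex_of_real (Arg2pi w) = of_int m * (\<i> * complex_of_real (Arg2pi w))" by simp
    then show ?thesis by (simp only: exp_power_int[symmetric] E_def)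
  qed
  have Y: "sph_harm_fun l m p = complex_of_real (sqrt ((2 * real l + 1) * fact (nat (int l - m)) / (4 * pi * fact (nat (int l + m))))
      * assoc_legendre l m (p $ 3)) * E powi m"
    using x by (simp add: sph_harm_fun_def sph_harm_coord_def w_def[symmetric] expE cos_arccos abs_le_iff)
  show ?thesis
  proof (cases "m \<ge> 0")
    case True
    define k where "k = nat m"
    have k: "m = int k" "k \<le> l" using True m by (auto simp: k_def)
    have "complex_of_real (cmod w) ^ k * E ^ k = w ^ k"
      by (subst (2) w) (simp add: power_mult_distrib)
    moreover have "nat (int l - int k) = l - k" "nat (int l + int k) = l + k" using k by auto
    ultimately show ?thesis
      unfolding Y by (simp add: k assoc_legendre_def rodrigues_eq_deriv r harm_const_def azimuth_def w_def[symmetric] mult.assoc[symmetric])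
  next
    case False
    define k where "k = nat (- m)"
    have k: "m = - int k" "k \<le> l" "0 < k" using False m by (auto simp: k_def)
    have wk: "complex_of_real (cmod w) ^ k * E powi (- int k) = cnj w ^ k"
      by (subst (2) w) (simp add: power_mult_distrib power_int_minus cE power_inverse)
    have n: "nat (int l - m) = l + k" "nat (int l + m) = l - k" using k by auto
    have sq: "sqrt ((2 * real l + 1) * fact (l + k) / (4 * pi * fact (l - k))) * (fact (l - k) / fact (l + k))
        = sqrt ((2 * real l + 1) * fact (l - k) / (4 * pi * fact (l + k)))"
    proof -
      have "fact (l - k) / fact (l + k) = sqrt ((fact (l - k) / fact (l + k))\<^sup>2)" by simp
      then have "sqrt ((2 * real l + 1) * fact (l + k) / (4 * pi * fact (l - k))) * (fact (l - k) / fact (l + k))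
        = sqrt ((2 * real l + 1) * fact (l + k) / (4 * pi * fact (l - k)) * (fact (l - k) / fact (l + k))\<^sup>2)"
        by (simp only: real_sqrt_mult)
      also have "(2 * real l + 1) * fact (l + k) / (4 * pi * fact (l - k)) * (fact (l - k) / fact (l + k))\<^sup>2
        = (2 * real l + 1) * fact (l - k) / (4 * pi * fact (l + k))"
        by (simp add: field_simps power2_eq_square)
      finally show ?thesis .
    qed
    have "sqrt ((2 * real l + 1) * fact (l + k) / (4 * pi * fact (l - k))) * assoc_legendre l m (p $ 3)
        = (sqrt ((2 * real l + 1) * fact (l + k) / (4 * pi * fact (l - k))) * (fact (l - k) / fact (l + k))) / (2 ^ l * fact l)
          * cmod w ^ k * poly (rodrigues l (l + k)) (p $ 3)"
      using assoc_legendre_negative[OF k(2,3) x] by (simp add: k(1) r)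
    also have "\<dots> = harm_const l m * cmod w ^ k * poly (rodrigues l (l + k)) (p $ 3)"
      unfolding sq using k by (simp add: harm_const_def)
    finally have "sph_harm_fun l m p = complex_of_real (harm_const l m) * complex_of_real (poly (rodrigues l (l + k)) (p $ 3))
        * (complex_of_real (cmod w) ^ k * E powi (- int k))"
      unfolding Y n by (simp add: k(1))
    then show ?thesis
      unfolding wk using k by (simp add: azimuth_def w_def)
  qed
qed

lemma azimuth_sph_coord:
  "azimuth m (sph_coord \<theta> \<phi>) = complex_of_real (sin \<theta>) ^ nat \<bar>m\<bar> * exp (\<i> * of_int m * complex_of_real \<phi>)"
proof -
  have w: "Complex (sin \<theta> * cos \<phi>) (sin \<theta> * sin \<phi>) = complex_of_real (sin \<theta>) * exp (\<i> * complex_of_real \<phi>)"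
    by (simp add: complex_eq_iff Re_exp Im_exp)
  show ?thesis
  proof (cases "m \<ge> 0")
    case True
    have "exp (\<i> * complex_of_real \<phi>) ^ nat m = exp (\<i> * of_int m * complex_of_real \<phi>)"
      using True by (simp add: exp_of_nat_mult[symmetric] ac_simps)
    then show ?thesis using True by (simp add: azimuth_def sph_coord_def w power_mult_distrib)
  next
    case False
    have "cnj (exp (\<i> * complex_of_real \<phi>)) ^ nat (- m) = exp (\<i> * of_int m * complex_of_real \<phi>)"
      using False by (simp add: exp_cnj exp_of_nat_mult[symmetric] ac_simps)
    then show ?thesis using False by (simp add: azimuth_def sph_coord_def w power_mult_distrib)
  qed
qed

lemma azimuth_continuous: "continuous_on UNIV (azimuth m)"
proof -
  have "continuous_on UNIV (\<lambda>p::real^3. Complex (p $ 1) (p $ 2))"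
    unfolding Complex_eq by (intro continuous_intros)
  then show ?thesis
    unfolding azimuth_def by (cases "m \<ge> 0") (auto intro!: continuous_intros)
qed

lemma sphere_integral_product:
  fixes F :: "real ^ 3 \<Rightarrow> complex" and A B :: "real \<Rightarrow> complex"
  assumes F: "F \<in> borel_measurable borel"
    and prod: "\<And>\<theta> \<phi>. F (sph_coord \<theta> \<phi>) = A \<theta> * B \<phi>"
    and A: "continuous_on UNIV A" and B: "continuous_on UNIV B"
  shows "(\<integral>p. F p \<partial>sphere_measure)
    = (\<integral>\<theta>. indicator {0..pi} \<theta> *\<^sub>R (complex_of_real (sin \<theta>) * A \<theta>) \<partial>lborel)
      * (\<integral>\<phi>. indicator {0..2*pi} \<phi> *\<^sub>R B \<phi> \<partial>lborel)"
proof -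
  let ?S = "{0..pi} \<times> {0..<2*pi} :: (real \<times> real) set"
  let ?R = "restrict_space (lborel :: (real \<times> real) measure) ?S"
  have S: "?S \<in> sets borel" by (simp add: borel_Times)
  have [measurable]: "A \<in> borel_measurable borel" "B \<in> borel_measurable borel"
    using A B by (auto intro: borel_measurable_continuous_onI)
  define f where "f \<theta> = indicator {0..pi} \<theta> *\<^sub>R (complex_of_real (sin \<theta>) * A \<theta>)" for \<theta> :: real
  define g where "g \<phi> = indicator {0..<2*pi} \<phi> *\<^sub>R B \<phi>" for \<phi> :: real
  have f: "integrable lborel f"
    unfolding f_def by (intro borel_integrable_compact continuous_intros continuous_on_subset[OF A]) auto
  have g0: "integrable lborel (\<lambda>\<phi>. indicator {0..2*pi} \<phi> *\<^sub>R B \<phi>)"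
    by (intro borel_integrable_compact continuous_on_subset[OF B]) auto
  have g: "integrable lborel g"
    unfolding g_def by (rule Bochner_Integration.integrable_bound[OF g0]) (auto simp: indicator_def)
  have fg: "integrable (lborel \<Otimes>\<^sub>M lborel) (\<lambda>(\<theta>, \<phi>). f \<theta> * g \<phi>)"
  proof (rule lborel_pair.Fubini_integrable)
    have [measurable]: "f \<in> borel_measurable borel" "g \<in> borel_measurable borel" using f g by auto
    show "(\<lambda>(\<theta>, \<phi>). f \<theta> * g \<phi>) \<in> borel_measurable (lborel \<Otimes>\<^sub>M lborel)" by measurable
  qed (use f g in \<open>auto simp: norm_mult\<close>)
  have sinm: "(\<lambda>p::real \<times> real. sin (fst p)) \<in> borel_measurable ?R"
    by (intro measurable_restrict_space1) (auto intro!: borel_measurable_continuous_onI continuous_intros)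
  have Fm: "(\<lambda>p::real \<times> real. A (fst p) * B (snd p)) \<in> borel_measurable ?R"
    by (intro measurable_restrict_space1)
      (auto intro!: borel_measurable_continuous_onI continuous_intros continuous_on_compose2[OF A] continuous_on_compose2[OF B])
  have "(\<integral>p. F p \<partial>sphere_measure)
      = (\<integral>p. F (sph_coord (fst p) (snd p)) \<partial>density ?R (\<lambda>(\<theta>, \<phi>). ennreal (sin \<theta>)))"
  proof -
    have "(\<lambda>(\<theta>, \<phi>). sph_coord \<theta> \<phi>) \<in> measurable (density ?R (\<lambda>(\<theta>, \<phi>). ennreal (sin \<theta>))) (restrict_space borel (sphere 0 1))"
      using measurable_sph_coord[of ?S] by simp
    from integral_distr[OF this measurable_restrict_space1[OF F]] show ?thesis
      unfolding sphere_measure_def by (simp add: case_prod_beta)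
  qed
  also have "\<dots> = (\<integral>p. A (fst p) * B (snd p) \<partial>density ?R (\<lambda>p. ennreal (sin (fst p))))"
    by (simp add: prod case_prod_beta')
  also have "\<dots> = (\<integral>p. sin (fst p) *\<^sub>R (A (fst p) * B (snd p)) \<partial>?R)"
    by (rule integral_density[OF Fm sinm]) (auto intro!: AE_I2 sin_ge_zero simp: space_restrict_space)
  also have "\<dots> = (\<integral>p. indicator ?S p *\<^sub>R (sin (fst p) *\<^sub>R (A (fst p) * B (snd p))) \<partial>lborel)"
    by (rule integral_restrict_space) (use S in simp)
  also have "\<dots> = (\<integral>p. (case p of (\<theta>, \<phi>) \<Rightarrow> f \<theta> * g \<phi>) \<partial>(lborel \<Otimes>\<^sub>M lborel))"
    unfolding lborel_prod
    by (intro Bochner_Integration.integral_cong) (auto simp: f_def g_def indicator_def scaleR_conv_of_real)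
  also have "\<dots> = (\<integral>\<theta>. (\<integral>\<phi>. f \<theta> * g \<phi> \<partial>lborel) \<partial>lborel)"
    using lborel_pair.integral_fst'[OF fg] by simp
  also have "\<dots> = (\<integral>\<theta>. f \<theta> \<partial>lborel) * (\<integral>\<phi>. g \<phi> \<partial>lborel)"
    by simp
  also have "(\<integral>\<phi>. g \<phi> \<partial>lborel) = (\<integral>\<phi>. indicator {0..2*pi} \<phi> *\<^sub>R B \<phi> \<partial>lborel)"
  proof (rule integral_cong_AE)
    show "AE \<phi> in lborel. g \<phi> = indicator {0..2*pi} \<phi> *\<^sub>R B \<phi>"
      using AE_lborel_singleton[of "2*pi"] by eventually_elim (auto simp: g_def indicator_def)
  qed (use g g0 in auto)
  finally show ?thesis by (simp add: f_def)
qed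

lemma integral_exp_circle:
  "(\<integral>\<phi>. indicator {0..2*pi} \<phi> *\<^sub>R exp (\<i> * of_int k * complex_of_real \<phi>) \<partial>lborel)
    = (if k = 0 then complex_of_real (2 * pi) else 0)"
proof (cases "k = 0")
  case True
  then show ?thesis by (simp add: scaleR_conv_of_real)
next
  case False
  define c where "c = \<i> * of_int k"
  have c: "c \<noteq> 0" using False by (simp add: c_def)
  have "(\<integral>\<phi>. indicator {0..2*pi} \<phi> *\<^sub>R exp (c * complex_of_real \<phi>) \<partial>lborel)
      = exp (c * complex_of_real (2 * pi)) / c - exp (c * complex_of_real 0) / c"
  proof (rule integral_FTC_Icc)
    fix x :: real
    have "((\<lambda>y. exp (c * y) / c) has_field_derivative exp (c * complex_of_real x)) (at (complex_of_real x))"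
      using c by (auto intro!: derivative_eq_intros)
    from has_vector_derivative_real_field[OF this]
    show "((\<lambda>x. exp (c * complex_of_real x) / c) has_vector_derivative exp (c * complex_of_real x)) (at x within {0..2*pi})"
      by (rule has_vector_derivative_at_within)
  qed (auto intro!: continuous_intros)
  also have "exp (c * complex_of_real (2 * pi)) = 1"
    using exp_integer_2pi[of "of_int k"] by (simp add: c_def ac_simps)
  finally show ?thesis using False by (simp add: c_def)
qed

text \<open>The integral over \<open>\<phi>\<close> vanishes unless \<open>m = m'\<close>. In that case the powers of \<open>sin \<theta>\<close> form the weight
  \<open>(1 - x\<^sup>2)\<^sup>|\<^sup>m\<^sup>|\<close>, and the integral over \<open>x = cos \<theta>\<close> is the one of the previous section.\<close>

lemma sph_harm_orthonormal:
  assumes m: "\<bar>m\<bar> \<le> int l" and m': "\<bar>m'\<bar> \<le> int l'"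
  shows "inner_l2 (sph_harm l m) (sph_harm l' m') = (if l = l' \<and> m = m' then 1 else 0)"
proof -
  define k where "k = nat \<bar>m\<bar>"
  define k' where "k' = nat \<bar>m'\<bar>"
  define c where "c = complex_of_real (harm_const l m * harm_const l' m')"
  define R where "R = rodrigues l (l + k)"
  define R' where "R' = rodrigues l' (l' + k')"
  define F where "F p = azimuth m p * cnj (azimuth m' p) * complex_of_real (poly R (p $ 3) * poly R' (p $ 3))" for p
  have Fc: "continuous_on UNIV F"
    unfolding F_def by (intro continuous_intros azimuth_continuous)
  have "inner_l2 (sph_harm l m) (sph_harm l' m') = (\<integral>p. sph_harm_fun l m p * cnj (sph_harm_fun l' m' p) \<partial>sphere_measure)"
    using m m' by transfer simp
  also have "\<dots> = (\<integral>p. c * F p \<partial>sphere_measure)"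
    using m m' by (intro Bochner_Integration.integral_cong)
      (simp_all add: sph_harm_fun_polynomial F_def c_def R_def R'_def k_def k'_def)
  also have "\<dots> = c * (\<integral>p. F p \<partial>sphere_measure)" by simp
  also have "(\<integral>p. F p \<partial>sphere_measure)
     = (\<integral>\<theta>. indicator {0..pi} \<theta> *\<^sub>R (complex_of_real (sin \<theta>) * (complex_of_real (sin \<theta>) ^ (k + k') * complex_of_real (poly R (cos \<theta>) * poly R' (cos \<theta>)))) \<partial>lborel)
      * (\<integral>\<phi>. indicator {0..2*pi} \<phi> *\<^sub>R exp (\<i> * of_int (m - m') * complex_of_real \<phi>) \<partial>lborel)"
  proof (rule sphere_integral_product)
    show "F \<in> borel_measurable borel" by (rule borel_measurable_continuous_onI[OF Fc])
    fix \<theta> \<phi>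
    have "exp (\<i> * of_int (m - m') * complex_of_real \<phi>) = exp (\<i> * of_int m * complex_of_real \<phi>) * cnj (exp (\<i> * of_int m' * complex_of_real \<phi>))"
      by (simp add: exp_cnj exp_add[symmetric] algebra_simps)
    moreover have "sph_coord \<theta> \<phi> $ 3 = cos \<theta>" by (simp add: sph_coord_def)
    ultimately show "F (sph_coord \<theta> \<phi>) = complex_of_real (sin \<theta>) ^ (k + k') * complex_of_real (poly R (cos \<theta>) * poly R' (cos \<theta>))
        * exp (\<i> * of_int (m - m') * complex_of_real \<phi>)"
      by (simp add: F_def azimuth_sph_coord k_def k'_def power_add)
  qed (auto intro!: continuous_intros)
  finally have I: "inner_l2 (sph_harm l m) (sph_harm l' m') = c * ((\<integral>\<theta>. indicator {0..pi} \<theta> *\<^sub>R (complex_of_real (sin \<theta>) * (complex_of_real (sin \<theta>) ^ (k + k') * complex_of_real (poly R (cos \<theta>) * poly R' (cos \<theta>)))) \<partial>lborel)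
      * (if m = m' then complex_of_real (2 * pi) else 0))"
    unfolding integral_exp_circle by simp
  show ?thesis
  proof (cases "m = m'")
    case False
    then show ?thesis unfolding I by simp
  next
    case True
    then have kk: "k' = k" by (simp add: k_def k'_def)
    have kl: "k \<le> l" "k \<le> l'" using m m' True by (auto simp: k_def)
    have "(\<integral>\<theta>. indicator {0..pi} \<theta> *\<^sub>R (complex_of_real (sin \<theta>) * (complex_of_real (sin \<theta>) ^ (k + k') * complex_of_real (poly R (cos \<theta>) * poly R' (cos \<theta>)))) \<partial>lborel)
      = (\<integral>\<theta>. complex_of_real (indicator {0..pi} \<theta> *\<^sub>R (poly ((- Lquad) ^ k * R * R') (cos \<theta>) * sin \<theta>)) \<partial>lborel)"
    proof (rule Bochner_Integration.integral_cong[OF refl])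
      fix \<theta> :: real
      have "poly ((- Lquad) ^ k) (cos \<theta>) = sin \<theta> ^ (k + k)"
        unfolding poly_power by (simp add: cos_squared_eq mult_2[symmetric] power_mult)
      then show "indicator {0..pi} \<theta> *\<^sub>R (complex_of_real (sin \<theta>) * (complex_of_real (sin \<theta>) ^ (k + k') * complex_of_real (poly R (cos \<theta>) * poly R' (cos \<theta>))))
        = complex_of_real (indicator {0..pi} \<theta> *\<^sub>R (poly ((- Lquad) ^ k * R * R') (cos \<theta>) * sin \<theta>))"
        by (simp add: kk scaleR_conv_of_real)
    qed
    also have "\<dots> = complex_of_real (poly_integral ((- Lquad) ^ k * R * R'))"
      unfolding poly_integral_def by (rule integral_complex_of_real)
    finally have I': "inner_l2 (sph_harm l m) (sph_harm l' m') = c * (complex_of_real (poly_integral ((- Lquad) ^ k * R * R')) * complex_of_real (2 * pi))"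
      unfolding I using True by simp
    show ?thesis
    proof (cases "l = l'")
      case False
      then show ?thesis
        unfolding I' R_def R'_def kk using poly_integral_rodrigues_orthogonal[OF kl False] by simp
    next
      case ll: True
      have "harm_const l m * harm_const l m = (2 * real l + 1) * fact (l - k) / (4 * pi * fact (l + k)) / (2 ^ l * fact l)\<^sup>2"
      proof -
        define \<sigma> :: real where "\<sigma> = (if m \<ge> 0 then (-1) ^ nat m else 1)"
        define X where "X = (2 * real l + 1) * fact (l - k) / (4 * pi * fact (l + k))"
        have "\<sigma> * \<sigma> = 1" by (simp add: \<sigma>_def flip: power_mult_distrib)
        moreover have "sqrt X * sqrt X = X" by (simp add: X_def)
        moreover have "harm_const l m = \<sigma> * sqrt X / (2 ^ l * fact l)"
          by (simp add: harm_const_def k_def[symmetric] \<sigma>_def X_def)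
        moreover have "(\<sigma> * sqrt X / (2 ^ l * fact l)) * (\<sigma> * sqrt X / (2 ^ l * fact l))
            = (\<sigma> * \<sigma>) * (sqrt X * sqrt X) / (2 ^ l * fact l)\<^sup>2"
          by (simp add: power2_eq_square)
        ultimately show ?thesis by (simp add: X_def)
      qed
      moreover have "poly_integral ((- Lquad) ^ k * R * R') = fact (l + k) / fact (l - k) * 2 * (2 ^ l * fact l)\<^sup>2 / (2 * real l + 1)"
        unfolding R_def R'_def kk using poly_integral_rodrigues_norm[OF kl(1)] ll by simp
      ultimately have "harm_const l m * harm_const l m * (poly_integral ((- Lquad) ^ k * R * R') * (2 * pi)) = 1"
      proof -
        define a b n q :: real where ab: "a = fact (l - k)" "b = fact (l + k)" "n = 2 * real l + 1" "q = (2 ^ l * fact l)\<^sup>2"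
        have "a \<noteq> 0" "b \<noteq> 0" "n \<noteq> 0" "q \<noteq> 0" by (auto simp: ab add_nonneg_eq_0_iff)
        then have "(n * a / (4 * pi * b) / q) * ((b / a * 2 * q / n) * (2 * pi)) = 1"
          by (simp add: field_simps)
        then show ?thesis
          unfolding \<open>harm_const l m * harm_const l m = _\<close> \<open>poly_integral _ = _\<close> ab .
      qed
      then show ?thesis
        unfolding I' c_def using True ll by (simp flip: of_real_mult add: mult.assoc)
    qed
  qed
qed

section \<open>Completeness of the spherical harmonics\<close>

definition planar :: "real ^ 3 \<Rightarrow> complex" where
  "planar p = Complex (p $ 1) (p $ 2)"

definition monom3 :: "nat \<Rightarrow> nat \<Rightarrow> nat \<Rightarrow> real ^ 3 \<Rightarrow> complex" where
  "monom3 a b c p = planar p ^ a * cnj (planar p) ^ b * complex_of_real (p $ 3) ^ c"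

lemma planar_continuous: "continuous_on A planar"
  unfolding planar_def Complex_eq by (intro continuous_intros)

lemma monom3_continuous: "continuous_on A (monom3 a b c)"
  unfolding monom3_def by (intro continuous_intros planar_continuous)

lemma planar_norm_squared: "p \<in> sphere 0 1 \<Longrightarrow> planar p * cnj (planar p) = complex_of_real (poly (- Lquad) (p $ 3))"
  using unit_sphere_coordinates[of p] by (simp add: planar_def complex_mult_cnj)

lemma azimuth_planar: "azimuth m p = (if m \<ge> 0 then planar p ^ nat m else cnj (planar p) ^ nat (- m))"
  by (simp add: azimuth_def planar_def)

text \<open>The functional \<open>T h = \<integral> G h\<close> annihilates larger and larger classes of functions: the products of a
  power of \<open>x \<plusminus> i y\<close> and a polynomial in \<open>z\<close>, polynomials, continuous functions, and indicator functions of
  closed and then of Borel sets. The last class forces \<open>G\<close> to vanish almost everywhere.\<close>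

locale orthogonal_to_harmonics =
  fixes G :: "real ^ 3 \<Rightarrow> complex"
  assumes sq: "square_integrable sphere_measure G"
    and orth: "\<And>l m. \<bar>m\<bar> \<le> int l \<Longrightarrow> (\<integral>p. G p * cnj (sph_harm_fun l m p) \<partial>sphere_measure) = 0"
begin

sublocale finite_measure sphere_measure by (rule finite_measure_sphere_measure)

definition T :: "(real ^ 3 \<Rightarrow> complex) \<Rightarrow> complex" where
  "T h = (\<integral>p. G p * h p \<partial>sphere_measure)"

lemma G_measurable [measurable]: "G \<in> borel_measurable sphere_measure"
  using sq by (simp add: square_integrable_def)

lemma borel_sphere: "h \<in> borel_measurable borel \<Longrightarrow> h \<in> borel_measurable sphere_measure"
  unfolding measurable_cong_sets[OF sets_sphere_measure refl] by (rule measurable_restrict_space1)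

lemma G_integrable: "integrable sphere_measure G"
proof -
  have "square_integrable sphere_measure (\<lambda>_. 1)" by (simp add: square_integrable_def)
  from square_integrable_times_cnj[OF sq this] show ?thesis by simp
qed

lemma bounded_integrable:
  assumes "h \<in> borel_measurable sphere_measure" "\<And>p. p \<in> sphere 0 1 \<Longrightarrow> norm (h p) \<le> B"
  shows "integrable sphere_measure (\<lambda>p. G p * h p)"
proof (rule Bochner_Integration.integrable_bound)
  show "integrable sphere_measure (\<lambda>p. complex_of_real B * G p)"
    using G_integrable by (rule integrable_mult_right)
  show "(\<lambda>p. G p * h p) \<in> borel_measurable sphere_measure" using assms(1) by measurable
  show "AE p in sphere_measure. norm (G p * h p) \<le> norm (complex_of_real B * G p)"
  proof (rule AE_I2)
    fix p assume "p \<in> space sphere_measure"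
    then have "norm (h p) \<le> \<bar>B\<bar>" using assms(2)[of p] by simp
    from mult_right_mono[OF this norm_ge_zero[of "G p"]]
    show "norm (G p * h p) \<le> norm (complex_of_real B * G p)"
      by (simp add: norm_mult mult.commute[of "norm (G p)"])
  qed
qed

lemma continuous_integrable:
  assumes "continuous_on UNIV h"
  shows "integrable sphere_measure (\<lambda>p. G p * h p)"
proof -
  have "bounded (h ` sphere 0 1)"
    by (intro compact_imp_bounded compact_continuous_image continuous_on_subset[OF assms]) auto
  then obtain B where "\<And>p. p \<in> sphere 0 1 \<Longrightarrow> norm (h p) \<le> B"
    unfolding bounded_iff by blast
  then show ?thesis
    by (intro bounded_integrable borel_sphere borel_measurable_continuous_onI assms)
qed

lemma T_cong: "(\<And>p. p \<in> sphere 0 1 \<Longrightarrow> h p = k p) \<Longrightarrow> T h = T k"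
  unfolding T_def by (intro Bochner_Integration.integral_cong) auto

lemma T_add: "continuous_on UNIV h \<Longrightarrow> continuous_on UNIV k \<Longrightarrow> T (\<lambda>p. h p + k p) = T h + T k"
  unfolding T_def by (subst Bochner_Integration.integral_add[symmetric]) (simp_all add: continuous_integrable distrib_left)

lemma T_scale: "T (\<lambda>p. c * h p) = c * T h"
  unfolding T_def by (subst integral_mult_right_zero[symmetric]) (simp add: ac_simps)

lemma harm_const_nonzero: "harm_const l m \<noteq> 0"
proof -
  have "0 < (2 * real l + 1) * fact (l - nat \<bar>m\<bar>) / (4 * pi * fact (l + nat \<bar>m\<bar>))"
    by (intro divide_pos_pos mult_pos_pos) auto
  then show ?thesis by (simp add: harm_const_def)
qed

lemma T_azimuth_rodrigues:
  assumes "\<bar>m\<bar> \<le> int l"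
  shows "T (\<lambda>p. cnj (azimuth m p) * complex_of_real (poly (rodrigues l (l + nat \<bar>m\<bar>)) (p $ 3))) = 0"
proof -
  have "0 = T (\<lambda>p. cnj (sph_harm_fun l m p))"
    using orth[OF assms] by (simp add: T_def)
  also have "\<dots> = T (\<lambda>p. complex_of_real (harm_const l m) * (cnj (azimuth m p) * complex_of_real (poly (rodrigues l (l + nat \<bar>m\<bar>)) (p $ 3))))"
    by (rule T_cong) (simp add: sph_harm_fun_polynomial assms mult.assoc)
  also have "\<dots> = complex_of_real (harm_const l m) * T (\<lambda>p. cnj (azimuth m p) * complex_of_real (poly (rodrigues l (l + nat \<bar>m\<bar>)) (p $ 3)))"
    by (rule T_scale)
  finally show ?thesis using harm_const_nonzero by simp
qed

text \<open>For fixed \<open>m\<close>, the polynomials \<open>rodrigues l (l + |m|)\<close>, \<open>l \<ge> |m|\<close>, have exactly the degrees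
  \<open>0, 1, 2, \<dots>\<close>, so they span all polynomials.\<close>

lemma T_azimuth_poly: "T (\<lambda>p. cnj (azimuth m p) * complex_of_real (poly q (p $ 3))) = 0"
proof (induction "degree q" arbitrary: q rule: less_induct)
  case less
  define l where "l = nat \<bar>m\<bar> + degree q"
  define R where "R = rodrigues l (l + nat \<bar>m\<bar>)"
  define c where "c = lead_coeff q / lead_coeff R"
  have dR: "degree R = degree q" by (simp add: R_def rodrigues_degree l_def)
  have R0: "R \<noteq> 0"
  proof -
    have "lead_coeff R * fact (2 * l - (l + nat \<bar>m\<bar>)) = fact (2 * l) * lead_coeff (Lquad ^ l)"
      using lead_coeff_pderiv_funpow[of "l + nat \<bar>m\<bar>" "Lquad ^ l"]
      by (simp add: R_def rodrigues_def degree_Lquad_power l_def)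
    then show ?thesis by (auto simp: lead_coeff_power)
  qed
  have c1: "continuous_on UNIV (\<lambda>p. cnj (azimuth m p) * complex_of_real (poly r (p $ 3)))" for r
    by (intro continuous_intros azimuth_continuous)
  have split: "T (\<lambda>p. cnj (azimuth m p) * complex_of_real (poly q (p $ 3)))
      = T (\<lambda>p. cnj (azimuth m p) * complex_of_real (poly (q - smult c R) (p $ 3)))
        + complex_of_real c * T (\<lambda>p. cnj (azimuth m p) * complex_of_real (poly R (p $ 3)))"
    unfolding T_scale[symmetric]
    by (subst T_add[symmetric]) (auto intro!: c1 continuous_intros azimuth_continuous T_cong simp: algebra_simps)
  have "T (\<lambda>p. cnj (azimuth m p) * complex_of_real (poly R (p $ 3))) = 0"
    unfolding R_def by (rule T_azimuth_rodrigues) (simp add: l_def)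
  moreover have "T (\<lambda>p. cnj (azimuth m p) * complex_of_real (poly (q - smult c R) (p $ 3))) = 0"
  proof (cases "degree q = 0")
    case True
    then obtain a b where "q = [:a:]" "R = [:b:]" using dR by (metis degree_eq_zeroE)
    then have "q - smult c R = 0" using R0 by (simp add: c_def)
    then show ?thesis by (simp add: T_def)
  next
    case False
    have "coeff (q - smult c R) (degree q) = 0"
    proof -
      have "coeff R (degree q) \<noteq> 0" using dR R0 by (metis leading_coeff_0_iff)
      then show ?thesis using dR by (simp add: c_def)
    qed
    moreover have "degree (q - smult c R) \<le> degree q"
      using dR by (intro degree_diff_le) auto
    ultimately have "degree (q - smult c R) < degree q"
      using False by (metis degree_0 gr0I leading_coeff_0_iff le_neq_implies_less)
    then show ?thesis by (rule less)
  qed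
  ultimately show ?case unfolding split by simp
qed

text \<open>Since \<open>(x + i y) (x - i y) = 1 - z\<^sup>2\<close> on the sphere, common powers of the two planar factors are
  polynomials in \<open>z\<close>, and a power of only one of them is left.\<close>

lemma T_monom3: "T (monom3 a b c) = 0"
proof -
  define m where "m = int b - int a"
  define q where "q = (- Lquad) ^ min a b * monom 1 c"
  have "T (monom3 a b c) = T (\<lambda>p. cnj (azimuth m p) * complex_of_real (poly q (p $ 3)))"
  proof (rule T_cong)
    fix p :: "real ^ 3" assume p: "p \<in> sphere 0 1"
    have q: "complex_of_real (poly q (p $ 3)) = (planar p * cnj (planar p)) ^ min a b * complex_of_real (p $ 3) ^ c"
      unfolding planar_norm_squared[OF p] by (simp add: q_def poly_power poly_monom)
    show "monom3 a b c p = cnj (azimuth m p) * complex_of_real (poly q (p $ 3))"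
    proof (cases "a \<le> b")
      case True
      then have "cnj (planar p) ^ b = cnj (planar p) ^ (b - a) * cnj (planar p) ^ a" by (simp flip: power_add)
      moreover have "nat m = b - a" "m \<ge> 0" using True by (auto simp: m_def)
      ultimately show ?thesis
        unfolding q using True by (simp add: monom3_def azimuth_planar power_mult_distrib min_def)
    next
      case False
      then have "planar p ^ a = planar p ^ (a - b) * planar p ^ b" by (simp flip: power_add)
      moreover have "nat (- m) = a - b" "\<not> m \<ge> 0" using False by (auto simp: m_def)
      ultimately show ?thesis
        unfolding q using False by (simp add: monom3_def azimuth_planar power_mult_distrib min_def)
    qed
  qed
  then show ?thesis by (simp add: T_azimuth_poly)
qed

text \<open>The kernel of \<open>T\<close> is not closed under products. The functions that stay in it after multiplication by
  every monomial are preserved by multiplication by polynomials, which allows an induction over the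
  construction of a polynomial function.\<close>

definition stable_kernel :: "(real ^ 3 \<Rightarrow> complex) \<Rightarrow> bool" where
  "stable_kernel k \<longleftrightarrow> continuous_on UNIV k \<and> (\<forall>a b c. T (\<lambda>p. k p * monom3 a b c p) = 0)"

lemma stable_kernel_add: "stable_kernel h \<Longrightarrow> stable_kernel k \<Longrightarrow> stable_kernel (\<lambda>p. h p + k p)"
  unfolding stable_kernel_def
  by (auto simp: distrib_right intro!: continuous_intros) (subst T_add; auto intro!: continuous_intros monom3_continuous)

lemma stable_kernel_scale:
  assumes "stable_kernel k"
  shows "stable_kernel (\<lambda>p. c * k p)"
  using assms unfolding stable_kernel_def
  by (auto intro!: continuous_intros simp: mult.assoc T_scale)

lemma stable_kernel_shift:
  assumes "stable_kernel k"
  shows "stable_kernel (\<lambda>p. planar p * k p)" "stable_kernel (\<lambda>p. cnj (planar p) * k p)"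
    "stable_kernel (\<lambda>p. complex_of_real (p $ 3) * k p)"
proof -
  have c: "continuous_on UNIV k" and z: "T (\<lambda>p. k p * monom3 a b c p) = 0" for a b c
    using assms by (auto simp: stable_kernel_def)
  have "planar p * k p * monom3 a b c p = k p * monom3 (Suc a) b c p" for a b c p
    by (simp add: monom3_def)
  then have "T (\<lambda>p. planar p * k p * monom3 a b c p) = 0" for a b c by (simp only: z)
  then show "stable_kernel (\<lambda>p. planar p * k p)"
    unfolding stable_kernel_def by (auto intro!: continuous_intros planar_continuous c)
  have "cnj (planar p) * k p * monom3 a b c p = k p * monom3 a (Suc b) c p" for a b c p
    by (simp add: monom3_def)
  then have "T (\<lambda>p. cnj (planar p) * k p * monom3 a b c p) = 0" for a b c by (simp only: z)
  then show "stable_kernel (\<lambda>p. cnj (planar p) * k p)"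
    unfolding stable_kernel_def by (auto intro!: continuous_intros planar_continuous c)
  have "complex_of_real (p $ 3) * k p * monom3 a b c p = k p * monom3 a b (Suc c) p" for a b c p
    by (simp add: monom3_def)
  then have "T (\<lambda>p. complex_of_real (p $ 3) * k p * monom3 a b c p) = 0" for a b c by (simp only: z)
  then show "stable_kernel (\<lambda>p. complex_of_real (p $ 3) * k p)"
    unfolding stable_kernel_def by (auto intro!: continuous_intros c)
qed

lemma stable_kernel_polynomial:
  assumes "real_polynomial_function h" "stable_kernel k"
  shows "stable_kernel (\<lambda>p. complex_of_real (h p) * k p)"
  using assms
proof (induction arbitrary: k)
  case (linear f)
  then interpret f: bounded_linear f by simp
  define \<alpha> \<beta> \<gamma> where "\<alpha> = f (axis 1 1)" "\<beta> = f (axis 2 1)" "\<gamma> = f (axis 3 1)"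
  have fp: "f p = p $ 1 * \<alpha> + p $ 2 * \<beta> + p $ 3 * \<gamma>" for p
  proof -
    have "p = p $ 1 *\<^sub>R axis 1 1 + p $ 2 *\<^sub>R axis 2 1 + p $ 3 *\<^sub>R axis 3 1"
      by (simp add: vec_eq_iff forall_3 axis_def)
    then have "f p = f (p $ 1 *\<^sub>R axis 1 1 + p $ 2 *\<^sub>R axis 2 1 + p $ 3 *\<^sub>R axis 3 1)" by simp
    then show ?thesis by (simp only: f.add f.scaleR \<alpha>_\<beta>_\<gamma>_def real_scaleR_def)
  qed
  \<comment> \<open>The Cartesian coordinates in terms of \<open>w = x + i y\<close>: \<open>x = (w + cnj w) / 2\<close> and \<open>y = (w - cnj w) / (2 i)\<close>.\<close>
  have "complex_of_real (f p) * k p = (complex_of_real \<alpha> / 2 + complex_of_real \<beta> / (2 * \<i>)) * (planar p * k p)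
      + ((complex_of_real \<alpha> / 2 - complex_of_real \<beta> / (2 * \<i>)) * (cnj (planar p) * k p)
      + complex_of_real \<gamma> * (complex_of_real (p $ 3) * k p))" for p
  proof -
    have "complex_of_real (f p) = (complex_of_real \<alpha> / 2 + complex_of_real \<beta> / (2 * \<i>)) * planar p
      + ((complex_of_real \<alpha> / 2 - complex_of_real \<beta> / (2 * \<i>)) * cnj (planar p) + complex_of_real \<gamma> * complex_of_real (p $ 3))"
      by (simp add: fp planar_def complex_eq_iff field_simps)
    then show ?thesis by (simp only: distrib_right mult.assoc)
  qed
  then show ?case
    by (simp only:) (intro stable_kernel_add stable_kernel_scale stable_kernel_shift linear)
next
  case (const c)
  then show ?case by (rule stable_kernel_scale)
next
  case (add f g)
  then show ?case using stable_kernel_add[OF add.IH(1)[OF add.prems] add.IH(2)[OF add.prems]]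
    by (simp add: distrib_right)
next
  case (mult f g)
  then show ?case using mult.IH(1)[OF mult.IH(2)[OF mult.prems]] by (simp add: mult.assoc)
qed

lemma T_polynomial:
  assumes "real_polynomial_function h"
  shows "T (\<lambda>p. complex_of_real (h p)) = 0"
proof -
  have "stable_kernel (\<lambda>_. 1)" by (simp add: stable_kernel_def T_monom3)
  from stable_kernel_polynomial[OF assms this]
  have "T (\<lambda>p. complex_of_real (h p) * monom3 0 0 0 p) = 0" by (simp add: stable_kernel_def)
  then show ?thesis by (simp add: monom3_def)
qed

lemma T_continuous:
  fixes h :: "real ^ 3 \<Rightarrow> real"
  assumes h: "continuous_on UNIV h"
  shows "T (\<lambda>p. complex_of_real (h p)) = 0"
proof -
  define K where "K = (\<integral>p. norm (G p) \<partial>sphere_measure)"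
  have K0: "0 \<le> K" by (simp add: K_def)
  have "norm (T (\<lambda>p. complex_of_real (h p))) \<le> \<epsilon> * K" if \<epsilon>: "0 < \<epsilon>" for \<epsilon>
  proof -
    obtain q where q: "real_polynomial_function q" "\<And>p. p \<in> sphere 0 1 \<Longrightarrow> \<bar>h p - q p\<bar> < \<epsilon>"
      using Stone_Weierstrass_real_polynomial_function[OF _ continuous_on_subset[OF h] \<epsilon>, of "sphere 0 1"] by auto
    have qc: "continuous_on UNIV q"
      using q(1) by (simp add: continuous_on_polymonial_function real_polynomial_function_eq)
    have c: "continuous_on UNIV (\<lambda>p. complex_of_real (h p - q p))" by (intro continuous_intros h qc)
    have "T (\<lambda>p. complex_of_real (h p)) = T (\<lambda>p. complex_of_real (h p - q p) + complex_of_real (q p))" by simp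
    also have "\<dots> = T (\<lambda>p. complex_of_real (h p - q p)) + T (\<lambda>p. complex_of_real (q p))"
      by (rule T_add[OF c]) (intro continuous_intros qc)
    finally have "T (\<lambda>p. complex_of_real (h p)) = T (\<lambda>p. complex_of_real (h p - q p))"
      by (simp add: T_polynomial[OF q(1)])
    also have "norm \<dots> \<le> (\<integral>p. \<epsilon> * norm (G p) \<partial>sphere_measure)"
      unfolding T_def
    proof (rule Bochner_Integration.integral_norm_bound_integral)
      show "norm (G p * complex_of_real (h p - q p)) \<le> \<epsilon> * norm (G p)" if "p \<in> space sphere_measure" for p
        unfolding norm_mult norm_of_real mult.commute[of "norm (G p)"]
        using q(2)[of p] that by (intro mult_right_mono) auto
    qed (intro continuous_integrable c integrable_mult_right integrable_norm G_integrable)+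
    also have "\<dots> = \<epsilon> * K" by (simp add: K_def)
    finally show ?thesis .
  qed
  then have "norm (T (\<lambda>p. complex_of_real (h p))) \<le> \<delta>" if "0 < \<delta>" for \<delta>
  proof -
    have "\<delta> / (K + 1) * K \<le> \<delta>" using that K0 by (simp add: divide_le_eq mult_left_mono)
    moreover have "0 < \<delta> / (K + 1)" using that K0 by simp
    ultimately show ?thesis
      using \<open>\<And>\<epsilon>. 0 < \<epsilon> \<Longrightarrow> norm (T (\<lambda>p. complex_of_real (h p))) \<le> \<epsilon> * K\<close> order_trans by blast
  qed
  then have "norm (T (\<lambda>p. complex_of_real (h p))) \<le> 0"
    by (metis dense_ge)
  then show ?thesis by simp
qed

lemma T_closed:
  assumes F: "closed F"
  shows "T (\<lambda>p. indicator F p) = 0"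
proof (cases "F = {}")
  case True
  then show ?thesis by (simp add: T_def)
next
  case False
  \<comment> \<open>Continuous functions that decrease to the indicator function of \<open>F\<close>.\<close>
  define h where "h n p = max 0 (1 - real n * infdist p F)" for n and p :: "real ^ 3"
  have hc: "continuous_on UNIV (h n)" for n
    unfolding h_def by (intro continuous_intros)
  have [measurable]: "h n \<in> borel_measurable sphere_measure" for n
    by (intro borel_sphere borel_measurable_continuous_onI hc)
  have [measurable]: "F \<in> sets borel" using F by (rule borel_closed)
  have "(\<lambda>n. T (\<lambda>p. complex_of_real (h n p))) \<longlonglongrightarrow> T (\<lambda>p. indicator F p)"
    unfolding T_def
  proof (rule integral_dominated_convergence[where w="\<lambda>p. norm (G p)"])
    show "(\<lambda>p. G p * indicator F p) \<in> borel_measurable sphere_measure"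
      by (intro borel_measurable_times G_measurable borel_sphere) measurable
    show "(\<lambda>p. G p * complex_of_real (h n p)) \<in> borel_measurable sphere_measure" for n
      by measurable
    show "integrable sphere_measure (\<lambda>p. norm (G p))" by (intro integrable_norm G_integrable)
    show "AE p in sphere_measure. (\<lambda>n. G p * complex_of_real (h n p)) \<longlonglongrightarrow> G p * indicator F p"
    proof (rule AE_I2)
      fix p
      have "(\<lambda>n. h n p) \<longlonglongrightarrow> indicator F p"
      proof (cases "p \<in> F")
        case True
        then show ?thesis by (simp add: h_def)
      next
        case pF: False
        then have d: "0 < infdist p F"
          using F False in_closed_iff_infdist_zero[of F p] infdist_nonneg[of p F] by (metis less_eq_real_def)
        obtain N where N: "1 < real N * infdist p F"
          using reals_Archimedean3[OF d] by blast
        have "h n p = 0" if "N \<le> n" for n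
        proof -
          have "real N * infdist p F \<le> real n * infdist p F" using that d by (intro mult_right_mono) auto
          then show ?thesis using N by (simp add: h_def)
        qed
        then have "\<forall>\<^sub>F n in sequentially. h n p = 0" by (auto simp: eventually_sequentially)
        then show ?thesis using pF by (simp add: tendsto_eventually)
      qed
      then have "(\<lambda>n. complex_of_real (h n p)) \<longlonglongrightarrow> complex_of_real (indicator F p)" by (rule tendsto_of_real)
      then show "(\<lambda>n. G p * complex_of_real (h n p)) \<longlonglongrightarrow> G p * indicator F p"
        by (intro tendsto_mult tendsto_const) (simp only: of_real_indicator)
    qed
    show "AE p in sphere_measure. norm (G p * complex_of_real (h n p)) \<le> norm (G p)" for n
    proof (rule AE_I2)
      fix p
      have "\<bar>h n p\<bar> \<le> 1" using infdist_nonneg[of p F] by (simp add: h_def)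
      then show "norm (G p * complex_of_real (h n p)) \<le> norm (G p)"
        using mult_left_mono[of "\<bar>h n p\<bar>" 1 "norm (G p)"] by (simp add: norm_mult)
    qed
  qed
  then show ?thesis by (simp add: T_continuous[OF hc] LIMSEQ_const_iff)
qed

text \<open>Closed sets are stable under intersection and generate the Borel sets, and the sets annihilated by
  \<open>T\<close> form a Dynkin system.\<close>

lemma T_borel:
  assumes "A \<in> sets borel"
  shows "T (\<lambda>p. indicator A p) = 0"
proof -
  have int: "integrable sphere_measure (\<lambda>p. G p * indicator B p)" if "B \<in> sets borel" for B :: "(real ^ 3) set"
    by (rule bounded_integrable[where B=1], intro borel_sphere) (use that in \<open>auto simp: indicator_def\<close>)
  have "Int_stable (Collect closed :: (real ^ 3) set set)" by (auto simp: Int_stable_def)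
  moreover have "Collect closed \<subseteq> Pow (UNIV :: (real ^ 3) set)" by simp
  moreover have "A \<in> sigma_sets UNIV (Collect closed)" using assms by (simp add: borel_eq_closed)
  ultimately show ?thesis
  proof (induction A rule: sigma_sets_induct_disjoint)
    case (basic A)
    then show ?case by (intro T_closed) auto
  next
    case empty
    then show ?case by (simp add: T_def)
  next
    case (compl A)
    then have A: "A \<in> sets borel" by (simp add: borel_eq_closed)
    have G1: "integrable sphere_measure (\<lambda>p. G p * 1)" using G_integrable by simp
    have "T (\<lambda>p. indicator (UNIV - A) p) = T (\<lambda>p. 1) - T (\<lambda>p. indicator A p)"
      unfolding T_def Bochner_Integration.integral_diff[OF G1 int[OF A], symmetric]
      by (intro Bochner_Integration.integral_cong) (auto simp: indicator_def)
    also have "T (\<lambda>p. 1) = 0" using T_closed[of UNIV] by simp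
    finally show ?case using compl by simp
  next
    case (union A)
    then have A: "A i \<in> sets borel" for i by (auto simp: borel_eq_closed)
    have "(\<lambda>n. T (\<lambda>p. indicator (\<Union>i<n. A i) p)) \<longlonglongrightarrow> T (\<lambda>p. indicator (\<Union>i. A i) p)"
      unfolding T_def
    proof (rule integral_dominated_convergence[where w="\<lambda>p. norm (G p)"])
      show "AE p in sphere_measure. (\<lambda>n. G p * indicator (\<Union>i<n. A i) p) \<longlonglongrightarrow> G p * indicator (\<Union>i. A i) p"
        by (intro AE_I2 tendsto_mult tendsto_const LIMSEQ_indicator_UN)
      show "AE p in sphere_measure. norm (G p * indicator (\<Union>i<n. A i) p) \<le> norm (G p)" for n
        by (auto simp: indicator_def)
    qed (use int A in \<open>auto intro!: borel_measurable_integrable integrable_norm G_integrable int\<close>)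
    moreover have "T (\<lambda>p. indicator (\<Union>i<n. A i) p) = 0" for n
    proof -
      have eq: "indicator (\<Union>i<n. A i) p = (\<Sum>i<n. indicator (A i) p :: complex)" for p
        by (rule indicator_UN_disjoint) (use union in \<open>auto simp: disjoint_family_on_def\<close>)
      have "T (\<lambda>p. indicator (\<Union>i<n. A i) p) = (\<Sum>i<n. T (\<lambda>p. indicator (A i) p))"
        unfolding T_def eq sum_distrib_left using int A by (subst Bochner_Integration.integral_sum) auto
      then show ?thesis using union by simp
    qed
    ultimately show ?case by (simp add: LIMSEQ_const_iff)
  qed
qed

lemma G_zero: "AE p in sphere_measure. G p = 0"
proof (rule density_zero[OF G_integrable])
  fix A assume "A \<in> sets sphere_measure"
  then obtain B where B: "B \<in> sets borel" "A = B \<inter> sphere 0 1"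
    by (auto simp: sets_sphere_measure sets_restrict_space)
  have "set_lebesgue_integral sphere_measure A G = T (\<lambda>p. indicator B p)"
    unfolding set_lebesgue_integral_def T_def
    by (intro Bochner_Integration.integral_cong) (auto simp: B indicator_def)
  then show "set_lebesgue_integral sphere_measure A G = 0" by (simp add: T_borel[OF B(1)])
qed

end

theorem sph_harm_complete:
  assumes "\<And>l m. \<bar>m\<bar> \<le> int l \<Longrightarrow> inner_l2 g (sph_harm l m) = 0"
  shows "g = 0"
  using assms
proof (transfer, goal_cases)
  case (1 g)
  interpret orthogonal_to_harmonics g
    by unfold_locales (use 1 in auto)
  show ?case
    using 1 G_zero by (simp add: square_integrable_def)
qed

section \<open>Expansion in spherical harmonics\<close>

lemma fl_coeff_add: "fl_coeff (f + g) l m = fl_coeff f l m + fl_coeff g l m"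
  and fl_coeff_diff: "fl_coeff (f - g) l m = fl_coeff f l m - fl_coeff g l m"
  and fl_coeff_scaleC: "fl_coeff (c *\<^sub>C f) l m = c * fl_coeff f l m"
  and fl_coeff_scaleR: "fl_coeff (r *\<^sub>R f) l m = r *\<^sub>R fl_coeff f l m"
  and fl_coeff_sum: "fl_coeff (\<Sum>i\<in>A. h i) l m = (\<Sum>i\<in>A. fl_coeff (h i) l m)"
  and fl_coeff_zero [simp]: "fl_coeff 0 l m = 0"
  by (simp_all add: fl_coeff_def inner_l2_add_left inner_l2_diff_left inner_l2_scaleC_left
      inner_l2_scaleR_left inner_l2_sum_left)

lemma fl_coeff_sph_harm:
  "\<bar>m\<bar> \<le> int l \<Longrightarrow> \<bar>m'\<bar> \<le> int l' \<Longrightarrow> fl_coeff (sph_harm l m) l' m' = (if l = l' \<and> m = m' then 1 else 0)"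
  by (simp add: fl_coeff_def sph_harm_orthonormal)

text \<open>Completeness of the harmonics is used through this rule: a function is determined by its
  coefficients.\<close>

lemma l2_sphere_eqI:
  assumes "\<And>l m. \<bar>m\<bar> \<le> int l \<Longrightarrow> fl_coeff f l m = fl_coeff g l m"
  shows "f = g"
proof -
  have "f - g = 0"
    by (rule sph_harm_complete) (use assms in \<open>simp add: fl_coeff_def inner_l2_diff_left\<close>)
  then show ?thesis by simp
qed

definition harm_sum :: "(nat \<Rightarrow> int \<Rightarrow> complex) \<Rightarrow> nat set \<Rightarrow> l2_sphere" where
  "harm_sum c A = (\<Sum>l\<in>A. \<Sum>m\<in>{- int l..int l}. c l m *\<^sub>C sph_harm l m)"

text \<open>The power spectrum of an arbitrary family of coefficients, which need not belong to a function.\<close>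

definition spec :: "(nat \<Rightarrow> int \<Rightarrow> complex) \<Rightarrow> nat \<Rightarrow> real" where
  "spec c l = (\<Sum>m\<in>{- int l..int l}. (cmod (c l m))\<^sup>2)"

lemma power_spectrum_spec: "power_spectrum l f = spec (fl_coeff f) l"
  by (simp add: power_spectrum_def spec_def)

lemma spec_nonneg: "0 \<le> spec c l"
  by (simp add: spec_def sum_nonneg)

lemma power_spectrum_nonneg [simp]: "0 \<le> power_spectrum l f"
  by (simp add: power_spectrum_spec spec_nonneg)

lemma spec_cong: "(\<And>m. \<bar>m\<bar> \<le> int l \<Longrightarrow> c l m = d l m) \<Longrightarrow> spec c l = spec d l"
  unfolding spec_def by (intro sum.cong) auto

lemma spec_mono:
  assumes "\<And>m. \<bar>m\<bar> \<le> int l \<Longrightarrow> cmod (c l m) \<le> B * cmod (d l m)"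
  shows "spec c l \<le> B\<^sup>2 * spec d l"
  unfolding spec_def sum_distrib_left
proof (rule sum_mono)
  fix m assume "m \<in> {- int l..int l}"
  then have "cmod (c l m) \<le> B * cmod (d l m)" by (intro assms) auto
  then have "(cmod (c l m))\<^sup>2 \<le> (B * cmod (d l m))\<^sup>2" by (intro power_mono) auto
  then show "(cmod (c l m))\<^sup>2 \<le> B\<^sup>2 * (cmod (d l m))\<^sup>2" by (simp add: power_mult_distrib)
qed

lemma norm_le_spec: "\<bar>m\<bar> \<le> int l \<Longrightarrow> (cmod (c l m))\<^sup>2 \<le> spec c l"
  unfolding spec_def by (intro member_le_sum) auto

lemma fl_coeff_harm_sum:
  assumes "finite A" "\<bar>m\<bar> \<le> int l"
  shows "fl_coeff (harm_sum c A) l m = (if l \<in> A then c l m else 0)"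
proof -
  have "fl_coeff (harm_sum c A) l m = (\<Sum>k\<in>A. \<Sum>j\<in>{- int k..int k}. c k j * fl_coeff (sph_harm k j) l m)"
    by (simp add: harm_sum_def fl_coeff_sum fl_coeff_scaleC)
  also have "\<dots> = (\<Sum>k\<in>A. \<Sum>j\<in>{- int k..int k}. if k = l then if j = m then c k j else 0 else 0)"
    using assms by (intro sum.cong refl) (auto simp: fl_coeff_sph_harm)
  also have "\<dots> = (\<Sum>k\<in>A. if k = l then c l m else 0)"
    using assms by (intro sum.cong refl) (auto simp: abs_le_iff)
  also have "\<dots> = (if l \<in> A then c l m else 0)"
    using assms by simp
  finally show ?thesis .
qed

lemma inner_harm_sum: "inner_l2 (harm_sum c A) h = (\<Sum>l\<in>A. \<Sum>m\<in>{- int l..int l}. c l m * cnj (fl_coeff h l m))"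
  unfolding harm_sum_def inner_l2_sum_left inner_l2_scaleC_left fl_coeff_def inner_l2_commute[of "sph_harm _ _" h] ..

lemma norm_harm_sum:
  assumes "finite A"
  shows "(norm (harm_sum c A))\<^sup>2 = (\<Sum>l\<in>A. spec c l)"
proof -
  have "complex_of_real ((norm (harm_sum c A))\<^sup>2) = (\<Sum>l\<in>A. \<Sum>m\<in>{- int l..int l}. c l m * cnj (fl_coeff (harm_sum c A) l m))"
    by (simp only: inner_l2_self[symmetric] inner_harm_sum)
  also have "\<dots> = (\<Sum>l\<in>A. \<Sum>m\<in>{- int l..int l}. complex_of_real ((cmod (c l m))\<^sup>2))"
    using assms by (intro sum.cong refl) (auto simp: fl_coeff_harm_sum abs_le_iff complex_norm_square simp del: of_real_power)
  also have "\<dots> = complex_of_real (\<Sum>l\<in>A. spec c l)"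
    by (simp add: spec_def)
  finally show ?thesis by (simp only: of_real_eq_iff)
qed

lemma norm_minus_harm_sum:
  assumes "finite A"
  shows "(norm (f - harm_sum (fl_coeff f) A))\<^sup>2 = (norm f)\<^sup>2 - (\<Sum>l\<in>A. power_spectrum l f)"
proof -
  have "inner_l2 (harm_sum (fl_coeff f) A) f = (\<Sum>l\<in>A. \<Sum>m\<in>{- int l..int l}. complex_of_real ((cmod (fl_coeff f l m))\<^sup>2))"
    by (simp add: inner_harm_sum complex_norm_square del: of_real_power)
  also have "\<dots> = complex_of_real (\<Sum>l\<in>A. power_spectrum l f)" by (simp add: power_spectrum_def)
  finally have "inner_l2 f (harm_sum (fl_coeff f) A) = complex_of_real (\<Sum>l\<in>A. power_spectrum l f)"
    by (subst inner_l2_commute) simp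
  then show ?thesis
    unfolding norm_diff_l2_sphere_squared norm_harm_sum[OF assms] by (simp add: power_spectrum_spec)
qed

lemma bessel: "finite A \<Longrightarrow> (\<Sum>l\<in>A. power_spectrum l f) \<le> (norm f)\<^sup>2"
  using norm_minus_harm_sum[of A f] zero_le_power2[of "norm (f - harm_sum (fl_coeff f) A)"] by linarith

lemma norm_fl_coeff_le:
  assumes "\<bar>m\<bar> \<le> int l"
  shows "cmod (fl_coeff f l m) \<le> norm f"
proof -
  have "(cmod (fl_coeff f l m))\<^sup>2 \<le> (norm f)\<^sup>2"
  proof -
    have "power_spectrum l f \<le> (norm f)\<^sup>2" using bessel[of "{l}" f] by simp
    then show ?thesis
      using norm_le_spec[of m l "fl_coeff f", OF assms] unfolding power_spectrum_spec by (rule order_trans[rotated])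
  qed
  then show ?thesis by (rule power2_le_imp_le) simp
qed

lemma bounded_linear_fl_coeff: "\<bar>m\<bar> \<le> int l \<Longrightarrow> bounded_linear (\<lambda>f. fl_coeff f l m)"
  by (rule bounded_linear_intro[where K=1]) (simp_all add: fl_coeff_add fl_coeff_scaleR norm_fl_coeff_le)

definition from_coeff :: "(nat \<Rightarrow> int \<Rightarrow> complex) \<Rightarrow> l2_sphere" where
  "from_coeff c = (\<Sum>l. \<Sum>m\<in>{- int l..int l}. c l m *\<^sub>C sph_harm l m)"

text \<open>By orthonormality the squared norm of a block of the series is a block of the convergent series of
  \<open>spec c\<close>, so the Cauchy criterion applies.\<close>

theorem riesz_fischer:
  assumes "summable (spec c)"
  shows "(\<lambda>n. harm_sum c {..<n}) \<longlonglongrightarrow> from_coeff c"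
proof -
  have "summable (\<lambda>l. \<Sum>m\<in>{- int l..int l}. c l m *\<^sub>C sph_harm l m)"
  proof (rule summable_Cauchy[THEN iffD2], intro allI impI)
    fix r :: real assume "0 < r"
    then obtain N where N: "\<And>m n. N \<le> m \<Longrightarrow> norm (sum (spec c) {m..<n}) < r\<^sup>2"
      using summable_Cauchy[THEN iffD1, OF assms] by (meson zero_less_power)
    show "\<exists>N. \<forall>m\<ge>N. \<forall>n. norm (\<Sum>l\<in>{m..<n}. \<Sum>k\<in>{- int l..int l}. c l k *\<^sub>C sph_harm l k) < r"
    proof (intro exI allI impI)
      fix m n assume "N \<le> m"
      have "(norm (harm_sum c {m..<n}))\<^sup>2 < r\<^sup>2"
        using N[OF \<open>N \<le> m\<close>, of n] by (simp add: norm_harm_sum)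
      then show "norm (\<Sum>l\<in>{m..<n}. \<Sum>k\<in>{- int l..int l}. c l k *\<^sub>C sph_harm l k) < r"
        using \<open>0 < r\<close> by (simp add: harm_sum_def power2_less_imp_less)
    qed
  qed
  then show ?thesis
    unfolding from_coeff_def harm_sum_def by (rule summable_LIMSEQ)
qed

lemma fl_coeff_from_coeff:
  assumes "summable (spec c)" "\<bar>m\<bar> \<le> int l"
  shows "fl_coeff (from_coeff c) l m = c l m"
proof (rule LIMSEQ_unique)
  show "(\<lambda>n. fl_coeff (harm_sum c {..<n}) l m) \<longlonglongrightarrow> fl_coeff (from_coeff c) l m"
    by (rule bounded_linear.tendsto[OF bounded_linear_fl_coeff[OF assms(2)] riesz_fischer[OF assms(1)]])
  have "\<forall>\<^sub>F n in sequentially. fl_coeff (harm_sum c {..<n}) l m = c l m"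
    using eventually_gt_at_top[of l] by eventually_elim (simp add: fl_coeff_harm_sum assms(2))
  then show "(\<lambda>n. fl_coeff (harm_sum c {..<n}) l m) \<longlonglongrightarrow> c l m"
    by (rule tendsto_eventually)
qed

lemma summable_power_spectrum: "summable (\<lambda>l. power_spectrum l f)"
  by (rule bounded_imp_summable[where B="(norm f)\<^sup>2"]) (simp_all add: bessel)

lemma from_coeff_fl_coeff: "from_coeff (fl_coeff f) = f"
  using summable_power_spectrum[of f]
  by (intro l2_sphere_eqI fl_coeff_from_coeff) (simp_all add: power_spectrum_spec)

theorem parseval: "norm f = sqrt (\<Sum>l. power_spectrum l f)"
proof -
  have "(\<lambda>n. harm_sum (fl_coeff f) {..<n}) \<longlonglongrightarrow> f"
    using riesz_fischer[of "fl_coeff f"] summable_power_spectrum[of f]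
    by (simp add: power_spectrum_spec from_coeff_fl_coeff)
  then have "(\<lambda>n. (norm (harm_sum (fl_coeff f) {..<n}))\<^sup>2) \<longlonglongrightarrow> (norm f)\<^sup>2"
    by (intro tendsto_intros)
  moreover have "(norm (harm_sum (fl_coeff f) {..<n}))\<^sup>2 = (\<Sum>l<n. power_spectrum l f)" for n
    by (simp add: norm_harm_sum power_spectrum_spec)
  ultimately have "(norm f)\<^sup>2 = (\<Sum>l. power_spectrum l f)"
    using summable_LIMSEQ[OF summable_power_spectrum[of f]] LIMSEQ_unique by fastforce
  then show ?thesis by (metis norm_ge_zero real_sqrt_abs abs_of_nonneg)
qed

section \<open>Sobolev norms in terms of coefficients\<close>

lemma sobolev_summable: "f \<in> sobolev s \<Longrightarrow> summable (\<lambda>l. real l powr (2 * s) * power_spectrum l f)"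
  by (simp add: sobolev_def)

lemma sobolevI_coeff:
  assumes "summable (spec c)" "summable (\<lambda>l. real l powr (2 * s) * spec c l)"
  shows "from_coeff c \<in> sobolev s"
proof -
  have "power_spectrum l (from_coeff c) = spec c l" for l
    unfolding power_spectrum_spec by (rule spec_cong) (simp add: fl_coeff_from_coeff assms)
  then show ?thesis using assms by (simp add: sobolev_def)
qed

text \<open>Parseval's identity makes the Sobolev norm a monotone function of the moduli of the coefficients.\<close>

lemma sobolev_dominated:
  assumes f: "f \<in> sobolev s"
    and le: "\<And>l m. \<bar>m\<bar> \<le> int l \<Longrightarrow> cmod (fl_coeff g l m) \<le> C * cmod (fl_coeff f l m)" and C: "0 \<le> C"
  shows "g \<in> sobolev s" "sobolev_norm s g \<le> C * sobolev_norm s f"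
proof -
  have p: "power_spectrum l g \<le> C\<^sup>2 * power_spectrum l f" for l
    unfolding power_spectrum_spec by (rule spec_mono) (rule le)
  have p': "real l powr (2 * s) * power_spectrum l g \<le> C\<^sup>2 * (real l powr (2 * s) * power_spectrum l f)" for l
    using mult_left_mono[OF p[of l], of "real l powr (2 * s)"] by (simp add: ac_simps)
  have sf: "summable (\<lambda>l. C\<^sup>2 * (real l powr (2 * s) * power_spectrum l f))"
    by (intro summable_mult sobolev_summable f)
  show g: "g \<in> sobolev s"
    unfolding sobolev_def mem_Collect_eq
    by (rule summable_comparison_test'[OF sf, of 0]) (use p' in simp)
  have "sqrt (\<Sum>l. power_spectrum l g) \<le> sqrt (C\<^sup>2 * (\<Sum>l. power_spectrum l f))"
    unfolding suminf_mult[OF summable_power_spectrum, symmetric]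
    by (intro real_sqrt_le_mono suminf_le summable_power_spectrum summable_mult p)
  moreover have "sqrt (\<Sum>l. real l powr (2 * s) * power_spectrum l g) \<le> sqrt (C\<^sup>2 * (\<Sum>l. real l powr (2 * s) * power_spectrum l f))"
    unfolding suminf_mult[OF sobolev_summable[OF f], symmetric]
    by (intro real_sqrt_le_mono suminf_le sf p' sobolev_summable g)
  ultimately show "sobolev_norm s g \<le> C * sobolev_norm s f"
    using C by (simp add: sobolev_norm_def parseval[of g] parseval[of f] real_sqrt_mult distrib_left)
qed

lemma sobolev_coeffI:
  assumes f: "f \<in> sobolev s"
    and le: "\<And>l m. \<bar>m\<bar> \<le> int l \<Longrightarrow> cmod (c l m) \<le> C * cmod (fl_coeff f l m)" and C: "0 \<le> C"
  shows "summable (spec c)" "from_coeff c \<in> sobolev s"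
    "\<And>l m. \<bar>m\<bar> \<le> int l \<Longrightarrow> fl_coeff (from_coeff c) l m = c l m"
proof -
  have "spec c l \<le> C\<^sup>2 * power_spectrum l f" for l
    unfolding power_spectrum_spec by (rule spec_mono) (rule le)
  then show sc: "summable (spec c)"
    by (intro summable_comparison_test'[OF summable_mult[OF summable_power_spectrum], of 0])
      (simp add: spec_nonneg)
  show eq: "\<And>l m. \<bar>m\<bar> \<le> int l \<Longrightarrow> fl_coeff (from_coeff c) l m = c l m"
    by (rule fl_coeff_from_coeff[OF sc])
  show "from_coeff c \<in> sobolev s"
    by (rule sobolev_dominated(1)[OF f _ C]) (simp add: eq le)
qed

text \<open>The operator with symbol \<open>l powr s\<close>; it turns the homogeneous Sobolev seminorm into an \<open>L\<^sup>2\<close> norm,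
  which is where the triangle inequality for \<^const>\<open>sobolev_norm\<close> comes from.\<close>

definition frac_deriv :: "real \<Rightarrow> l2_sphere \<Rightarrow> l2_sphere" where
  "frac_deriv s f = from_coeff (\<lambda>l m. complex_of_real (real l powr s) * fl_coeff f l m)"

lemma spec_frac_deriv: "spec (\<lambda>l m. complex_of_real (real l powr s) * fl_coeff f l m) l = real l powr (2 * s) * power_spectrum l f"
proof -
  have "(real l powr s)\<^sup>2 = real l powr (2 * s)" by (simp add: power2_eq_square flip: powr_add)
  then show ?thesis
    by (simp add: spec_def power_spectrum_def sum_distrib_left norm_mult power_mult_distrib)
qed

lemma fl_coeff_frac_deriv:
  "f \<in> sobolev s \<Longrightarrow> \<bar>m\<bar> \<le> int l \<Longrightarrow> fl_coeff (frac_deriv s f) l m = complex_of_real (real l powr s) * fl_coeff f l m"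
  unfolding frac_deriv_def
  by (rule fl_coeff_from_coeff) (simp_all add: ext[of "spec _", OF spec_frac_deriv] sobolev_def)

lemma sobolev_norm_frac_deriv:
  assumes "f \<in> sobolev s"
  shows "sobolev_norm s f = norm f + norm (frac_deriv s f)"
proof -
  have "power_spectrum l (frac_deriv s f) = real l powr (2 * s) * power_spectrum l f" for l
    unfolding spec_frac_deriv[symmetric] power_spectrum_spec[of l "frac_deriv s f"]
    by (rule spec_cong) (simp add: fl_coeff_frac_deriv assms)
  then show ?thesis by (simp add: sobolev_norm_def parseval[of "frac_deriv s f"])
qed

lemma sobolev_add:
  assumes f: "f \<in> sobolev s" and g: "g \<in> sobolev s"
  shows "f + g \<in> sobolev s" "sobolev_norm s (f + g) \<le> sobolev_norm s f + sobolev_norm s g"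
proof -
  have sum_ps: "power_spectrum l (f + g) \<le> 2 * power_spectrum l f + 2 * power_spectrum l g" for l
    unfolding power_spectrum_def sum_distrib_left sum.distrib[symmetric]
  proof (rule sum_mono)
    fix m
    have "(cmod (a + b))\<^sup>2 \<le> 2 * (cmod a)\<^sup>2 + 2 * (cmod b)\<^sup>2" for a b
    proof -
      have "(cmod (a + b))\<^sup>2 \<le> (cmod a + cmod b)\<^sup>2" by (intro power_mono norm_triangle_ineq) simp
      also have "\<dots> \<le> 2 * (cmod a)\<^sup>2 + 2 * (cmod b)\<^sup>2"
        using sum_squares_bound[of "cmod a" "cmod b"] by (simp add: power2_sum)
      finally show ?thesis .
    qed
    then show "(cmod (fl_coeff (f + g) l m))\<^sup>2 \<le> 2 * (cmod (fl_coeff f l m))\<^sup>2 + 2 * (cmod (fl_coeff g l m))\<^sup>2"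
      by (simp add: fl_coeff_add)
  qed
  have "summable (\<lambda>l. 2 * (real l powr (2 * s) * power_spectrum l f) + 2 * (real l powr (2 * s) * power_spectrum l g))"
    by (intro summable_add summable_mult sobolev_summable f g)
  then show fg: "f + g \<in> sobolev s"
    unfolding sobolev_def mem_Collect_eq
  proof (rule summable_comparison_test'[where N=0])
    fix l
    show "norm (real l powr (2 * s) * power_spectrum l (f + g)) \<le> 2 * (real l powr (2 * s) * power_spectrum l f) + 2 * (real l powr (2 * s) * power_spectrum l g)"
      using mult_left_mono[OF sum_ps[of l], of "real l powr (2 * s)"] by (simp add: algebra_simps)
  qed
  have "frac_deriv s (f + g) = frac_deriv s f + frac_deriv s g"
    by (rule l2_sphere_eqI) (simp add: fl_coeff_frac_deriv fl_coeff_add f g fg algebra_simps)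
  then show "sobolev_norm s (f + g) \<le> sobolev_norm s f + sobolev_norm s g"
    using norm_triangle_ineq[of f g] norm_triangle_ineq[of "frac_deriv s f" "frac_deriv s g"]
    by (simp add: sobolev_norm_frac_deriv f g fg)
qed

lemma sobolev_zero: "0 \<in> sobolev s" "sobolev_norm s 0 = 0"
  by (simp_all add: sobolev_def sobolev_norm_def power_spectrum_def)

lemma sobolev_scaleC:
  assumes "f \<in> sobolev s"
  shows "c *\<^sub>C f \<in> sobolev s" "sobolev_norm s (c *\<^sub>C f) \<le> cmod c * sobolev_norm s f"
  using sobolev_dominated[OF assms, of "c *\<^sub>C f" "cmod c"] by (simp_all add: fl_coeff_scaleC norm_mult)

lemma sobolev_scaleR: "f \<in> sobolev s \<Longrightarrow> r *\<^sub>R f \<in> sobolev s"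
  using sobolev_scaleC(1)[of f s "of_real r"] by (simp add: scaleC_l2_scaleR)

lemma sobolev_diff:
  assumes "f \<in> sobolev s" "g \<in> sobolev s"
  shows "f - g \<in> sobolev s"
  using sobolev_add(1)[OF assms(1) sobolev_scaleR[OF assms(2), of "-1"]] by simp

lemma sobolev_sum:
  "(\<And>i. i \<in> A \<Longrightarrow> h i \<in> sobolev s) \<Longrightarrow> (\<Sum>i\<in>A. h i) \<in> sobolev s \<and> sobolev_norm s (\<Sum>i\<in>A. h i) \<le> (\<Sum>i\<in>A. sobolev_norm s (h i))"
proof (induction A rule: infinite_finite_induct)
  case (insert x A)
  then have "h x \<in> sobolev s" "sum h A \<in> sobolev s" "sobolev_norm s (sum h A) \<le> (\<Sum>i\<in>A. sobolev_norm s (h i))" by auto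
  then show ?case using sobolev_add[of "h x" s "sum h A"] insert.hyps by auto
qed (simp_all add: sobolev_zero)

lemma sobolev_sph_harm:
  assumes "\<bar>m\<bar> \<le> int l"
  shows "sph_harm l m \<in> sobolev s"
proof -
  have "power_spectrum k (sph_harm l m) = 0" if "k \<notin> {l}" for k
    using that assms unfolding power_spectrum_def by (intro sum.neutral) (auto simp: fl_coeff_sph_harm abs_le_iff)
  then show ?thesis unfolding sobolev_def mem_Collect_eq by (intro summable_finite[of "{l}"]) auto
qed

lemma sobolev_harm_sum: "harm_sum c A \<in> sobolev s"
  unfolding harm_sum_def
  by (intro sobolev_sum[THEN conjunct1] sobolev_scaleC(1) sobolev_sph_harm) auto

lemma sobolev_norm_nonneg: "f \<in> sobolev s \<Longrightarrow> 0 \<le> sobolev_norm s f"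
  by (simp add: sobolev_norm_frac_deriv)

lemma norm_le_sobolev_norm: "f \<in> sobolev s \<Longrightarrow> norm f \<le> sobolev_norm s f"
  by (simp add: sobolev_norm_frac_deriv)

lemma sobolev_mono:
  assumes "f \<in> sobolev t" "s \<le> t"
  shows "f \<in> sobolev s"
  unfolding sobolev_def mem_Collect_eq
proof (rule summable_comparison_test'[OF sobolev_summable[OF assms(1)], of 1])
  fix l :: nat assume "1 \<le> l"
  then show "norm (real l powr (2 * s) * power_spectrum l f) \<le> real l powr (2 * t) * power_spectrum l f"
    using assms(2) by (simp add: mult_right_mono powr_mono)
qed

abbreviation H_tendsto :: "real \<Rightarrow> ('a \<Rightarrow> l2_sphere) \<Rightarrow> l2_sphere \<Rightarrow> 'a filter \<Rightarrow> bool" where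
  "H_tendsto s \<equiv> tendsto_in (sobolev s) (sobolev_norm s)"

abbreviation H_continuous_on :: "real \<Rightarrow> real set \<Rightarrow> (real \<Rightarrow> l2_sphere) \<Rightarrow> bool" where
  "H_continuous_on s \<equiv> continuous_on_in (sobolev s) (sobolev_norm s)"

lemma tendsto_in_fl_coeff:
  assumes t: "H_tendsto s g x F" and m: "\<bar>m\<bar> \<le> int l"
  shows "((\<lambda>a. fl_coeff (g a) l m) \<longlongrightarrow> fl_coeff x l m) F"
proof (rule LIM_zero_cancel)
  have x: "x \<in> sobolev s" "\<forall>\<^sub>F a in F. g a \<in> sobolev s" "((\<lambda>a. sobolev_norm s (g a - x)) \<longlongrightarrow> 0) F"
    using t by (auto simp: tendsto_in_def)
  show "((\<lambda>a. fl_coeff (g a) l m - fl_coeff x l m) \<longlongrightarrow> 0) F"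
  proof (rule Lim_null_comparison[OF _ x(3)], use x(2) in eventually_elim)
    case (elim a)
    have "cmod (fl_coeff (g a - x) l m) \<le> sobolev_norm s (g a - x)"
      by (rule order_trans[OF norm_fl_coeff_le[OF m] norm_le_sobolev_norm[OF sobolev_diff[OF elim x(1)]]])
    then show ?case by (simp add: fl_coeff_diff)
  qed
qed

lemma tendsto_in_unique:
  assumes "H_tendsto s g x F" "H_tendsto s g y F" "F \<noteq> bot"
  shows "x = y"
proof (rule l2_sphere_eqI)
  fix l m assume m: "\<bar>m\<bar> \<le> int l"
  show "fl_coeff x l m = fl_coeff y l m"
    by (rule tendsto_unique[OF assms(3) tendsto_in_fl_coeff[OF assms(1) m] tendsto_in_fl_coeff[OF assms(2) m]])
qed

lemma tannery_real:
  fixes a :: "nat \<Rightarrow> 'a \<Rightarrow> real"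
  assumes lim: "\<And>l. ((\<lambda>n. a l n) \<longlongrightarrow> 0) F" and bound: "\<forall>\<^sub>F n in F. \<forall>l. \<bar>a l n\<bar> \<le> B l" and B: "summable B"
  shows "((\<lambda>n. \<Sum>l. a l n) \<longlongrightarrow> 0) F"
proof (cases "F = bot")
  case False
  have "\<forall>\<^sub>F x in sequentially \<times>\<^sub>F F. \<forall>l. \<bar>a l (snd x)\<bar> \<le> B l"
    using eventually_prodI[OF always_eventually bound, of "\<lambda>_. True" sequentially] by simp
  then have "\<forall>\<^sub>F (l, n) in sequentially \<times>\<^sub>F F. norm (a l n) \<le> B l"
    by (rule eventually_mono) auto
  from tannerys_theorem[OF lim this B False] show ?thesis by simp
qed simp

text \<open>Dominated convergence for the two series in the Sobolev norm; the coefficients of \<open>C f\<close> provide the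
  summable bound.\<close>

theorem sobolev_tendstoI:
  assumes f: "f \<in> sobolev s" and x: "x \<in> sobolev s" and g: "\<forall>\<^sub>F a in F. g a \<in> sobolev s"
    and dom: "\<forall>\<^sub>F a in F. \<forall>l m. \<bar>m\<bar> \<le> int l \<longrightarrow> cmod (fl_coeff (g a) l m - fl_coeff x l m) \<le> C * cmod (fl_coeff f l m)"
    and lim: "\<And>l m. \<bar>m\<bar> \<le> int l \<Longrightarrow> ((\<lambda>a. fl_coeff (g a) l m) \<longlongrightarrow> fl_coeff x l m) F"
  shows "H_tendsto s g x F"
proof -
  have p: "\<forall>\<^sub>F a in F. \<forall>l. power_spectrum l (g a - x) \<le> C\<^sup>2 * power_spectrum l f"
    using dom by eventually_elim (auto simp: power_spectrum_spec fl_coeff_diff intro!: spec_mono)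
  have pl: "((\<lambda>a. power_spectrum l (g a - x)) \<longlongrightarrow> 0) F" for l
  proof -
    have "((\<lambda>a. power_spectrum l (g a - x)) \<longlongrightarrow> (\<Sum>m\<in>{- int l..int l}. (cmod (fl_coeff x l m - fl_coeff x l m))\<^sup>2)) F"
      unfolding power_spectrum_def fl_coeff_diff by (intro tendsto_intros lim) auto
    then show ?thesis by simp
  qed
  have "((\<lambda>a. \<Sum>l. power_spectrum l (g a - x)) \<longlongrightarrow> 0) F"
    by (rule tannery_real[OF pl _ summable_mult[OF summable_power_spectrum[of f], of "C\<^sup>2"]])
      (use p in \<open>simp\<close>)
  moreover have "((\<lambda>a. \<Sum>l. real l powr (2 * s) * power_spectrum l (g a - x)) \<longlongrightarrow> 0) F"
  proof (rule tannery_real[OF _ _ summable_mult[OF sobolev_summable[OF f], of "C\<^sup>2"]])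
    show "((\<lambda>a. real l powr (2 * s) * power_spectrum l (g a - x)) \<longlongrightarrow> 0) F" for l
      using tendsto_mult[OF tendsto_const pl, of "real l powr (2 * s)"] by simp
    show "\<forall>\<^sub>F a in F. \<forall>l. \<bar>real l powr (2 * s) * power_spectrum l (g a - x)\<bar> \<le> C\<^sup>2 * (real l powr (2 * s) * power_spectrum l f)"
      using p
    proof eventually_elim
      case (elim a)
      show ?case
      proof
        fix l
        show "\<bar>real l powr (2 * s) * power_spectrum l (g a - x)\<bar> \<le> C\<^sup>2 * (real l powr (2 * s) * power_spectrum l f)"
          using mult_left_mono[OF elim[rule_format, of l], of "real l powr (2 * s)"] by (simp add: ac_simps)
      qed
    qed
  qed
  ultimately have "((\<lambda>a. sqrt (\<Sum>l. power_spectrum l (g a - x)) + sqrt (\<Sum>l. real l powr (2 * s) * power_spectrum l (g a - x))) \<longlongrightarrow> sqrt 0 + sqrt 0) F"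
    by (intro tendsto_add tendsto_real_sqrt)
  then have "((\<lambda>a. sobolev_norm s (g a - x)) \<longlongrightarrow> 0) F"
    by (simp add: sobolev_norm_def parseval)
  with x g show ?thesis by (simp add: tendsto_in_def)
qed

text \<open>Domination is required only near each point, with a constant that may depend on it: the solution is
  bounded in the stronger norm only away from time \<open>0\<close>.\<close>

lemma sobolev_continuousI:
  assumes g: "g \<in> sobolev s"
    and dom: "\<And>t. t \<in> A \<Longrightarrow> \<exists>C\<ge>0. \<forall>\<^sub>F r in nhds t. r \<in> A \<longrightarrow>
      (\<forall>l m. \<bar>m\<bar> \<le> int l \<longrightarrow> cmod (fl_coeff (v r) l m) \<le> C * cmod (fl_coeff g l m))"
    and cont: "\<And>l m. \<bar>m\<bar> \<le> int l \<Longrightarrow> continuous_on A (\<lambda>t. fl_coeff (v t) l m)"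
  shows "H_continuous_on s A v"
proof -
  have "v t \<in> sobolev s \<and> H_tendsto s v (v t) (at t within A)" if t: "t \<in> A" for t
  proof -
    obtain C where C: "0 \<le> C" and ev: "\<forall>\<^sub>F r in nhds t. r \<in> A \<longrightarrow>
        (\<forall>l m. \<bar>m\<bar> \<le> int l \<longrightarrow> cmod (fl_coeff (v r) l m) \<le> C * cmod (fl_coeff g l m))"
      using dom[OF t] by blast
    note at_t = eventually_nhds_x_imp_x[OF ev, rule_format, OF t]
    have near: "\<forall>\<^sub>F r in at t within A. \<forall>l m. \<bar>m\<bar> \<le> int l \<longrightarrow> cmod (fl_coeff (v r) l m) \<le> C * cmod (fl_coeff g l m)"
      unfolding eventually_at_filter using ev by eventually_elim auto
    have vt: "v t \<in> sobolev s" by (rule sobolev_dominated(1)[OF g at_t C])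
    have "H_tendsto s v (v t) (at t within A)"
    proof (rule sobolev_tendstoI[OF g vt, where C="2 * C"])
      show "\<forall>\<^sub>F r in at t within A. v r \<in> sobolev s"
        using near by eventually_elim (use C in \<open>blast intro: sobolev_dominated(1)[OF g]\<close>)
      show "\<forall>\<^sub>F r in at t within A. \<forall>l m. \<bar>m\<bar> \<le> int l \<longrightarrow>
          cmod (fl_coeff (v r) l m - fl_coeff (v t) l m) \<le> 2 * C * cmod (fl_coeff g l m)"
        using near
      proof eventually_elim
        case (elim r)
        show ?case
        proof (intro allI impI)
          fix l m assume m: "\<bar>m\<bar> \<le> int l"
          show "cmod (fl_coeff (v r) l m - fl_coeff (v t) l m) \<le> 2 * C * cmod (fl_coeff g l m)"
            using norm_triangle_ineq4[of "fl_coeff (v r) l m" "fl_coeff (v t) l m"] elim[rule_format, OF m] at_t[OF m]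
            by linarith
        qed
      qed
    qed (use cont t in \<open>simp add: continuous_on_def\<close>)
    with vt show ?thesis ..
  qed
  then show ?thesis by (simp add: continuous_on_in_def)
qed

lemma continuous_on_in_cong:
  assumes "continuous_on_in V N A v" and eq: "\<And>t. t \<in> A \<Longrightarrow> v t = w t"
  shows "continuous_on_in V N A w"
  unfolding continuous_on_in_def tendsto_in_def
proof (intro conjI ballI)
  fix t assume t: "t \<in> A"
  have v: "v t \<in> V" "\<forall>\<^sub>F r in at t within A. v r \<in> V" "((\<lambda>r. N (v r - v t)) \<longlongrightarrow> 0) (at t within A)"
    using assms(1) t by (auto simp: continuous_on_in_def tendsto_in_def)
  have ev: "\<forall>\<^sub>F r in at t within A. v r = w r" by (simp add: eventually_at_filter eq)
  show "w t \<in> V" "w t \<in> V" using v(1) eq[OF t] by simp_all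
  show "\<forall>\<^sub>F r in at t within A. w r \<in> V" using v(2) ev by eventually_elim simp
  show "((\<lambda>r. N (w r - w t)) \<longlongrightarrow> 0) (at t within A)"
    by (rule Lim_transform_eventually[OF v(3)]) (use ev in \<open>eventually_elim, simp add: eq[OF t]\<close>)
qed

lemma H_continuous_on_at_right:
  assumes "H_continuous_on s {0..} v"
  shows "H_tendsto s v (v 0) (at_right 0)"
proof -
  have "H_tendsto s v (v 0) (at 0 within {0..})"
    using assms by (simp add: continuous_on_in_def)
  moreover have "at_right 0 \<le> (at 0 within {0..} :: real filter)" by (rule at_le) auto
  ultimately show ?thesis unfolding tendsto_in_def by (meson filter_leD tendsto_mono)
qed

section \<open>Bochner integrals in Sobolev spaces\<close>

abbreviation simple_bochner_integrable where
  "simple_bochner_integrable \<equiv> Bochner_Integration.simple_bochner_integrable"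

abbreviation simple_bochner_integral where
  "simple_bochner_integral \<equiv> Bochner_Integration.simple_bochner_integral"

lemma simple_bochner_integrable_scaleC_sph_harm:
  assumes "simple_bochner_integrable M \<sigma>"
  shows "simple_bochner_integrable M (\<lambda>y. \<sigma> y *\<^sub>C h)"
    "simple_bochner_integral M (\<lambda>y. \<sigma> y *\<^sub>C h) = simple_bochner_integral M \<sigma> *\<^sub>C h"
proof -
  have z: "0 *\<^sub>C h = 0" using scaleC_l2_add_left[of 0 0 h] by simp
  show "simple_bochner_integrable M (\<lambda>y. \<sigma> y *\<^sub>C h)"
    using simple_bochner_integrable_compose2[OF _ assms assms, of "\<lambda>a b. a *\<^sub>C h"] z by simp
  have "linear (\<lambda>c. c *\<^sub>C h)"
    by (rule linearI) (simp_all add: scaleC_l2_add_left scaleR_conv_of_real scaleC_l2_scaleR[symmetric] scaleC_l2_scaleC)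
  from simple_bochner_integral_linear[OF this assms]
  show "simple_bochner_integral M (\<lambda>y. \<sigma> y *\<^sub>C h) = simple_bochner_integral M \<sigma> *\<^sub>C h" .
qed

lemma simple_bochner_integral_sum:
  assumes "finite A" "\<And>i. i \<in> A \<Longrightarrow> simple_bochner_integrable M (h i)"
  shows "simple_bochner_integrable M (\<lambda>y. \<Sum>i\<in>A. h i y)
    \<and> simple_bochner_integral M (\<lambda>y. \<Sum>i\<in>A. h i y) = (\<Sum>i\<in>A. simple_bochner_integral M (h i))"
  using assms
proof (induction A rule: finite_induct)
  case empty
  show ?case
    by (auto simp: simple_bochner_integrable.simps simple_bochner_integral_def intro: sum.neutral)
next
  case (insert x A)
  then have "simple_bochner_integrable M (h x)" "simple_bochner_integrable M (\<lambda>y. \<Sum>i\<in>A. h i y)"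
      "simple_bochner_integral M (\<lambda>y. \<Sum>i\<in>A. h i y) = (\<Sum>i\<in>A. simple_bochner_integral M (h i))" by auto
  then show ?case
    using insert.hyps simple_bochner_integrable_compose2[of "(+)" M "h x" "\<lambda>y. \<Sum>i\<in>A. h i y"]
      simple_bochner_integral_add[of M "h x" "\<lambda>y. \<Sum>i\<in>A. h i y"] by simp
qed

text \<open>The coefficient functionals are bounded by the Sobolev norm and commute with integrals of simple
  functions, so they commute with Bochner integrals.\<close>

lemma has_bochner_integral_in_fl_coeff:
  assumes I: "has_bochner_integral_in (sobolev s) (sobolev_norm s) M F x" and m: "\<bar>m\<bar> \<le> int l"
    and meas: "(\<lambda>y. fl_coeff (F y) l m) \<in> borel_measurable M"
  shows "has_bochner_integral M (\<lambda>y. fl_coeff (F y) l m) (fl_coeff x l m)"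
proof -
  obtain \<sigma> where F: "F ` space M \<subseteq> sobolev s"
      and s: "\<And>i. simple_bochner_integrable M (\<sigma> i)" "\<And>i. \<sigma> i ` space M \<subseteq> sobolev s"
      and lim: "(\<lambda>i. \<integral>\<^sup>+y. ennreal (sobolev_norm s (F y - \<sigma> i y)) \<partial>M) \<longlonglongrightarrow> 0"
      and t: "H_tendsto s (\<lambda>i. simple_bochner_integral M (\<sigma> i)) x sequentially"
    using I unfolding has_bochner_integral_in_def by blast
  show ?thesis
  proof (rule has_bochner_integral.intros[OF meas])
    show "simple_bochner_integrable M (\<lambda>y. fl_coeff (\<sigma> i y) l m)" for i
      using simple_bochner_integrable_compose2[OF _ s(1) s(1), of "\<lambda>a b. fl_coeff a l m"] by simp
    have "simple_bochner_integral M (\<lambda>y. fl_coeff (\<sigma> i y) l m) = fl_coeff (simple_bochner_integral M (\<sigma> i)) l m" for i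
      by (rule simple_bochner_integral_linear[OF bounded_linear.linear[OF bounded_linear_fl_coeff[OF m]] s(1)])
    then show "(\<lambda>i. simple_bochner_integral M (\<lambda>y. fl_coeff (\<sigma> i y) l m)) \<longlonglongrightarrow> fl_coeff x l m"
      using tendsto_in_fl_coeff[OF t m] by simp
    show "(\<lambda>i. \<integral>\<^sup>+y. ennreal (norm (fl_coeff (F y) l m - fl_coeff (\<sigma> i y) l m)) \<partial>M) \<longlonglongrightarrow> 0"
    proof (rule tendsto_sandwich[OF _ _ tendsto_const lim])
      show "\<forall>\<^sub>F i in sequentially. (\<integral>\<^sup>+y. ennreal (norm (fl_coeff (F y) l m - fl_coeff (\<sigma> i y) l m)) \<partial>M) \<le> (\<integral>\<^sup>+y. ennreal (sobolev_norm s (F y - \<sigma> i y)) \<partial>M)"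
      proof (intro always_eventually allI nn_integral_mono ennreal_leI)
        fix i y assume "y \<in> space M"
        then have "F y - \<sigma> i y \<in> sobolev s" using F s(2) by (intro sobolev_diff) auto
        then show "norm (fl_coeff (F y) l m - fl_coeff (\<sigma> i y) l m) \<le> sobolev_norm s (F y - \<sigma> i y)"
          using norm_fl_coeff_le[OF m, of "F y - \<sigma> i y"] norm_le_sobolev_norm by (fastforce simp: fl_coeff_diff)
      qed
    qed simp
  qed
qed

lemma harm_sum_tendsto:
  assumes "f \<in> sobolev s"
  shows "H_tendsto s (\<lambda>n. harm_sum (fl_coeff f) {..<n}) f sequentially"
proof (rule sobolev_tendstoI[where f=f and C=1])
  show "((\<lambda>n. fl_coeff (harm_sum (fl_coeff f) {..<n}) l m) \<longlongrightarrow> fl_coeff f l m) sequentially" if "\<bar>m\<bar> \<le> int l" for l m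
  proof (rule tendsto_eventually)
    show "\<forall>\<^sub>F n in sequentially. fl_coeff (harm_sum (fl_coeff f) {..<n}) l m = fl_coeff f l m"
      using eventually_gt_at_top[of l] by eventually_elim (simp add: fl_coeff_harm_sum that)
  qed
qed (auto simp: assms sobolev_harm_sum fl_coeff_harm_sum)

text \<open>The approximating simple functions keep the degrees below \<open>n\<close> only, and replace each of the finitely
  many remaining coefficients by a scalar simple function. The truncation error at \<open>y\<close> is dominated by \<open>k y\<close>
  times the error \<open>r n\<close> of truncating \<open>f\<close>, which tends to \<open>0\<close>. The scalar errors are at most \<open>\<epsilon> n\<close>, which is
  so small that, weighted by the norms of the harmonics, they add up to at most \<open>1 / (n + 1)\<close>.\<close>

theorem has_bochner_integral_in_sobolevI:
  assumes f: "f \<in> sobolev s"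
    and F: "\<And>y. y \<in> space M \<Longrightarrow> F y \<in> sobolev s"
    and k: "integrable M k" "\<And>y. y \<in> space M \<Longrightarrow> 0 \<le> k y"
    and dom: "\<And>y l m. y \<in> space M \<Longrightarrow> \<bar>m\<bar> \<le> int l \<Longrightarrow> cmod (fl_coeff (F y) l m) \<le> k y * cmod (fl_coeff f l m)"
    and int: "\<And>l m. \<bar>m\<bar> \<le> int l \<Longrightarrow> has_bochner_integral M (\<lambda>y. fl_coeff (F y) l m) (fl_coeff x l m)"
    and x: "x \<in> sobolev s"
  shows "has_bochner_integral_in (sobolev s) (sobolev_norm s) M F x"
proof -
  define N where "N = sobolev_norm s"
  define I where "I n = Sigma {..<n} (\<lambda>l. {- int l..int l})" for n :: nat
  define W where "W n = (\<Sum>(l, m)\<in>I n. N (sph_harm l m))" for n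
  define \<epsilon> where "\<epsilon> n = 1 / (real (Suc n) * (1 + W n))" for n
  have finI: "finite (I n)" for n by (simp add: I_def)
  have mI: "\<bar>m\<bar> \<le> int l" if "(l, m) \<in> I n" for l m n using that by (auto simp: I_def)
  have NY: "0 \<le> N (sph_harm l m)" if "\<bar>m\<bar> \<le> int l" for l m
    unfolding N_def by (intro sobolev_norm_nonneg sobolev_sph_harm that)
  have W0: "0 \<le> W n" for n
    unfolding W_def by (intro sum_nonneg) (auto intro!: NY mI)
  have \<epsilon>0: "0 < \<epsilon> n" for n
    unfolding \<epsilon>_def using W0[of n] by (intro divide_pos_pos mult_pos_pos) auto
  have \<epsilon>W: "\<epsilon> n * W n \<le> 1 / real (Suc n)" for n
    using W0[of n] by (simp add: \<epsilon>_def divide_simps)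
  \<comment> \<open>Each Fourier coefficient is approximated by scalar simple functions.\<close>
  define Q where "Q n l m \<sigma> \<longleftrightarrow> simple_bochner_integrable M \<sigma>
      \<and> (\<integral>\<^sup>+y. ennreal (norm (fl_coeff (F y) l m - \<sigma> y)) \<partial>M) \<le> ennreal (\<epsilon> n)
      \<and> norm (simple_bochner_integral M \<sigma> - fl_coeff x l m) \<le> \<epsilon> n" for n l m \<sigma>
  have Q_ex: "\<exists>\<sigma>. Q n l m \<sigma>" if lm: "\<bar>m\<bar> \<le> int l" for l m n
  proof -
    obtain t where t: "\<And>i. simple_bochner_integrable M (t i)"
        "(\<lambda>i. \<integral>\<^sup>+y. ennreal (norm (fl_coeff (F y) l m - t i y)) \<partial>M) \<longlonglongrightarrow> 0"
        "(\<lambda>i. simple_bochner_integral M (t i)) \<longlonglongrightarrow> fl_coeff x l m"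
      using int[OF lm] by (auto elim!: has_bochner_integral.cases)
    have "\<forall>\<^sub>F i in sequentially. (\<integral>\<^sup>+y. ennreal (norm (fl_coeff (F y) l m - t i y)) \<partial>M) < ennreal (\<epsilon> n)"
      using \<epsilon>0[of n] by (intro order_tendstoD(2)[OF t(2)]) simp
    moreover have "\<forall>\<^sub>F i in sequentially. dist (simple_bochner_integral M (t i)) (fl_coeff x l m) < \<epsilon> n"
      by (rule tendstoD[OF t(3) \<epsilon>0])
    ultimately have "\<forall>\<^sub>F i in sequentially. (\<integral>\<^sup>+y. ennreal (norm (fl_coeff (F y) l m - t i y)) \<partial>M) < ennreal (\<epsilon> n)
        \<and> dist (simple_bochner_integral M (t i)) (fl_coeff x l m) < \<epsilon> n"
      by (rule eventually_conj)
    then obtain i where "(\<integral>\<^sup>+y. ennreal (norm (fl_coeff (F y) l m - t i y)) \<partial>M) < ennreal (\<epsilon> n)"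
        "dist (simple_bochner_integral M (t i)) (fl_coeff x l m) < \<epsilon> n"
      using eventually_happens'[OF sequentially_bot] by blast
    then show ?thesis using t(1)[of i] by (intro exI[of _ "t i"]) (auto simp: Q_def dist_norm)
  qed
  define \<sigma> where "\<sigma> n l m = (SOME \<sigma>. Q n l m \<sigma>)" for n l m
  have Q: "Q n l m (\<sigma> n l m)" if "\<bar>m\<bar> \<le> int l" for n l m
    unfolding \<sigma>_def by (rule someI_ex[OF Q_ex[OF that]])
  have \<sigma>: "\<And>n l m. \<bar>m\<bar> \<le> int l \<Longrightarrow> simple_bochner_integrable M (\<sigma> n l m)"
      "\<And>n l m. \<bar>m\<bar> \<le> int l \<Longrightarrow> (\<integral>\<^sup>+y. ennreal (norm (fl_coeff (F y) l m - \<sigma> n l m y)) \<partial>M) \<le> ennreal (\<epsilon> n)"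
      "\<And>n l m. \<bar>m\<bar> \<le> int l \<Longrightarrow> norm (simple_bochner_integral M (\<sigma> n l m) - fl_coeff x l m) \<le> \<epsilon> n"
    using Q unfolding Q_def by blast+
  define t where "t n y = harm_sum (\<lambda>l m. \<sigma> n l m y) {..<n}" for n y
  have hs: "harm_sum c {..<n} = (\<Sum>(l, m)\<in>I n. c l m *\<^sub>C sph_harm l m)" for c n
    unfolding harm_sum_def I_def by (rule sum.Sigma) auto
  have t_int: "simple_bochner_integrable M (t n)
      \<and> simple_bochner_integral M (t n) = harm_sum (\<lambda>l m. simple_bochner_integral M (\<sigma> n l m)) {..<n}" for n
  proof -
    have "t n = (\<lambda>y. \<Sum>p\<in>I n. (case p of (l, m) \<Rightarrow> \<lambda>y. \<sigma> n l m y *\<^sub>C sph_harm l m) y)"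
      unfolding t_def hs by (auto intro!: ext sum.cong)
    moreover have "simple_bochner_integrable M (case p of (l, m) \<Rightarrow> \<lambda>y. \<sigma> n l m y *\<^sub>C sph_harm l m)" if "p \<in> I n" for p
      using that by (cases p) (auto intro!: simple_bochner_integrable_scaleC_sph_harm \<sigma> mI)
    moreover have "simple_bochner_integral M (case p of (l, m) \<Rightarrow> \<lambda>y. \<sigma> n l m y *\<^sub>C sph_harm l m)
        = (case p of (l, m) \<Rightarrow> simple_bochner_integral M (\<sigma> n l m) *\<^sub>C sph_harm l m)" if "p \<in> I n" for p
      using that by (cases p) (auto intro!: simple_bochner_integrable_scaleC_sph_harm(2) \<sigma> mI)
    ultimately show ?thesis
      using simple_bochner_integral_sum[OF finI[of n], of M "\<lambda>p. case p of (l, m) \<Rightarrow> \<lambda>y. \<sigma> n l m y *\<^sub>C sph_harm l m"]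
      by (simp add: hs cong: sum.cong)
  qed
  have N_hs: "N (harm_sum c {..<n}) \<le> (\<Sum>(l, m)\<in>I n. cmod (c l m) * N (sph_harm l m))" for c n
  proof -
    have "N (\<Sum>p\<in>I n. case p of (l, m) \<Rightarrow> c l m *\<^sub>C sph_harm l m) \<le> (\<Sum>p\<in>I n. N (case p of (l, m) \<Rightarrow> c l m *\<^sub>C sph_harm l m))"
      unfolding N_def by (intro sobolev_sum[THEN conjunct2]) (auto intro!: sobolev_scaleC sobolev_sph_harm mI)
    also have "\<dots> \<le> (\<Sum>(l, m)\<in>I n. cmod (c l m) * N (sph_harm l m))"
      unfolding N_def by (intro sum_mono) (auto intro!: sobolev_scaleC(2) sobolev_sph_harm mI)
    finally show ?thesis unfolding hs .
  qed
  have hs_diff: "harm_sum c A - harm_sum d A = harm_sum (\<lambda>l m. c l m - d l m) A" if "finite A" for c d A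
    by (rule l2_sphere_eqI) (simp add: fl_coeff_diff fl_coeff_harm_sum that)
  define P where "P n g = harm_sum (fl_coeff g) {..<n}" for n g
  define r where "r n = N (f - P n f)" for n
  have r: "r \<longlonglongrightarrow> 0"
  proof -
    have "(\<lambda>n. N (P n f - f)) \<longlonglongrightarrow> 0"
      using harm_sum_tendsto[OF f] by (simp add: tendsto_in_def N_def P_def)
    moreover have "N (P n f - f) = r n" for n
    proof -
      have "N (g - h) = N (h - g)" for g h
        unfolding N_def sobolev_norm_def power_spectrum_def fl_coeff_diff by (simp add: norm_minus_commute)
      then show ?thesis by (simp add: r_def)
    qed
    ultimately show ?thesis by simp
  qed
  have Pdom: "g - P n g \<in> sobolev s \<and> N (g - P n g) \<le> C * r n"
    if dom_g: "\<And>l m. \<bar>m\<bar> \<le> int l \<Longrightarrow> cmod (fl_coeff g l m) \<le> C * cmod (fl_coeff f l m)" and C0: "0 \<le> C" for g C n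
  proof -
    have 1: "f - P n f \<in> sobolev s" unfolding P_def by (intro sobolev_diff f sobolev_harm_sum)
    have 2: "cmod (fl_coeff (g - P n g) l m) \<le> C * cmod (fl_coeff (f - P n f) l m)" if "\<bar>m\<bar> \<le> int l" for l m
      using dom_g[OF that] by (cases "l < n") (simp_all add: P_def fl_coeff_diff fl_coeff_harm_sum that)
    show ?thesis
      unfolding r_def N_def using sobolev_dominated[OF 1 2 C0] by blast
  qed
  have F_t: "N (F y - t n y) \<le> k y * r n + (\<Sum>(l, m)\<in>I n. cmod (fl_coeff (F y) l m - \<sigma> n l m y) * N (sph_harm l m))"
    if y: "y \<in> space M" for y n
  proof -
    have 1: "F y - P n (F y) \<in> sobolev s" "N (F y - P n (F y)) \<le> k y * r n"
      using Pdom[of "F y" "k y" n, OF dom[OF y] k(2)[OF y]] by blast+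
    have 2: "P n (F y) - t n y = harm_sum (\<lambda>l m. fl_coeff (F y) l m - \<sigma> n l m y) {..<n}"
      unfolding P_def t_def by (rule hs_diff) simp
    have "N (F y - t n y) = N ((F y - P n (F y)) + (P n (F y) - t n y))" by simp
    also have "\<dots> \<le> N (F y - P n (F y)) + N (P n (F y) - t n y)"
      unfolding N_def 2 by (rule sobolev_add(2)[OF 1(1) sobolev_harm_sum])
    also have "\<dots> \<le> k y * r n + (\<Sum>(l, m)\<in>I n. cmod (fl_coeff (F y) l m - \<sigma> n l m y) * N (sph_harm l m))"
      unfolding 2 by (intro add_mono 1 N_hs)
    finally show ?thesis .
  qed
  have meas [measurable]: "(\<lambda>y. fl_coeff (F y) l m) \<in> borel_measurable M" if "\<bar>m\<bar> \<le> int l" for l m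
    using int[OF that] by (auto elim!: has_bochner_integral.cases)
  have \<sigma>_meas: "\<sigma> n l m \<in> borel_measurable M" if "\<bar>m\<bar> \<le> int l" for n l m
    using \<sigma>(1)[OF that] by (auto elim!: simple_bochner_integrable.cases intro: borel_measurable_simple_function)
  have r0: "0 \<le> r n" for n
    unfolding r_def N_def P_def by (intro sobolev_norm_nonneg sobolev_diff f sobolev_harm_sum)
  have N_meas: "(\<lambda>y. N (F y - t n y)) \<in> borel_measurable M" for n
  proof -
    have ps: "(\<lambda>y. power_spectrum l (F y - t n y)) \<in> borel_measurable M" for l
    proof -
      have "(\<lambda>y. cmod (fl_coeff (F y) l m - fl_coeff (t n y) l m)) \<in> borel_measurable M" if "m \<in> {- int l..int l}" for m
      proof -
        have m: "\<bar>m\<bar> \<le> int l" using that by auto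
        show ?thesis
          using meas[OF m] \<sigma>_meas[OF m, of n] by (cases "l < n") (simp_all add: t_def fl_coeff_harm_sum m)
      qed
      then show ?thesis unfolding power_spectrum_def fl_coeff_diff
        by (intro borel_measurable_sum borel_measurable_power)
    qed
    show ?thesis
      unfolding N_def sobolev_norm_def parseval using ps by measurable
  qed
  have bound: "(\<integral>\<^sup>+y. ennreal (N (F y - t n y)) \<partial>M) \<le> ennreal ((\<integral>y. k y \<partial>M) * r n + 1 / real (Suc n))" for n
  proof -
    have km: "k \<in> borel_measurable M" using k(1) by auto
    have nk: "(\<integral>\<^sup>+y. ennreal (k y) \<partial>M) = ennreal (\<integral>y. k y \<partial>M)"
      using k by (intro nn_integral_eq_integral AE_I2) auto
    have "(\<integral>\<^sup>+y. ennreal (N (F y - t n y)) \<partial>M)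
        \<le> (\<integral>\<^sup>+y. ennreal (k y) * ennreal (r n) + (\<Sum>(l, m)\<in>I n. ennreal (cmod (fl_coeff (F y) l m - \<sigma> n l m y)) * ennreal (N (sph_harm l m))) \<partial>M)"
    proof (rule nn_integral_mono)
      fix y assume y: "y \<in> space M"
      have "ennreal (N (F y - t n y)) \<le> ennreal (k y * r n + (\<Sum>(l, m)\<in>I n. cmod (fl_coeff (F y) l m - \<sigma> n l m y) * N (sph_harm l m)))"
        by (rule ennreal_leI[OF F_t[OF y]])
      also have "\<dots> = ennreal (k y * r n) + ennreal (\<Sum>(l, m)\<in>I n. cmod (fl_coeff (F y) l m - \<sigma> n l m y) * N (sph_harm l m))"
        using k(2)[OF y] r0[of n]
        by (intro ennreal_plus) (auto intro!: sum_nonneg NY mI mult_nonneg_nonneg)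
      also have "ennreal (\<Sum>(l, m)\<in>I n. cmod (fl_coeff (F y) l m - \<sigma> n l m y) * N (sph_harm l m))
          = (\<Sum>(l, m)\<in>I n. ennreal (cmod (fl_coeff (F y) l m - \<sigma> n l m y) * N (sph_harm l m)))"
        unfolding case_prod_beta' by (rule sum_ennreal[symmetric]) (auto intro!: mult_nonneg_nonneg NY mI)
      also have "ennreal (k y * r n) + (\<Sum>(l, m)\<in>I n. ennreal (cmod (fl_coeff (F y) l m - \<sigma> n l m y) * N (sph_harm l m)))
          = ennreal (k y) * ennreal (r n) + (\<Sum>(l, m)\<in>I n. ennreal (cmod (fl_coeff (F y) l m - \<sigma> n l m y)) * ennreal (N (sph_harm l m)))"
        using k(2)[OF y] r0[of n] by (auto simp: ennreal_mult NY mI intro!: sum.cong)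
      finally show "ennreal (N (F y - t n y)) \<le> ennreal (k y) * ennreal (r n) + (\<Sum>(l, m)\<in>I n. ennreal (cmod (fl_coeff (F y) l m - \<sigma> n l m y)) * ennreal (N (sph_harm l m)))" .
    qed
    also have "\<dots> = (\<integral>\<^sup>+y. ennreal (k y) \<partial>M) * ennreal (r n) + (\<Sum>(l, m)\<in>I n. (\<integral>\<^sup>+y. ennreal (cmod (fl_coeff (F y) l m - \<sigma> n l m y)) \<partial>M) * ennreal (N (sph_harm l m)))"
    proof -
      have m1: "(\<lambda>y. ennreal (cmod (fl_coeff (F y) l m - \<sigma> n l m y))) \<in> borel_measurable M" if "(l, m) \<in> I n" for l m
        using meas[OF mI[OF that]] \<sigma>_meas[OF mI[OF that], of n] by measurable
      have "(\<integral>\<^sup>+y. (\<Sum>(l, m)\<in>I n. ennreal (cmod (fl_coeff (F y) l m - \<sigma> n l m y)) * ennreal (N (sph_harm l m))) \<partial>M)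
          = (\<Sum>(l, m)\<in>I n. (\<integral>\<^sup>+y. ennreal (cmod (fl_coeff (F y) l m - \<sigma> n l m y)) \<partial>M) * ennreal (N (sph_harm l m)))"
        unfolding case_prod_beta'
        by (subst nn_integral_sum) (auto intro!: borel_measurable_times_ennreal m1 sum.cong nn_integral_multc)
      moreover have "(\<lambda>y. \<Sum>(l, m)\<in>I n. ennreal (cmod (fl_coeff (F y) l m - \<sigma> n l m y)) * ennreal (N (sph_harm l m))) \<in> borel_measurable M"
        unfolding case_prod_beta' by (intro borel_measurable_sum borel_measurable_times_ennreal m1) auto
      ultimately show ?thesis
        using km by (subst nn_integral_add) (auto simp: nn_integral_multc)
    qed
    also have "\<dots> \<le> ennreal (\<integral>y. k y \<partial>M) * ennreal (r n) + (\<Sum>(l, m)\<in>I n. ennreal (\<epsilon> n) * ennreal (N (sph_harm l m)))"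
      unfolding nk by (intro add_mono order_refl sum_mono) (auto intro!: mult_right_mono \<sigma>(2) mI)
    also have "\<dots> = ennreal ((\<integral>y. k y \<partial>M) * r n) + ennreal (\<epsilon> n * W n)"
    proof -
      have "(\<Sum>(l, m)\<in>I n. ennreal (\<epsilon> n) * ennreal (N (sph_harm l m))) = (\<Sum>p\<in>I n. ennreal (\<epsilon> n * N (sph_harm (fst p) (snd p))))"
        using \<epsilon>0[of n] by (auto intro!: sum.cong simp: ennreal_mult NY mI less_imp_le)
      also have "\<dots> = ennreal (\<Sum>p\<in>I n. \<epsilon> n * N (sph_harm (fst p) (snd p)))"
        using \<epsilon>0[of n] by (intro sum_ennreal) (auto intro!: mult_nonneg_nonneg NY mI simp: less_imp_le)
      also have "(\<Sum>p\<in>I n. \<epsilon> n * N (sph_harm (fst p) (snd p))) = \<epsilon> n * W n"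
        by (simp add: W_def sum_distrib_left case_prod_beta')
      finally show ?thesis using r0[of n] by (simp add: ennreal_mult'')
    qed
    also have "\<dots> \<le> ennreal ((\<integral>y. k y \<partial>M) * r n) + ennreal (1 / real (Suc n))"
      by (intro add_mono ennreal_leI \<epsilon>W order_refl)
    also have "\<dots> = ennreal ((\<integral>y. k y \<partial>M) * r n + 1 / real (Suc n))"
      using k(2) r0[of n] by (subst ennreal_plus) (auto intro!: mult_nonneg_nonneg integral_nonneg_AE)
    finally show ?thesis .
  qed
  have inv: "(\<lambda>n. 1 / real (Suc n)) \<longlonglongrightarrow> 0"
    using LIMSEQ_inverse_real_of_nat by (simp add: inverse_eq_divide)
  have lim1: "(\<lambda>n. \<integral>\<^sup>+y. ennreal (N (F y - t n y)) \<partial>M) \<longlonglongrightarrow> 0"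
  proof (rule tendsto_sandwich[OF _ _ tendsto_const])
    have "(\<lambda>n. ennreal ((\<integral>y. k y \<partial>M) * r n + 1 / real (Suc n))) \<longlonglongrightarrow> ennreal ((\<integral>y. k y \<partial>M) * 0 + 0)"
      by (intro tendsto_ennrealI tendsto_intros r inv)
    then show "(\<lambda>n. ennreal ((\<integral>y. k y \<partial>M) * r n + 1 / real (Suc n))) \<longlonglongrightarrow> 0" by simp
  qed (use bound in auto)
  have lim2: "H_tendsto s (\<lambda>n. simple_bochner_integral M (t n)) x sequentially"
    unfolding tendsto_in_def
  proof (intro conjI x always_eventually allI)
    show "simple_bochner_integral M (t n) \<in> sobolev s" for n
      unfolding t_int[THEN conjunct2] by (rule sobolev_harm_sum)
    have up: "N (simple_bochner_integral M (t n) - x) \<le> 1 / real (Suc n) + N (P n x - x)" for n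
    proof -
      define c where "c l m = simple_bochner_integral M (\<sigma> n l m) - fl_coeff x l m" for l m
      have eq: "simple_bochner_integral M (t n) - P n x = harm_sum c {..<n}"
        unfolding t_int[THEN conjunct2] P_def c_def by (rule hs_diff) simp
      have "N (harm_sum c {..<n}) \<le> (\<Sum>(l, m)\<in>I n. cmod (c l m) * N (sph_harm l m))" by (rule N_hs)
      also have "\<dots> \<le> (\<Sum>(l, m)\<in>I n. \<epsilon> n * N (sph_harm l m))"
        unfolding c_def by (intro sum_mono) (auto intro!: mult_right_mono \<sigma>(3) mI NY)
      also have "\<dots> = \<epsilon> n * W n" by (simp add: W_def sum_distrib_left case_prod_beta')
      finally have "N (harm_sum c {..<n}) \<le> 1 / real (Suc n)" using \<epsilon>W[of n] by linarith
      moreover have "N ((simple_bochner_integral M (t n) - P n x) + (P n x - x))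
          \<le> N (simple_bochner_integral M (t n) - P n x) + N (P n x - x)"
      proof -
        have "harm_sum c {..<n} \<in> sobolev s" by (rule sobolev_harm_sum)
        moreover have "P n x - x \<in> sobolev s" unfolding P_def by (intro sobolev_diff sobolev_harm_sum x)
        ultimately show ?thesis unfolding N_def eq[symmetric] by (rule sobolev_add(2))
      qed
      ultimately have "N ((simple_bochner_integral M (t n) - P n x) + (P n x - x)) \<le> 1 / real (Suc n) + N (P n x - x)"
        unfolding eq by linarith
      then show ?thesis by simp
    qed
    have up0: "(\<lambda>n. 1 / real (Suc n) + N (P n x - x)) \<longlonglongrightarrow> 0 + 0"
      using harm_sum_tendsto[OF x] by (intro tendsto_add inv) (simp add: tendsto_in_def N_def P_def)
    have lo: "0 \<le> N (simple_bochner_integral M (t n) - x)" for n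
      unfolding N_def t_int[THEN conjunct2] by (intro sobolev_norm_nonneg sobolev_diff sobolev_harm_sum x)
    show "(\<lambda>n. sobolev_norm s (simple_bochner_integral M (t n) - x)) \<longlonglongrightarrow> 0"
      unfolding N_def[symmetric]
      by (rule tendsto_sandwich[OF always_eventually[OF allI[OF lo]] always_eventually[OF allI[OF up]] tendsto_const])
        (use up0 in simp)
  qed
  show ?thesis
    unfolding has_bochner_integral_in_def
  proof (intro conjI exI[of _ t] allI)
    show "F ` space M \<subseteq> sobolev s" using F by auto
    show "t n ` space M \<subseteq> sobolev s" for n by (auto simp: t_def sobolev_harm_sum)
    show "simple_bochner_integrable M (t n)" for n by (rule t_int[THEN conjunct1])
    show "(\<lambda>y. sobolev_norm s (F y - t n y)) \<in> borel_measurable M" for n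
      using N_meas[of n] unfolding N_def .
    show "(\<lambda>n. \<integral>\<^sup>+y. ennreal (sobolev_norm s (F y - t n y)) \<partial>M) \<longlonglongrightarrow> 0"
      using lim1 unfolding N_def .
  qed (rule lim2)
qed

section \<open>Levy measures and their tails\<close>

lemma space_levy_measure: "levy_measure \<nu> \<Longrightarrow> space \<nu> = {0<..}"
  using sets_eq_imp_space_eq[of \<nu> "restrict_space borel {0<..}"]
  by (auto simp: levy_measure_def space_restrict_space)

lemma borel_measurable_levy_measure:
  "levy_measure \<nu> \<Longrightarrow> f \<in> borel_measurable borel \<Longrightarrow> f \<in> borel_measurable \<nu>"
  using measurable_cong_sets[of \<nu> "restrict_space borel {0<..}"]
  by (auto simp: levy_measure_def intro: measurable_restrict_space1)

lemma levy_tail_sets: "levy_measure \<nu> \<Longrightarrow> 0 \<le> x \<Longrightarrow> {x<..} \<in> sets \<nu>"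
  by (auto simp: levy_measure_def sets_restrict_space image_iff intro!: bexI[of _ "{x<..}"])

lemma levy_tail_finite:
  assumes "levy_measure \<nu>" "0 < x"
  shows "emeasure \<nu> {x<..} < \<infinity>"
proof -
  have "ennreal (min 1 x) * emeasure \<nu> {x<..} = (\<integral>\<^sup>+t. ennreal (min 1 x) * indicator {x<..} t \<partial>\<nu>)"
    using assms levy_tail_sets[of \<nu> x] by (simp add: nn_integral_cmult_indicator)
  also have "\<dots> \<le> (\<integral>\<^sup>+t. ennreal (min 1 t) \<partial>\<nu>)"
    by (intro nn_integral_mono) (auto simp: indicator_def intro!: ennreal_leI)
  also have "\<dots> < \<infinity>" using assms by (simp add: levy_measure_def)
  finally show ?thesis
    using assms(2) by (auto simp: ennreal_mult_less_top)
qed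

lemma emeasure_levy_tail:
  "levy_measure \<nu> \<Longrightarrow> 0 < x \<Longrightarrow> emeasure \<nu> {x<..} = ennreal (levy_tail \<nu> x)"
  using levy_tail_finite[of \<nu> x] by (simp add: levy_tail_def emeasure_eq_ennreal_measure)

lemma levy_tail_nonneg [simp]: "0 \<le> levy_tail \<nu> x"
  by (simp add: levy_tail_def)

text \<open>Here the value of \<^const>\<open>measure\<close> on sets that are not measurable, or have infinite measure, is used. The
  tail thus extends by \<open>0\<close> to the whole line.\<close>

lemma levy_tail_nonpos:
  assumes "levy_measure \<nu>" "x \<le> 0"
  shows "levy_tail \<nu> x = 0"
proof (cases "x = 0")
  case True
  then show ?thesis using assms by (simp add: levy_tail_def levy_measure_def measure_def)
next
  case False
  then have "{x<..} \<notin> sets \<nu>"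
    using sets.sets_into_space[of "{x<..}" \<nu>] assms dense[of x 0]
    by (fastforce simp: space_levy_measure subset_eq)
  then show ?thesis by (simp add: levy_tail_def measure_notin_sets)
qed

lemma levy_tail_antimono:
  assumes "levy_measure \<nu>" "0 < x" "x \<le> y"
  shows "levy_tail \<nu> y \<le> levy_tail \<nu> x"
proof -
  have "emeasure \<nu> {y<..} \<le> emeasure \<nu> {x<..}"
    using assms by (intro emeasure_mono levy_tail_sets) auto
  then show ?thesis
    using assms by (simp add: emeasure_levy_tail)
qed

lemma borel_measurable_levy_tail:
  assumes "levy_measure \<nu>"
  shows "levy_tail \<nu> \<in> borel_measurable borel"
proof -
  have "mono_on {0<..} (\<lambda>x. - levy_tail \<nu> x)"
    using levy_tail_antimono[OF assms] by (auto intro!: mono_onI)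
  then have "(\<lambda>x. - levy_tail \<nu> x) \<in> borel_measurable (restrict_space borel {0<..})"
    by (rule borel_measurable_mono_on_fnc)
  then have "(\<lambda>x. indicator {0<..} x *\<^sub>R (- levy_tail \<nu> x)) \<in> borel_measurable borel"
    by (subst (asm) borel_measurable_restrict_space_iff) auto
  then have "(\<lambda>x. - (indicator {0<..} x *\<^sub>R (- levy_tail \<nu> x))) \<in> borel_measurable borel"
    by measurable
  moreover have "(\<lambda>x. - (indicator {0<..} x *\<^sub>R (- levy_tail \<nu> x))) = levy_tail \<nu>"
    using levy_tail_nonpos[OF assms] by (auto simp: fun_eq_iff indicator_def)
  ultimately show ?thesis by simp
qed

lemma sigma_finite_levy_measure:
  assumes "levy_measure \<nu>"
  shows "sigma_finite_measure \<nu>"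
proof
  show "\<exists>A. countable A \<and> A \<subseteq> sets \<nu> \<and> \<Union> A = space \<nu> \<and> (\<forall>a\<in>A. emeasure \<nu> a \<noteq> \<infinity>)"
  proof (intro exI[of _ "range (\<lambda>n::nat. {inverse (real (Suc n))<..})"] conjI)
    show "\<Union> (range (\<lambda>n. {inverse (real (Suc n))<..})) = space \<nu>"
    proof -
      have "\<exists>n. inverse (real (Suc n)) < x" if "0 < x" for x
        using reals_Archimedean[OF that] by auto
      moreover have "0 < x" if "inverse (real (Suc n)) < x" for n x
        by (rule less_trans[OF _ that]) simp
      ultimately show ?thesis using space_levy_measure[OF assms] by auto
    qed
    show "\<forall>a\<in>range (\<lambda>n. {inverse (real (Suc n))<..}). emeasure \<nu> a \<noteq> \<infinity>"
      using levy_tail_finite[OF assms] by (auto simp: less_top[symmetric])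
    show "range (\<lambda>n. {inverse (real (Suc n))<..}) \<subseteq> sets \<nu>"
      using levy_tail_sets[OF assms] by auto
  qed auto
qed

lemma levy_measure_integrable_exp:
  assumes "levy_measure \<nu>" "0 \<le> x"
  shows "integrable \<nu> (\<lambda>t. 1 - exp (- x * t))"
proof (rule Bochner_Integration.integrable_bound)
  have "integrable \<nu> (\<lambda>t. min 1 t)"
    using assms borel_measurable_levy_measure[OF assms(1), of "\<lambda>t. min 1 t"]
    by (intro integrableI_nonneg AE_I2) (auto simp: levy_measure_def space_levy_measure)
  then show "integrable \<nu> (\<lambda>t. max 1 x * min 1 t)" by (rule integrable_mult_right)
  show "(\<lambda>t. 1 - exp (- x * t)) \<in> borel_measurable \<nu>"
    by (rule borel_measurable_levy_measure[OF assms(1)]) measurable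
  show "AE t in \<nu>. norm (1 - exp (- x * t)) \<le> norm (max 1 x * min 1 t)"
  proof (rule AE_I2)
    fix t assume "t \<in> space \<nu>"
    then have t: "0 < t" by (simp add: space_levy_measure[OF assms(1)])
    have 1: "0 \<le> 1 - exp (- x * t)" using assms t by simp
    have 2: "1 - exp (- x * t) \<le> x * t" using exp_ge_add_one_self[of "- x * t"] by simp
    have 3: "x * t \<le> max 1 x * t" using t by (intro mult_right_mono) auto
    have "1 - exp (- x * t) \<le> max 1 x * min 1 t"
    proof (cases "t \<le> 1")
      case True
      then show ?thesis using 2 3 by simp
    next
      case False
      have "1 - exp (- x * t) \<le> 1" by simp
      also have "1 \<le> max 1 x * min 1 t" using False by simp
      finally show ?thesis .
    qed
    then show "norm (1 - exp (- x * t)) \<le> norm (max 1 x * min 1 t)"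
      using 1 by simp
  qed
qed

lemma ennreal_laplace_exponent:
  assumes "levy_measure \<nu>" "0 \<le> x"
  shows "ennreal (laplace_exponent \<nu> x) = (\<integral>\<^sup>+t. ennreal (1 - exp (- x * t)) \<partial>\<nu>)"
  unfolding laplace_exponent_def
  using assms by (intro nn_integral_eq_integral[symmetric] levy_measure_integrable_exp AE_I2)
    (auto simp: space_levy_measure)

text \<open>As \<open>n\<close> grows, \<open>1 - exp (- n t)\<close> increases to \<open>1\<close>, so the integrals increase to the total mass of the
  Levy measure, which is infinite.\<close>

lemma laplace_exponent_unbounded:
  assumes "levy_measure \<nu>"
  shows "\<exists>n::nat. C < laplace_exponent \<nu> (real n)"
proof (rule ccontr)
  assume "\<not> ?thesis"
  then have le: "laplace_exponent \<nu> (real n) \<le> C" for n by (auto simp: not_less)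
  have m: "(\<lambda>t. ennreal (1 - exp (- real n * t))) \<in> borel_measurable \<nu>" for n
    by (rule borel_measurable_levy_measure[OF assms]) measurable
  have "\<infinity> = (\<integral>\<^sup>+t. 1 \<partial>\<nu>)"
    using assms by (simp add: space_levy_measure levy_measure_def)
  also have "\<dots> = (\<integral>\<^sup>+t. (SUP n. ennreal (1 - exp (- real n * t))) \<partial>\<nu>)"
  proof (intro nn_integral_cong)
    fix t assume "t \<in> space \<nu>"
    then have t: "0 < t" by (simp add: space_levy_measure[OF assms])
    have "(\<lambda>n. ennreal (1 - exp (- real n * t))) \<longlonglongrightarrow> ennreal (1 - 0)"
    proof (intro tendsto_ennrealI tendsto_diff tendsto_const)
      have "(\<lambda>n. (exp (- t)) ^ n) \<longlonglongrightarrow> 0"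
        using t by (intro LIMSEQ_realpow_zero) auto
      then show "(\<lambda>n. exp (- real n * t)) \<longlonglongrightarrow> 0"
        by (simp flip: exp_of_nat_mult)
    qed
    moreover have "incseq (\<lambda>n. ennreal (1 - exp (- real n * t)))"
      using t by (auto simp: incseq_def intro!: ennreal_leI)
    ultimately show "1 = (SUP n. ennreal (1 - exp (- real n * t)))"
      using LIMSEQ_unique[OF LIMSEQ_SUP] by force
  qed
  also have "\<dots> = (SUP n. (\<integral>\<^sup>+t. ennreal (1 - exp (- real n * t)) \<partial>\<nu>))"
  proof (rule nn_integral_monotone_convergence_SUP_AE)
    show "AE t in \<nu>. ennreal (1 - exp (- real n * t)) \<le> ennreal (1 - exp (- real (Suc n) * t))" for n
      using assms by (intro AE_I2 ennreal_leI) (auto simp: space_levy_measure algebra_simps)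
  qed (rule m)
  also have "\<dots> \<le> ennreal C"
    unfolding ennreal_laplace_exponent[OF assms of_nat_0_le_iff, symmetric]
    using le by (intro SUP_least ennreal_leI)
  finally show False by (simp add: top_unique)
qed

lemma laplace_exponent_pos:
  assumes "levy_measure \<nu>" "0 < x"
  shows "0 < laplace_exponent \<nu> x"
proof (rule ccontr)
  assume "\<not> ?thesis"
  then have "ennreal (laplace_exponent \<nu> x) = 0" by (simp add: ennreal_neg)
  then have "(\<integral>\<^sup>+t. ennreal (1 - exp (- x * t)) \<partial>\<nu>) = 0"
    using assms by (simp add: ennreal_laplace_exponent)
  then have "AE t in \<nu>. ennreal (1 - exp (- x * t)) = 0"
    by (subst (asm) nn_integral_0_iff_AE)
      (auto intro!: borel_measurable_levy_measure[OF assms(1)])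
  moreover have "ennreal (1 - exp (- x * t)) \<noteq> 0" if "t \<in> space \<nu>" for t
    using that assms by (simp add: space_levy_measure)
  ultimately have "AE t in \<nu>. False"
    by (auto elim: AE_mp intro!: AE_I2)
  then have "emeasure \<nu> (space \<nu>) = 0"
    using AE_iff_measurable[of "space \<nu>" \<nu> "\<lambda>_. False"] by simp
  then show False
    using assms by (simp add: space_levy_measure levy_measure_def)
qed

text \<open>Tonelli's theorem on the set \<open>0 < x < y\<close>; the tail at \<open>x\<close> is the measure of its section over \<open>x\<close>.\<close>

lemma nn_integral_levy_tail:
  assumes "levy_measure \<nu>" and g [measurable]: "g \<in> borel_measurable borel"
  shows "(\<integral>\<^sup>+x. g x * ennreal (levy_tail \<nu> x) \<partial>lborel) = (\<integral>\<^sup>+y. (\<integral>\<^sup>+x. g x * indicator {0..y} x \<partial>lborel) \<partial>\<nu>)"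
proof -
  interpret sigma_finite_measure \<nu> by (rule sigma_finite_levy_measure[OF assms(1)])
  interpret P: pair_sigma_finite lborel \<nu> ..
  have [measurable]: "(\<lambda>y. y) \<in> borel_measurable \<nu>"
    by (rule borel_measurable_levy_measure[OF assms(1)]) measurable
  define f where "f = (\<lambda>(x, y). if 0 < x \<and> x < y then g x else 0)"
  have [measurable]: "snd \<in> borel_measurable (lborel \<Otimes>\<^sub>M \<nu>)"
    by (rule measurable_compose[OF measurable_snd]) measurable
  have f: "f \<in> borel_measurable (lborel \<Otimes>\<^sub>M \<nu>)"
    unfolding f_def case_prod_beta by measurable
  have "(\<integral>\<^sup>+x. g x * ennreal (levy_tail \<nu> x) \<partial>lborel) = (\<integral>\<^sup>+x. (\<integral>\<^sup>+y. f (x, y) \<partial>\<nu>) \<partial>lborel)"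
  proof (rule nn_integral_cong)
    fix x :: real
    show "g x * ennreal (levy_tail \<nu> x) = (\<integral>\<^sup>+y. f (x, y) \<partial>\<nu>)"
    proof (cases "0 < x")
      case True
      then have "(\<integral>\<^sup>+y. f (x, y) \<partial>\<nu>) = (\<integral>\<^sup>+y. g x * indicator {x<..} y \<partial>\<nu>)"
        by (intro nn_integral_cong) (auto simp: f_def)
      then show ?thesis
        using True levy_tail_sets[OF assms(1), of x]
        by (simp add: nn_integral_cmult_indicator emeasure_levy_tail[OF assms(1)])
    next
      case False
      then show ?thesis by (simp add: f_def levy_tail_nonpos[OF assms(1)])
    qed
  qed
  also have "\<dots> = (\<integral>\<^sup>+y. (\<integral>\<^sup>+x. f (x, y) \<partial>lborel) \<partial>\<nu>)"
    using P.Fubini'[of "\<lambda>x y. f (x, y)"] f by simp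
  also have "\<dots> = (\<integral>\<^sup>+y. (\<integral>\<^sup>+x. g x * indicator {0..y} x \<partial>lborel) \<partial>\<nu>)"
  proof (rule nn_integral_cong, rule nn_integral_cong_AE)
    fix y
    show "AE x in lborel. f (x, y) = g x * indicator {0..y} x"
      using AE_lborel_singleton[of 0] AE_lborel_singleton[of y]
      by eventually_elim (auto simp: f_def)
  qed
  finally show ?thesis .
qed

lemma laplace_transform_levy_tail:
  assumes "levy_measure \<nu>" "0 < x"
  shows "has_bochner_integral lborel (\<lambda>t. exp (- x * t) * levy_tail \<nu> t) (laplace_exponent \<nu> x / x)"
proof (rule has_bochner_integral_nn_integral)
  have [measurable]: "levy_tail \<nu> \<in> borel_measurable borel"
    by (rule borel_measurable_levy_tail[OF assms(1)])
  have "(\<integral>\<^sup>+t. ennreal (exp (- x * t) * levy_tail \<nu> t) \<partial>lborel)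
      = (\<integral>\<^sup>+t. ennreal (exp (- x * t)) * ennreal (levy_tail \<nu> t) \<partial>lborel)"
    by (simp add: ennreal_mult)
  also have "\<dots> = (\<integral>\<^sup>+y. (\<integral>\<^sup>+t. ennreal (exp (- x * t)) * indicator {0..y} t \<partial>lborel) \<partial>\<nu>)"
    by (rule nn_integral_levy_tail[OF assms(1)]) measurable
  also have "\<dots> = (\<integral>\<^sup>+y. ennreal (1 / x) * ennreal (1 - exp (- x * y)) \<partial>\<nu>)"
  proof (rule nn_integral_cong)
    fix y assume "y \<in> space \<nu>"
    then have y: "0 < y" by (simp add: space_levy_measure[OF assms(1)])
    have "(\<integral>\<^sup>+t. ennreal (exp (- x * t)) * indicator {0..y} t \<partial>lborel)
        = ennreal (- exp (- x * y) / x - (- exp (- x * 0) / x))"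
      using assms y by (intro nn_integral_FTC_Icc)
        (auto intro!: derivative_eq_intros simp: field_simps)
    also have "\<dots> = ennreal (1 / x) * ennreal (1 - exp (- x * y))"
      using assms y by (subst ennreal_mult[symmetric]) (auto simp: field_simps)
    finally show "(\<integral>\<^sup>+t. ennreal (exp (- x * t)) * indicator {0..y} t \<partial>lborel)
      = ennreal (1 / x) * ennreal (1 - exp (- x * y))" .
  qed
  also have "\<dots> = ennreal (1 / x) * ennreal (laplace_exponent \<nu> x)"
    using assms by (subst nn_integral_cmult)
      (auto intro!: borel_measurable_levy_measure[OF assms(1)] simp: ennreal_laplace_exponent)
  also have "\<dots> = ennreal (laplace_exponent \<nu> x / x)"
    using assms laplace_exponent_pos[OF assms] by (subst ennreal_mult[symmetric]) auto
  finally show "(\<integral>\<^sup>+t. ennreal (exp (- x * t) * levy_tail \<nu> t) \<partial>lborel) = ennreal (laplace_exponent \<nu> x / x)" .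
  show "(\<lambda>t. exp (- x * t) * levy_tail \<nu> t) \<in> borel_measurable lborel" by measurable
  show "0 \<le> laplace_exponent \<nu> x / x"
    using assms laplace_exponent_pos[OF assms] by simp
qed auto

section \<open>The inverse of a subordinator\<close>

locale subordinated =
  fixes \<nu> :: "real measure" and M :: "'w measure" and S :: "real \<Rightarrow> 'w \<Rightarrow> real"
  assumes levy: "levy_measure \<nu>"
    and subordinator: "subordinator M S (laplace_exponent \<nu>)"
begin

sublocale prob_space M
  using subordinator by (simp add: subordinator_def)

abbreviation \<Phi> :: "real \<Rightarrow> real" where "\<Phi> \<equiv> laplace_exponent \<nu>"
abbreviation L :: "real \<Rightarrow> 'w \<Rightarrow> real" where "L \<equiv> inverse_subordinator S"
abbreviation e :: "real \<Rightarrow> complex \<Rightarrow> complex" where "e \<equiv> e_fun M S"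

lemma S_measurable: "0 \<le> t \<Longrightarrow> S t \<in> borel_measurable M"
  using subordinator by (simp add: subordinator_def)

lemma S_zero: "\<omega> \<in> space M \<Longrightarrow> S 0 \<omega> = 0"
  using subordinator by (simp add: subordinator_def)

lemma S_mono: "\<omega> \<in> space M \<Longrightarrow> 0 \<le> r \<Longrightarrow> r \<le> t \<Longrightarrow> S r \<omega> \<le> S t \<omega>"
  using subordinator by (auto simp: subordinator_def mono_on_def)

lemma S_nonneg: "\<omega> \<in> space M \<Longrightarrow> 0 \<le> t \<Longrightarrow> 0 \<le> S t \<omega>"
  using S_mono[of \<omega> 0 t] S_zero[of \<omega>] by simp

lemma S_right_continuous: "\<omega> \<in> space M \<Longrightarrow> 0 \<le> t \<Longrightarrow> continuous (at_right t) (\<lambda>t. S t \<omega>)"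
  using subordinator by (simp add: subordinator_def)

lemma S_laplace: "0 \<le> t \<Longrightarrow> 0 \<le> x \<Longrightarrow> expectation (\<lambda>\<omega>. exp (- x * S t \<omega>)) = exp (- t * \<Phi> x)"
  using subordinator by (simp add: subordinator_def)

text \<open>Markov's inequality for \<open>exp (- x S r)\<close>. Letting \<open>r\<close> grow shows that the paths are unbounded; letting
  \<open>x\<close> grow, with \<open>t = 0\<close>, shows that they are not constant on any interval.\<close>

lemma prob_S_le:
  assumes "0 \<le> r" "0 \<le> x"
  shows "prob {\<omega>\<in>space M. S r \<omega> \<le> t} \<le> exp (x * t - r * \<Phi> x)"
proof -
  have [measurable]: "S r \<in> borel_measurable M" by (rule S_measurable[OF assms(1)])
  have int: "integrable M (\<lambda>\<omega>. exp (- x * S r \<omega>))"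
    using assms S_nonneg by (intro integrable_const_bound[where B=1] AE_I2) auto
  have "prob {\<omega>\<in>space M. S r \<omega> \<le> t} = expectation (indicator {\<omega>\<in>space M. S r \<omega> \<le> t})"
    by (simp add: Int_absorb1)
  also have "\<dots> \<le> expectation (\<lambda>\<omega>. exp (x * t) * exp (- x * S r \<omega>))"
  proof (rule integral_mono)
    show "indicator {\<omega>\<in>space M. S r \<omega> \<le> t} \<omega> \<le> exp (x * t) * exp (- x * S r \<omega>)" for \<omega>
      using assms by (auto simp: indicator_def mult_left_mono simp flip: exp_add)
  qed (use int in \<open>auto intro!: integrable_real_indicator simp: less_top[symmetric]\<close>)
  also have "\<dots> = exp (x * t) * exp (- r * \<Phi> x)"
    using int S_laplace[OF assms] by simp
  finally show ?thesis by (simp add: exp_diff exp_minus field_simps)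
qed

lemma AE_S_unbounded: "AE \<omega> in M. \<forall>t. \<exists>r>0. t < S r \<omega>"
proof -
  have "AE \<omega> in M. \<exists>n. real k < S (real (Suc n)) \<omega>" for k :: nat
  proof -
    have [measurable]: "S (1 + real n) \<in> borel_measurable M" for n by (rule S_measurable) simp
    define A where "A = {\<omega>\<in>space M. \<forall>n. S (real (Suc n)) \<omega> \<le> real k}"
    have A: "A \<in> events" unfolding A_def of_nat_Suc by measurable
    have "prob A \<le> exp (real k - real (Suc n) * \<Phi> 1)" for n
    proof -
      have "prob A \<le> prob {\<omega>\<in>space M. S (real (Suc n)) \<omega> \<le> real k}"
        by (intro finite_measure_mono) (auto simp: A_def)
      also have "\<dots> \<le> exp (real k - real (Suc n) * \<Phi> 1)"
        using prob_S_le[of "real (Suc n)" 1 "real k"] by simp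
      finally show ?thesis .
    qed
    moreover have "(\<lambda>n. exp (real k - real (Suc n) * \<Phi> 1)) \<longlonglongrightarrow> 0"
    proof -
      have "(\<lambda>n. exp (- \<Phi> 1) ^ n) \<longlonglongrightarrow> 0"
        using laplace_exponent_pos[OF levy, of 1] by (intro LIMSEQ_realpow_zero) auto
      then have "(\<lambda>n. exp (real k) * exp (- \<Phi> 1) ^ (Suc n)) \<longlonglongrightarrow> exp (real k) * 0"
        by (intro tendsto_mult tendsto_const) (rule LIMSEQ_Suc)
      then show ?thesis
        by (simp add: exp_diff exp_minus field_simps exp_of_nat_mult[symmetric] exp_add del: of_nat_Suc power_Suc)
    qed
    ultimately have "prob A \<le> 0"
      by (intro LIMSEQ_le_const) auto
    then have "prob A = 0" using measure_nonneg[of M A] by linarith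
    then have "AE \<omega> in M. \<omega> \<notin> A"
      using A by (simp add: prob_eq_0)
    then show ?thesis
      by (rule AE_mp) (auto simp: A_def not_le intro!: AE_I2)
  qed
  then have "AE \<omega> in M. \<forall>k. \<exists>n. real k < S (real (Suc n)) \<omega>"
    by (simp add: AE_all_countable)
  then show ?thesis
  proof eventually_elim
    case (elim \<omega>)
    show ?case
    proof
      fix t
      obtain k where "t \<le> real k" using real_arch_simple by blast
      moreover obtain n where "real k < S (real (Suc n)) \<omega>" using elim by blast
      ultimately show "\<exists>r>0. t < S r \<omega>" by (intro exI[of _ "real (Suc n)"]) auto
    qed
  qed
qed

text \<open>By stationarity, an interval of length \<open>p - q\<close> on which the path is constant has probability at most
  \<open>exp (- (p - q) (\<Phi> n))\<close> for every \<open>n\<close>, and \<open>\<Phi>\<close> is unbounded. Countably many intervals with rational end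
  points suffice.\<close>

lemma AE_S_strict_mono: "AE \<omega> in M. \<forall>r\<ge>0. \<forall>t>r. S r \<omega> < S t \<omega>"
proof -
  have main: "AE \<omega> in M. S q \<omega> < S p \<omega>" if q: "0 \<le> q" "q < p" for p q
  proof -
    have [measurable]: "S q \<in> borel_measurable M" "S p \<in> borel_measurable M" "S (p - q) \<in> borel_measurable M"
      using q by (auto intro: S_measurable)
    have "distr M borel (\<lambda>\<omega>. S (q + (p - q)) \<omega> - S q \<omega>) = distr M borel (S (p - q))"
      using subordinator q unfolding subordinator_def by (metis diff_ge_0_iff_ge less_imp_le)
    then have "measure (distr M borel (\<lambda>\<omega>. S p \<omega> - S q \<omega>)) {..0} = measure (distr M borel (S (p - q))) {..0}"
      by simp
    then have eq: "prob {\<omega>\<in>space M. S p \<omega> - S q \<omega> \<le> 0} = prob {\<omega>\<in>space M. S (p - q) \<omega> \<le> 0}"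
      by (simp add: measure_distr vimage_def Int_def conj_commute)
    have "prob {\<omega>\<in>space M. S p \<omega> - S q \<omega> \<le> 0} = 0"
    proof (rule ccontr)
      assume "\<not> ?thesis"
      then have pos: "0 < prob {\<omega>\<in>space M. S p \<omega> - S q \<omega> \<le> 0}"
        using measure_nonneg[of M] by (metis less_eq_real_def)
      define a where "a = prob {\<omega>\<in>space M. S p \<omega> - S q \<omega> \<le> 0}"
      obtain n :: nat where n: "- ln a / (p - q) < \<Phi> (real n)"
        using laplace_exponent_unbounded[OF levy] by blast
      then have "- ln a / (p - q) * (p - q) < \<Phi> (real n) * (p - q)"
        using q by (intro mult_strict_right_mono) auto
      moreover have "- ln a / (p - q) * (p - q) = - ln a" using q by simp
      ultimately have "- (p - q) * \<Phi> (real n) < ln a" by (simp only:) (simp add: algebra_simps)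
      then have "exp (- (p - q) * \<Phi> (real n)) < a"
        using pos by (metis a_def exp_less_mono exp_ln)
      moreover have "a \<le> exp (- (p - q) * \<Phi> (real n))"
        using prob_S_le[of "p - q" "real n" 0] q unfolding a_def eq by (simp add: algebra_simps)
      ultimately show False by simp
    qed
    then have "AE \<omega> in M. \<omega> \<notin> {\<omega>\<in>space M. S p \<omega> - S q \<omega> \<le> 0}"
      by (subst (asm) prob_eq_0) auto
    then show ?thesis by (rule AE_mp) (auto intro!: AE_I2)
  qed
  have "AE \<omega> in M. \<forall>q::rat. \<forall>p::rat. 0 \<le> q \<longrightarrow> q < p \<longrightarrow> S (of_rat q) \<omega> < S (of_rat p) \<omega>"
    using main by (simp add: AE_all_countable of_rat_less)
  with AE_space show ?thesis
  proof eventually_elim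
    case (elim \<omega>)
    show ?case
    proof (intro allI impI)
      fix r t :: real assume r: "0 \<le> r" "r < t"
      obtain q where q: "r < of_rat q" "of_rat q < t" using of_rat_dense[OF r(2)] by blast
      obtain p where p: "of_rat q < (of_rat p :: real)" "of_rat p < t" using of_rat_dense[OF q(2)] by blast
      have q0: "0 \<le> (of_rat q :: real)" using r q by linarith
      have "S r \<omega> \<le> S (of_rat q) \<omega>" using S_mono elim(1) r q by simp
      also have "\<dots> < S (of_rat p) \<omega>" using elim(2) p q0 by (simp add: of_rat_less zero_le_of_rat_iff)
      also have "\<dots> \<le> S t \<omega>" using p q0 by (intro S_mono elim(1)) linarith+
      finally show "S r \<omega> < S t \<omega>" .
    qed
  qed
qed

definition regular :: "'w \<Rightarrow> bool" where
  "regular \<omega> \<longleftrightarrow> \<omega> \<in> space M \<and> (\<forall>t. \<exists>r>0. t < S r \<omega>) \<and> (\<forall>r\<ge>0. \<forall>t>r. S r \<omega> < S t \<omega>)"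

lemma AE_regular: "AE \<omega> in M. regular \<omega>"
  using AE_space AE_S_unbounded AE_S_strict_mono by eventually_elim (simp add: regular_def)

lemma L_set_bdd: "bdd_below {r. 0 < r \<and> t < S r \<omega>}"
  by (rule bdd_belowI[of _ 0]) auto

lemma L_nonneg: "regular \<omega> \<Longrightarrow> 0 \<le> L t \<omega>"
  unfolding inverse_subordinator_def regular_def by (intro cInf_greatest) auto

lemma L_le: "0 < r \<Longrightarrow> t < S r \<omega> \<Longrightarrow> L t \<omega> \<le> r"
  unfolding inverse_subordinator_def by (intro cInf_lower L_set_bdd) auto

lemma L_less_obtain:
  assumes "regular \<omega>" "L t \<omega> < r"
  obtains q where "0 < q" "q < r" "t < S q \<omega>"
proof -
  have "{r. 0 < r \<and> t < S r \<omega>} \<noteq> {}" using assms by (auto simp: regular_def)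
  then show thesis
    using assms(2) that unfolding inverse_subordinator_def
    by (subst (asm) cInf_less_iff[OF _ L_set_bdd]) auto
qed

text \<open>Right continuity gives more than \<open>r \<le> L t\<close>: the path stays below \<open>t\<close> for some time after \<open>r\<close>.\<close>

lemma less_L:
  assumes "regular \<omega>" "0 \<le> r" "S r \<omega> < t"
  shows "r < L t \<omega>"
proof -
  have \<omega>: "\<omega> \<in> space M" using assms by (simp add: regular_def)
  have "((\<lambda>t. S t \<omega>) \<longlongrightarrow> S r \<omega>) (at_right r)"
    using S_right_continuous[OF \<omega> assms(2)] by (simp add: continuous_within)
  then have "\<forall>\<^sub>F q in at_right r. S q \<omega> < t"
    using assms(3) by (rule order_tendstoD)
  then obtain b where b: "b > r" "\<And>y. r < y \<Longrightarrow> y < b \<Longrightarrow> S y \<omega> < t"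
    by (auto simp: eventually_at_right_field)
  define r' where "r' = (r + b) / 2"
  have r': "r < r'" "S r' \<omega> < t" using b by (auto simp: r'_def)
  have "r' \<le> L t \<omega>"
    unfolding inverse_subordinator_def
  proof (rule cInf_greatest)
    show "{r. 0 < r \<and> t < S r \<omega>} \<noteq> {}" using assms by (auto simp: regular_def)
    fix q assume "q \<in> {r. 0 < r \<and> t < S r \<omega>}"
    then show "r' \<le> q"
      using S_mono[OF \<omega>, of q r'] r' by (cases "q \<le> r'") auto
  qed
  with r' show ?thesis by simp
qed

lemma S_le_of_less_L:
  assumes "regular \<omega>" "0 \<le> r" "0 \<le> t" "r < L t \<omega>"
  shows "S r \<omega> \<le> t"
proof (cases "r = 0")
  case True
  then show ?thesis using S_zero assms by (simp add: regular_def)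
next
  case False
  then show ?thesis using L_le[of r t \<omega>] assms by fastforce
qed

lemma L_mono: "regular \<omega> \<Longrightarrow> t \<le> t' \<Longrightarrow> L t \<omega> \<le> L t' \<omega>"
  unfolding inverse_subordinator_def
  by (intro cInf_superset_mono L_set_bdd) (auto simp: regular_def)

lemma L_zero: assumes "regular \<omega>" shows "L 0 \<omega> = 0"
proof (rule antisym[OF _ L_nonneg[OF assms]])
  show "L 0 \<omega> \<le> 0"
  proof (rule field_le_epsilon)
    fix r :: real assume "0 < r"
    then have "S 0 \<omega> < S r \<omega>" using assms by (simp add: regular_def)
    then show "L 0 \<omega> \<le> 0 + r"
      using \<open>0 < r\<close> S_zero assms by (simp add: regular_def L_le)
  qed
qed

text \<open>A jump of \<open>L\<close> would be an interval on which \<open>S\<close> is constant.\<close>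

lemma L_continuous:
  assumes "regular \<omega>"
  shows "continuous_on {0..} (\<lambda>t. L t \<omega>)"
proof -
  have "((\<lambda>t. L t \<omega>) \<longlongrightarrow> L t \<omega>) (at t within {0..})" if "0 \<le> t" for t
  proof (rule order_tendstoI)
    fix a assume "a < L t \<omega>"
    show "\<forall>\<^sub>F x in at t within {0..}. a < L x \<omega>"
    proof (cases "a < 0")
      case True
      then show ?thesis using L_nonneg[OF assms] by (auto intro!: always_eventually elim: less_le_trans)
    next
      case False
      define b where "b = (a + L t \<omega>) / 2"
      have b: "a < b" "b < L t \<omega>" using \<open>a < L t \<omega>\<close> by (auto simp: b_def)
      have "S a \<omega> < S b \<omega>" using False b assms by (simp add: regular_def)
      also have "\<dots> \<le> t" using S_le_of_less_L[OF assms _ that b(2)] b False by simp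
      finally have "S a \<omega> < t" .
      from order_tendstoD(1)[OF tendsto_ident_at this] show ?thesis
        by eventually_elim (use less_L[OF assms] False in auto)
    qed
  next
    fix a assume "L t \<omega> < a"
    then obtain q where q: "0 < q" "q < a" "t < S q \<omega>" using L_less_obtain[OF assms] by blast
    from order_tendstoD(2)[OF tendsto_ident_at q(3)]
    show "\<forall>\<^sub>F x in at t within {0..}. L x \<omega> < a"
      by eventually_elim (use L_le[OF q(1)] q in \<open>force intro: le_less_trans\<close>)
  qed
  then show ?thesis by (simp add: continuous_on_def)
qed

text \<open>Where the infimum is over a nonempty set, \<open>L t < a\<close> means that \<open>S q > t\<close> for some rational \<open>q\<close> in
  \<open>(0, a)\<close>; elsewhere \<open>L\<close> has the constant value \<open>Inf {}\<close>.\<close>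

lemma L_measurable_pair: "(\<lambda>(t, \<omega>). L t \<omega>) \<in> borel_measurable (borel \<Otimes>\<^sub>M M)"
proof (subst borel_measurable_iff_less, rule allI)
  fix a :: real
  \<comment> \<open>\<^term>\<open>S\<close> is measurable at nonnegative times only; \<open>max 0\<close> keeps negative rationals away from it.\<close>
  have [measurable]: "S (max 0 (of_rat q)) \<in> borel_measurable M" "S (1 + real n) \<in> borel_measurable M" for q :: rat and n
    by (auto intro: S_measurable)
  define N where "N p \<longleftrightarrow> (\<exists>n. fst p < S (real (Suc n)) (snd p))" for p
  define Q where "Q p \<longleftrightarrow> (\<exists>q::rat. 0 < q \<and> of_rat q < a \<and> fst p < S (max 0 (of_rat q)) (snd p))" for p
  have N: "N p \<longleftrightarrow> (\<exists>r>0. fst p < S r (snd p))" if "snd p \<in> space M" for p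
  proof
    assume "\<exists>r>0. fst p < S r (snd p)"
    then obtain r where r: "0 < r" "fst p < S r (snd p)" by blast
    obtain n where "r \<le> real n" using real_arch_simple by blast
    then have "S r (snd p) \<le> S (real (Suc n)) (snd p)" using S_mono[OF that] r by simp
    then show "N p" using r by (auto simp: N_def intro: less_le_trans)
  next
    assume "N p"
    then obtain n where "fst p < S (real (Suc n)) (snd p)" by (auto simp: N_def)
    then show "\<exists>r>0. fst p < S r (snd p)" by (intro exI[of _ "real (Suc n)"]) simp
  qed
  have Q: "Q p \<longleftrightarrow> L (fst p) (snd p) < a" if p: "snd p \<in> space M" "N p" for p
  proof
    assume "Q p"
    then obtain q where q: "0 < q" "of_rat q < a" "fst p < S (max 0 (of_rat q)) (snd p)"
      by (auto simp: Q_def)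
    then show "L (fst p) (snd p) < a"
      using L_le[of "of_rat q" "fst p" "snd p"] by (simp add: max_def zero_less_of_rat_iff less_imp_le split: if_splits)
  next
    assume "L (fst p) (snd p) < a"
    moreover have "{r. 0 < r \<and> fst p < S r (snd p)} \<noteq> {}" using N p by auto
    ultimately obtain r where r: "0 < r" "r < a" "fst p < S r (snd p)"
      unfolding inverse_subordinator_def by (auto simp: cInf_less_iff[OF _ L_set_bdd])
    obtain q where q: "r < of_rat q" "of_rat q < a" using of_rat_dense[OF r(2)] by blast
    then have "0 < (of_rat q :: real)" using r by linarith
    moreover have "S r (snd p) \<le> S (of_rat q) (snd p)" using S_mono[OF p(1)] r q by simp
    ultimately show "Q p"
      using r q by (auto simp: Q_def max_def zero_less_of_rat_iff intro!: exI[of _ q])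
  qed
  have "{p \<in> space (borel \<Otimes>\<^sub>M M). (case p of (t, \<omega>) \<Rightarrow> L t \<omega>) < a}
      = {p \<in> space (borel \<Otimes>\<^sub>M M). (N p \<longrightarrow> Q p) \<and> (\<not> N p \<longrightarrow> Inf {} < a)}"
  proof (intro Collect_cong conj_cong refl)
    fix p :: "real \<times> 'w" assume "p \<in> space (borel \<Otimes>\<^sub>M M)"
    then have p: "snd p \<in> space M" by (auto simp: space_pair_measure)
    show "((case p of (t, \<omega>) \<Rightarrow> L t \<omega>) < a) = ((N p \<longrightarrow> Q p) \<and> (\<not> N p \<longrightarrow> Inf {} < a))"
    proof (cases "N p")
      case True
      then show ?thesis using Q[OF p] by (simp add: case_prod_beta)
    next
      case False
      then have "{r. 0 < r \<and> fst p < S r (snd p)} = {}" using N[OF p] by auto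
      then have "L (fst p) (snd p) = Inf {}" by (simp only: inverse_subordinator_def)
      then show ?thesis using False by (simp add: case_prod_beta)
    qed
  qed
  also have "\<dots> \<in> sets (borel \<Otimes>\<^sub>M M)"
    unfolding N_def Q_def of_nat_Suc by measurable
  finally show "{p \<in> space (borel \<Otimes>\<^sub>M M). (case p of (t, \<omega>) \<Rightarrow> L t \<omega>) < a} \<in> sets (borel \<Otimes>\<^sub>M M)" .
qed

lemma L_measurable [measurable]: "L t \<in> borel_measurable M"
  using measurable_compose[OF measurable_Pair1' L_measurable_pair, of t] by simp

end

section \<open>Relaxation functions and their Laplace transform\<close>

lemma continuous_Icc_bound:
  fixes f :: "real \<Rightarrow> 'a::real_normed_vector"
  assumes "continuous_on {a..b} f"
  obtains B where "\<And>x. x \<in> {a..b} \<Longrightarrow> norm (f x) \<le> B"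
proof -
  have "bounded (f ` {a..b})"
    by (intro compact_imp_bounded compact_continuous_image assms) simp
  then show thesis using that unfolding bounded_iff by blast
qed

lemma exp_decay_tendsto:
  assumes "0 < (b::real)"
  shows "((\<lambda>x. exp (- b * x)) \<longlongrightarrow> 0) at_top"
  by (rule filterlim_compose[OF exp_at_bot filterlim_tendsto_neg_mult_at_bot[OF tendsto_const _ filterlim_ident]])
    (use assms in simp)

lemma integrable_exp_decay:
  assumes "0 < (b::real)"
  shows "integrable lborel (\<lambda>x. indicator {0..} x *\<^sub>R exp (- b * x))"
proof -
  have "(\<integral>\<^sup>+x. ennreal (exp (- b * x)) * indicator {0..} x \<partial>lborel) = ennreal (0 - (- exp (- b * 0) / b))"
  proof (rule nn_integral_FTC_atLeast)
    show "((\<lambda>x. - exp (- b * x) / b) \<longlongrightarrow> 0) at_top"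
      using tendsto_divide[OF tendsto_minus[OF exp_decay_tendsto[OF assms(1)]] tendsto_const[of b]] assms by simp
  qed (use assms in \<open>auto intro!: derivative_eq_intros\<close>)
  then have "(\<integral>\<^sup>+x. ennreal (indicator {0..} x *\<^sub>R exp (- b * x)) \<partial>lborel) < \<infinity>"
    by (subst nn_integral_cong[where v="\<lambda>x. ennreal (exp (- b * x)) * indicator {0..} x"])
      (auto simp: indicator_def)
  then show ?thesis
    by (intro integrableI_nonneg) auto
qed

context subordinated
begin

lemma exp_L_bound:
  assumes "regular \<omega>" "Re z \<le> 0"
  shows "cmod (exp (z * complex_of_real (L t \<omega>))) \<le> 1"
  using assms L_nonneg[OF assms(1), of t] by (simp add: mult_nonpos_nonneg)

lemma exp_L_integrable:
  assumes "Re z \<le> 0"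
  shows "integrable M (\<lambda>\<omega>. exp (z * complex_of_real (L t \<omega>)))"
  using AE_regular exp_L_bound[OF _ assms]
  by (intro integrable_const_bound[where B=1]) (auto elim!: AE_mp)

lemma exp_neg_L_integrable:
  assumes "0 \<le> c"
  shows "integrable M (\<lambda>\<omega>. exp (- c * L t \<omega>))"
  using AE_regular L_nonneg assms
  by (intro integrable_const_bound[where B=1]) (auto elim!: AE_mp)

text \<open>The relaxation function for the real exponent \<open>- c\<close>. It is the modulus bound for all exponents with
  real part \<open>- c\<close>, and it is monotone in time.\<close>

definition er :: "real \<Rightarrow> real \<Rightarrow> real" where
  "er t c = expectation (\<lambda>\<omega>. exp (- c * L t \<omega>))"

lemma e_of_real: "e t (- complex_of_real c) = complex_of_real (er t c)"
  unfolding e_fun_def er_def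
  by (subst integral_complex_of_real[symmetric]) (simp flip: exp_of_real)

lemma norm_e_le_er: "cmod (e t z) \<le> er t (- Re z)"
  unfolding e_fun_def er_def by (rule order_trans[OF integral_norm_bound]) simp

lemma er_le_1: "0 \<le> c \<Longrightarrow> er t c \<le> 1"
  unfolding er_def
  using AE_regular L_nonneg exp_neg_L_integrable
  by (intro integral_le_const) (auto elim!: AE_mp)

lemma er_nonneg: "0 \<le> er t c"
  unfolding er_def by simp

lemma norm_e_le_1: "Re z \<le> 0 \<Longrightarrow> cmod (e t z) \<le> 1"
  using norm_e_le_er[of t z] er_le_1[of "- Re z" t] by simp

lemma er_antimono: "0 \<le> c \<Longrightarrow> t \<le> t' \<Longrightarrow> er t' c \<le> er t c"
  unfolding er_def
  using AE_regular L_mono exp_neg_L_integrable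
  by (intro integral_mono_AE) (auto elim!: AE_mp intro!: mult_left_mono)

lemma e_zero: "e 0 z = 1"
proof -
  have "e 0 z = (\<integral>\<omega>. 1 \<partial>M)"
    unfolding e_fun_def using AE_regular by (intro integral_cong_AE) (auto elim!: AE_mp simp: L_zero)
  then show ?thesis by (simp add: prob_space)
qed

text \<open>Dominated convergence along the continuous paths of \<open>L\<close>.\<close>

lemma e_continuous:
  assumes "Re z \<le> 0"
  shows "continuous_on {0..} (\<lambda>t. e t z)"
proof -
  have "((\<lambda>x. e x z) \<longlongrightarrow> e t z) (at t within {0..})" if "t \<in> {0..}" for t
    unfolding e_fun_def
  proof (rule tendsto_at_iff_sequentially[THEN iffD2], intro allI impI)
    fix X :: "nat \<Rightarrow> real"
    assume X: "\<forall>i. X i \<in> {0..} - {t}" "X \<longlonglongrightarrow> t"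
    show "((\<lambda>t. expectation (\<lambda>\<omega>. exp (z * complex_of_real (L t \<omega>)))) \<circ> X)
        \<longlonglongrightarrow> expectation (\<lambda>\<omega>. exp (z * complex_of_real (L t \<omega>)))"
      unfolding comp_def
    proof (rule integral_dominated_convergence[where w="\<lambda>_. 1"])
      show "AE \<omega> in M. (\<lambda>i. exp (z * complex_of_real (L (X i) \<omega>))) \<longlonglongrightarrow> exp (z * complex_of_real (L t \<omega>))"
        using AE_regular
      proof eventually_elim
        case (elim \<omega>)
        have "(\<lambda>i. L (X i) \<omega>) \<longlonglongrightarrow> L t \<omega>"
          using L_continuous[OF elim] X that by (auto intro: continuous_on_tendsto_compose)
        then show ?case by (intro tendsto_intros)
      qed
      show "AE \<omega> in M. norm (exp (z * complex_of_real (L (X i) \<omega>))) \<le> 1" for i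
        using AE_regular by eventually_elim (rule exp_L_bound[OF _ assms])
    qed auto
  qed
  then show ?thesis by (simp add: continuous_on_def)
qed

lemma er_tendsto_1: "(\<lambda>n. er t (inverse (real (Suc n)))) \<longlonglongrightarrow> 1"
proof -
  have "(\<lambda>n. er t (inverse (real (Suc n)))) \<longlonglongrightarrow> expectation (\<lambda>_. 1)"
    unfolding er_def
  proof (rule integral_dominated_convergence[where w="\<lambda>_. 1"])
    show "AE \<omega> in M. (\<lambda>n. exp (- inverse (real (Suc n)) * L t \<omega>)) \<longlonglongrightarrow> 1"
    proof (rule AE_I2)
      fix \<omega>
      have "(\<lambda>n. exp (- inverse (real (Suc n)) * L t \<omega>)) \<longlonglongrightarrow> exp (- 0 * L t \<omega>)"
        by (intro tendsto_intros LIMSEQ_inverse_real_of_nat)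
      then show "(\<lambda>n. exp (- inverse (real (Suc n)) * L t \<omega>)) \<longlonglongrightarrow> 1" by simp
    qed
    show "AE \<omega> in M. norm (exp (- inverse (real (Suc n)) * L t \<omega>)) \<le> 1" for n
      using AE_regular by eventually_elim (use L_nonneg in auto)
  qed auto
  then show ?thesis by (simp add: prob_space)
qed

lemma integral_exp_decay:
  fixes z :: complex and a :: real
  assumes "Re z < a"
  shows "(\<integral>x. indicator {0..} x *\<^sub>R exp ((z - complex_of_real a) * complex_of_real x) \<partial>lborel) = 1 / (complex_of_real a - z)"
proof -
  define w where "w = z - complex_of_real a"
  have w: "Re w < 0" using assms by (simp add: w_def)
  then have w0: "w \<noteq> 0" by auto
  have n: "cmod (exp (w * complex_of_real x)) = exp (Re w * x)" for x by simp
  have int: "integrable lborel (\<lambda>x. indicator {0..} x *\<^sub>R exp (w * complex_of_real x))"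
    using integrable_exp_decay[of "- Re w"] w by (intro Bochner_Integration.integrable_bound[OF integrable_exp_decay[of "- Re w"]]) auto
  have si: "set_integrable lborel {0<..} (\<lambda>x. exp (w * complex_of_real x))"
    unfolding set_integrable_def
    by (rule Bochner_Integration.integrable_bound[OF int]) (auto simp: indicator_def)
  have "(LBINT x=0..\<infinity>. exp (w * complex_of_real x)) = 0 - 1 / w"
  proof (rule interval_integral_FTC_integrable[where F="\<lambda>x. exp (w * complex_of_real x) / w"])
    show "((\<lambda>x. exp (w * complex_of_real x) / w) has_vector_derivative exp (w * complex_of_real x)) (at x)" for x
    proof -
      have "((\<lambda>y. exp (w * y) / w) has_field_derivative exp (w * complex_of_real x)) (at (complex_of_real x))"
        using w0 by (auto intro!: derivative_eq_intros)
      from has_vector_derivative_real_field[OF this] show ?thesis .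
    qed
    show "set_integrable lborel (einterval 0 \<infinity>) (\<lambda>x. exp (w * complex_of_real x))"
      using si by (simp add: zero_ereal_def)
    have "((\<lambda>x. exp (w * complex_of_real x) / w) \<longlongrightarrow> exp (w * complex_of_real 0) / w) (at_right 0)"
      using w0 by (intro tendsto_intros) auto
    then show "(((\<lambda>x. exp (w * complex_of_real x) / w) \<circ> real_of_ereal) \<longlongrightarrow> 1 / w) (at_right 0)"
      by (simp add: zero_ereal_def ereal_tendsto_simps)
    have "((\<lambda>x. exp (Re w * x) / cmod w) \<longlongrightarrow> 0) at_top"
      using tendsto_divide[OF exp_decay_tendsto[of "- Re w"] tendsto_const[of "cmod w"]] w w0 by simp
    then have "((\<lambda>x. exp (w * complex_of_real x) / w) \<longlongrightarrow> 0) at_top"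
      by (subst tendsto_norm_zero_iff[symmetric]) (simp add: norm_divide)
    then show "(((\<lambda>x. exp (w * complex_of_real x) / w) \<circ> real_of_ereal) \<longlongrightarrow> 0) (at_left \<infinity>)"
      by (simp add: ereal_tendsto_simps)
  qed (auto intro!: continuous_intros)
  also have "(LBINT x=0..\<infinity>. exp (w * complex_of_real x)) = (LBINT x:{0<..}. exp (w * complex_of_real x))"
    by (simp add: interval_lebesgue_integral_le_eq zero_ereal_def)
  also have "\<dots> = (\<integral>x. indicator {0..} x *\<^sub>R exp (w * complex_of_real x) \<partial>lborel)"
    unfolding set_lebesgue_integral_def
  proof (rule integral_cong_AE)
    show "AE x in lborel. indicator {0<..} x *\<^sub>R exp (w * complex_of_real x) = indicator {0..} x *\<^sub>R exp (w * complex_of_real x)"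
      using AE_lborel_singleton[of 0] by eventually_elim (auto simp: indicator_def)
  qed auto
  finally show ?thesis using w0 by (simp add: w_def field_simps)
qed

text \<open>Let \<open>T\<close> be exponential of rate \<open>x\<close> and independent of \<open>S\<close>. The left-hand side is the expectation of
  \<open>exp (z (L T))\<close>. Since \<open>a < L T\<close> and \<open>S a < T\<close> agree up to null sets, the probability of \<open>a < L T\<close> is
  the expectation of \<open>exp (- x (S a))\<close>, that is \<open>exp (- a (\<Phi> x))\<close>. So \<open>L T\<close> is exponential of rate \<open>\<Phi> x\<close>.\<close>

lemma laplace_e:
  assumes "0 < x" "Re z \<le> 0"
  shows "(\<integral>t. indicator {0..} t *\<^sub>R (complex_of_real (x * exp (- x * t)) * e t z) \<partial>lborel)
    = complex_of_real (\<Phi> x) / (complex_of_real (\<Phi> x) - z)"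
proof -
  define T where "T = density lborel (\<lambda>t. ennreal (exponential_density x t))"
  interpret T: prob_space T
    unfolding T_def by (rule prob_space_exponential_density[OF assms(1)])
  interpret TM: pair_prob_space T M ..
  have \<Phi>: "0 < \<Phi> x" by (rule laplace_exponent_pos[OF levy assms(1)])
  have sT [measurable_cong]: "sets T = sets borel" by (simp add: T_def)
  have L_pair [measurable]: "(\<lambda>p. L (fst p) (snd p)) \<in> borel_measurable (T \<Otimes>\<^sub>M M)"
    using L_measurable_pair unfolding case_prod_beta by measurable
  have T_ge: "emeasure T {t. a \<le> t} = ennreal (exp (- x * a))" "emeasure T {t. a < t} = ennreal (exp (- x * a))"
    if "0 \<le> a" for a
  proof -
    have "(\<integral>\<^sup>+t. ennreal (exponential_density x t) * indicator {a..} t \<partial>lborel) = ennreal (0 - (- exp (- x * a)))"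
    proof -
      have "(\<integral>\<^sup>+t. ennreal (exponential_density x t) * indicator {a..} t \<partial>lborel)
          = (\<integral>\<^sup>+t. ennreal (x * exp (- x * t)) * indicator {a..} t \<partial>lborel)"
        using that by (intro nn_integral_cong) (auto simp: exponential_density_def indicator_def mult.commute)
      also have "\<dots> = ennreal (0 - (- exp (- x * a)))"
      proof (rule nn_integral_FTC_atLeast)
        show "((\<lambda>t. - exp (- x * t)) \<longlongrightarrow> 0) at_top"
          using tendsto_minus[OF exp_decay_tendsto[OF assms(1)]] by simp
      qed (use assms in \<open>auto intro!: derivative_eq_intros\<close>)
      finally show ?thesis .
    qed
    then show 1: "emeasure T {t. a \<le> t} = ennreal (exp (- x * a))"
      by (simp add: T_def emeasure_density atLeast_def)
    have "emeasure T {t. a < t} = emeasure T {t. a \<le> t}"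
    proof (rule emeasure_eq_AE)
      have "AE t in lborel. t \<noteq> a" by (rule AE_lborel_singleton)
      then have "AE t in T. t \<noteq> a" unfolding T_def by (subst AE_density) auto
      then show "AE t in T. (t \<in> {t. a < t}) = (t \<in> {t. a \<le> t})" by eventually_elim auto
    qed (auto simp: sT)
    with 1 show "emeasure T {t. a < t} = ennreal (exp (- x * a))" by simp
  qed
  have cdf: "emeasure (T \<Otimes>\<^sub>M M) {p \<in> space (T \<Otimes>\<^sub>M M). a < L (fst p) (snd p)} = ennreal (exp (- a * \<Phi> x))" if a: "0 \<le> a" for a
  proof -
    have [measurable]: "S a \<in> borel_measurable M" by (rule S_measurable[OF a])
    have "emeasure (T \<Otimes>\<^sub>M M) {p \<in> space (T \<Otimes>\<^sub>M M). a < L (fst p) (snd p)}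
        = (\<integral>\<^sup>+\<omega>. emeasure T ((\<lambda>t. (t, \<omega>)) -` {p \<in> space (T \<Otimes>\<^sub>M M). a < L (fst p) (snd p)}) \<partial>M)"
      by (rule TM.emeasure_pair_measure_alt2) measurable
    also have "\<dots> = (\<integral>\<^sup>+\<omega>. ennreal (exp (- x * S a \<omega>)) \<partial>M)"
    proof (rule nn_integral_cong_AE, use AE_regular in eventually_elim)
      case (elim \<omega>)
      have \<omega>: "\<omega> \<in> space M" using elim by (simp add: regular_def)
      have "(\<lambda>t. (t, \<omega>)) -` {p \<in> space (T \<Otimes>\<^sub>M M). a < L (fst p) (snd p)} = {t. a < L t \<omega>}"
        using \<omega> by (auto simp: space_pair_measure T_def)
      also have "emeasure T {t. a < L t \<omega>} = emeasure T {t. S a \<omega> < t}"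
      proof (rule emeasure_eq_AE)
        have 0: "AE t in T. 0 \<le> t"
          unfolding T_def by (subst AE_density) (auto simp: exponential_density_def)
        have "AE t in lborel. t \<noteq> S a \<omega>" by (rule AE_lborel_singleton)
        then have "AE t in T. t \<noteq> S a \<omega>" unfolding T_def by (subst AE_density) auto
        with 0 show "AE t in T. (t \<in> {t. a < L t \<omega>}) = (t \<in> {t. S a \<omega> < t})"
        proof eventually_elim
          case (elim t)
          then show ?case
            using less_L[OF \<open>regular \<omega>\<close> a] S_le_of_less_L[OF \<open>regular \<omega>\<close> a, of t] by fastforce
        qed
        have "(\<lambda>t. L t \<omega>) \<in> borel_measurable borel"
          using measurable_compose[OF measurable_Pair2'[OF \<omega>] L_measurable_pair] by simp
        then show "{t. a < L t \<omega>} \<in> sets T" by (simp add: sT)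
      qed (simp add: sT)
      also have "\<dots> = ennreal (exp (- x * S a \<omega>))"
        by (rule T_ge) (rule S_nonneg[OF \<omega> a])
      finally show ?case .
    qed
    also have "\<dots> = ennreal (exp (- a * \<Phi> x))"
    proof (subst nn_integral_eq_integral)
      show "integrable M (\<lambda>\<omega>. exp (- x * S a \<omega>))"
        using assms S_nonneg a by (intro integrable_const_bound[where B=1] AE_I2) auto
    qed (use S_laplace[OF a, of x] assms in auto)
    finally show ?thesis .
  qed
  have dist: "distributed (T \<Otimes>\<^sub>M M) lborel (\<lambda>p. L (fst p) (snd p)) (exponential_density (\<Phi> x))"
  proof (rule exponential_distributedI[OF L_pair \<Phi>], goal_cases)
    case (1 a)
    then have a: "0 \<le> a" .
    define A where "A = {p \<in> space (T \<Otimes>\<^sub>M M). a < L (fst p) (snd p)}"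
    have A: "A \<in> sets (T \<Otimes>\<^sub>M M)" unfolding A_def by measurable
    have "{p \<in> space (T \<Otimes>\<^sub>M M). L (fst p) (snd p) \<le> a} = space (T \<Otimes>\<^sub>M M) - A"
      by (auto simp: A_def)
    then have "emeasure (T \<Otimes>\<^sub>M M) {p \<in> space (T \<Otimes>\<^sub>M M). L (fst p) (snd p) \<le> a} = 1 - emeasure (T \<Otimes>\<^sub>M M) A"
      using emeasure_compl[OF A] TM.emeasure_space_1 by (simp add: TM.emeasure_finite)
    also have "\<dots> = ennreal (1 - exp (- a * \<Phi> x))"
      using cdf[OF a] by (simp add: A_def ennreal_minus flip: ennreal_1)
    finally have *: "emeasure (T \<Otimes>\<^sub>M M) {p \<in> space (T \<Otimes>\<^sub>M M). L (fst p) (snd p) \<le> a} = ennreal (1 - exp (- a * \<Phi> x))" .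
    then show ?case by (simp add: ennreal_minus flip: ennreal_1)
  qed
  have int: "integrable (T \<Otimes>\<^sub>M M) (\<lambda>(t, \<omega>). exp (z * complex_of_real (L t \<omega>)))"
  proof (rule TM.Fubini_integrable)
    have m: "(\<lambda>t. \<integral>\<omega>. norm (case (t, \<omega>) of (t, \<omega>) \<Rightarrow> exp (z * complex_of_real (L t \<omega>))) \<partial>M) \<in> borel_measurable T"
      by simp
    show "integrable T (\<lambda>t. \<integral>\<omega>. norm (case (t, \<omega>) of (t, \<omega>) \<Rightarrow> exp (z * complex_of_real (L t \<omega>))) \<partial>M)"
    proof (rule T.integrable_const_bound[where B=1, OF AE_I2 m])
      fix t
      show "norm (\<integral>\<omega>. norm (case (t, \<omega>) of (t, \<omega>) \<Rightarrow> exp (z * complex_of_real (L t \<omega>))) \<partial>M) \<le> 1"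
        using er_le_1[of "- Re z" t] er_nonneg[of t "- Re z"] assms by (simp add: er_def)
    qed
    show "AE t in T. integrable M (\<lambda>\<omega>. case (t, \<omega>) of (t, \<omega>) \<Rightarrow> exp (z * complex_of_real (L t \<omega>)))"
      using exp_L_integrable[OF assms(2)] by simp
  qed (simp add: case_prod_beta)
  have "(\<integral>t. e t z \<partial>T) = (\<integral>p. (case p of (t, \<omega>) \<Rightarrow> exp (z * complex_of_real (L t \<omega>))) \<partial>(T \<Otimes>\<^sub>M M))"
    unfolding e_fun_def using TM.integral_fst'[OF int] by simp
  also have "\<dots> = (\<integral>p. exp (z * complex_of_real (L (fst p) (snd p))) \<partial>(T \<Otimes>\<^sub>M M))"
    by (simp add: case_prod_beta)
  also have "\<dots> = (\<integral>r. exponential_density (\<Phi> x) r *\<^sub>R exp (z * complex_of_real r) \<partial>lborel)"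
  proof -
    have "(\<integral>p. exp (z * complex_of_real (L (fst p) (snd p))) \<partial>(T \<Otimes>\<^sub>M M))
        = (\<integral>r. exp (z * complex_of_real r) \<partial>distr (T \<Otimes>\<^sub>M M) lborel (\<lambda>p. L (fst p) (snd p)))"
      by (subst integral_distr) auto
    also have "distr (T \<Otimes>\<^sub>M M) lborel (\<lambda>p. L (fst p) (snd p)) = density lborel (exponential_density (\<Phi> x))"
      by (rule distributed_distr_eq_density[OF dist])
    finally show ?thesis
      using \<Phi> by (simp add: integral_density exponential_density_nonneg)
  qed
  also have "\<dots> = \<Phi> x * (\<integral>r. indicator {0..} r *\<^sub>R exp ((z - complex_of_real (\<Phi> x)) * complex_of_real r) \<partial>lborel)"
    by (subst integral_mult_right_zero[symmetric], intro Bochner_Integration.integral_cong)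
      (auto simp: exponential_density_def indicator_def scaleR_conv_of_real exp_diff exp_minus
        left_diff_distrib field_simps simp flip: exp_of_real)
  also have "\<dots> = complex_of_real (\<Phi> x) / (complex_of_real (\<Phi> x) - z)"
    using integral_exp_decay[of z "\<Phi> x"] assms \<Phi> by simp
  finally have "(\<integral>t. e t z \<partial>T) = complex_of_real (\<Phi> x) / (complex_of_real (\<Phi> x) - z)" .
  also have "(\<integral>t. e t z \<partial>T) = (\<integral>t. exponential_density x t *\<^sub>R e t z \<partial>lborel)"
  proof -
    have [measurable]: "(\<lambda>t. e t z) \<in> borel_measurable borel"
      unfolding e_fun_def
      by (rule borel_measurable_lebesgue_integral) (use L_measurable_pair in \<open>simp add: case_prod_beta\<close>)
    show ?thesis
      unfolding T_def using assms by (intro integral_density) (auto simp: exponential_density_nonneg)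
  qed
  also have "\<dots> = (\<integral>t. indicator {0..} t *\<^sub>R (complex_of_real (x * exp (- x * t)) * e t z) \<partial>lborel)"
    by (intro Bochner_Integration.integral_cong) (auto simp: exponential_density_def indicator_def scaleR_conv_of_real)
  finally show ?thesis by simp
qed

end

section \<open>Convolution and the Laplace transform on the half-line\<close>

definition conv :: "(real \<Rightarrow> complex) \<Rightarrow> (real \<Rightarrow> complex) \<Rightarrow> real \<Rightarrow> complex" where
  "conv a b t = (\<integral>\<tau>. indicator {0..t} \<tau> *\<^sub>R (a (t - \<tau>) * b \<tau>) \<partial>lborel)"

definition locally_integrable :: "(real \<Rightarrow> complex) \<Rightarrow> bool" where
  "locally_integrable K \<longleftrightarrow> (\<forall>T. integrable lborel (\<lambda>x. indicator {0..T} x *\<^sub>R K x))"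

lemma locally_integrable_continuous:
  assumes "continuous_on {0..} b"
  shows "locally_integrable b"
  unfolding locally_integrable_def
  by (auto intro!: borel_integrable_compact intro: continuous_on_subset[OF assms])

lemma conv_commute: "conv a b t = conv b a t"
proof -
  have "conv a b t = (\<integral>\<tau>. indicator {0..t} (t + -1 * \<tau>) *\<^sub>R (a (t - (t + -1 * \<tau>)) * b (t + -1 * \<tau>)) \<partial>lborel)"
    unfolding conv_def by (subst lborel_integral_real_affine[where c="-1" and t=t]) simp_all
  also have "\<dots> = conv b a t"
    unfolding conv_def by (intro Bochner_Integration.integral_cong) (auto simp: indicator_def)
  finally show ?thesis .
qed

lemma conv_cong:
  "(\<And>s. 0 \<le> s \<Longrightarrow> s \<le> t \<Longrightarrow> a s = a' s) \<Longrightarrow> (\<And>s. 0 \<le> s \<Longrightarrow> s \<le> t \<Longrightarrow> b s = b' s) \<Longrightarrow> conv a b t = conv a' b' t"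
  unfolding conv_def by (intro Bochner_Integration.integral_cong) (auto simp: indicator_def)

lemma conv_scale_right: "conv a (\<lambda>s. c * b s) t = c * conv a b t"
  unfolding conv_def by (subst integral_mult_right_zero[symmetric]) (simp add: algebra_simps)

lemma integrable_reflect_real:
  fixes f :: "real \<Rightarrow> complex"
  assumes "integrable lborel f"
  shows "integrable lborel (\<lambda>x. f (t - x))"
  using lborel_integrable_real_affine[OF assms, of "-1" t] by simp

lemma integrable_translate_real:
  fixes f :: "real \<Rightarrow> complex"
  assumes "integrable lborel f"
  shows "integrable lborel (\<lambda>x. f (x - t))"
  using lborel_integrable_real_affine[OF assms, of 1 "-t"] by (simp add: algebra_simps)

lemma integral_reflect_lborel:
  fixes f :: "real \<Rightarrow> complex"
  shows "(\<integral>x. f (t - x) \<partial>lborel) = (\<integral>x. f x \<partial>lborel)"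
  by (subst lborel_integral_real_affine[where c="-1" and t=t and f=f]) simp_all

lemma integral_translate_lborel:
  fixes f :: "real \<Rightarrow> complex"
  shows "(\<integral>x. f (x - t) \<partial>lborel) = (\<integral>x. f x \<partial>lborel)"
  by (subst lborel_integral_real_affine[where c="1" and t="-t" and f=f]) (simp_all add: algebra_simps)

lemma integrable_convolution_pair:
  fixes f g :: "real \<Rightarrow> complex"
  assumes f: "integrable lborel f" and g: "integrable lborel g"
  shows "integrable (lborel \<Otimes>\<^sub>M lborel) (\<lambda>(\<tau>, s). f (s - \<tau>) * g \<tau>)"
proof (rule lborel_pair.Fubini_integrable)
  have [measurable]: "f \<in> borel_measurable borel" "g \<in> borel_measurable borel"
    using f g by auto
  show "(\<lambda>(\<tau>, s). f (s - \<tau>) * g \<tau>) \<in> borel_measurable (lborel \<Otimes>\<^sub>M lborel)"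
    by measurable
  have "(\<integral>s. norm (case (\<tau>, s) of (\<tau>, s) \<Rightarrow> f (s - \<tau>) * g \<tau>) \<partial>lborel) = (\<integral>s. norm (f s) \<partial>lborel) * norm (g \<tau>)" for \<tau>
  proof -
    have "(\<integral>s. norm (f (s - \<tau>)) \<partial>lborel) = (\<integral>s. norm (f s) \<partial>lborel)"
      by (subst lborel_integral_real_affine[where c="1" and t="-\<tau>" and f="\<lambda>s. norm (f s)"]) (simp_all add: algebra_simps)
    then show ?thesis by (simp add: norm_mult)
  qed
  then show "integrable lborel (\<lambda>\<tau>. \<integral>s. norm (case (\<tau>, s) of (\<tau>, s) \<Rightarrow> f (s - \<tau>) * g \<tau>) \<partial>lborel)"
    using g by simp
  show "AE \<tau> in lborel. integrable lborel (\<lambda>s. case (\<tau>, s) of (\<tau>, s) \<Rightarrow> f (s - \<tau>) * g \<tau>)"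
    using integrable_translate_real[OF f] by simp
qed

lemma integral_convolution:
  fixes f g :: "real \<Rightarrow> complex"
  assumes f: "integrable lborel f" and g: "integrable lborel g"
  shows "has_bochner_integral lborel (\<lambda>s. \<integral>\<tau>. f (s - \<tau>) * g \<tau> \<partial>lborel) ((\<integral>x. f x \<partial>lborel) * (\<integral>x. g x \<partial>lborel))"
proof -
  note I = integrable_convolution_pair[OF f g]
  have "integrable lborel (\<lambda>s. \<integral>\<tau>. f (s - \<tau>) * g \<tau> \<partial>lborel)"
    using lborel_pair.integrable_snd[OF I] by simp
  moreover have "(\<integral>s. (\<integral>\<tau>. f (s - \<tau>) * g \<tau> \<partial>lborel) \<partial>lborel) = (\<integral>\<tau>. (\<integral>s. f (s - \<tau>) * g \<tau> \<partial>lborel) \<partial>lborel)"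
    using lborel_pair.Fubini_integral[OF I] by simp
  moreover have "\<dots> = (\<integral>x. f x \<partial>lborel) * (\<integral>x. g x \<partial>lborel)"
    by (simp add: integral_translate_lborel)
  ultimately show ?thesis by (simp add: has_bochner_integral_iff)
qed

text \<open>Associativity and commutativity of the convolution, combined. The kernel \<open>K\<close> may be unbounded, as the
  tail of a Levy measure is at \<open>0\<close>; Fubini's theorem applies after all functions are cut off outside
  \<open>[0, t]\<close>.\<close>

lemma conv_swap:
  assumes a: "continuous_on {0..} a" and b: "continuous_on {0..} b" and K: "locally_integrable K"
  shows "conv a (conv K b) t = conv b (conv K a) t"
proof -
  define cut where "cut f x = indicator {0..t} x *\<^sub>R f x" for f :: "real \<Rightarrow> complex" and x :: real
  have int: "integrable lborel (cut a)" "integrable lborel (cut b)" "integrable lborel (cut K)"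
    using K locally_integrable_continuous[OF a] locally_integrable_continuous[OF b]
    by (auto simp: cut_def[abs_def] locally_integrable_def)
  have eq: "conv f (conv K g) t = (\<integral>s. (\<integral>\<tau>. cut f (t - s) * (cut K (s - \<tau>) * cut g \<tau>) \<partial>lborel) \<partial>lborel)" for f g
    unfolding conv_def
  proof (rule Bochner_Integration.integral_cong[OF refl])
    fix s :: real
    show "indicator {0..t} s *\<^sub>R (f (t - s) * (\<integral>\<tau>. indicator {0..s} \<tau> *\<^sub>R (K (s - \<tau>) * g \<tau>) \<partial>lborel))
        = (\<integral>\<tau>. cut f (t - s) * (cut K (s - \<tau>) * cut g \<tau>) \<partial>lborel)"
    proof (cases "s \<in> {0..t}")
      case True
      then have "(\<integral>\<tau>. indicator {0..s} \<tau> *\<^sub>R (K (s - \<tau>) * g \<tau>) \<partial>lborel) = (\<integral>\<tau>. cut K (s - \<tau>) * cut g \<tau> \<partial>lborel)"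
        by (intro Bochner_Integration.integral_cong) (auto simp: cut_def indicator_def)
      moreover have "cut f (t - s) = f (t - s)" using True by (simp add: cut_def)
      ultimately show ?thesis using True by (simp add: integral_mult_right_zero)
    next
      case False
      then have "cut f (t - s) = 0" by (auto simp: cut_def)
      with False show ?thesis by simp
    qed
  qed
  obtain A where A: "\<And>x. norm (cut a x) \<le> A"
  proof -
    obtain A where A: "\<And>x. x \<in> {0..t} \<Longrightarrow> norm (a x) \<le> A"
      by (rule continuous_Icc_bound[of 0 t a]) (auto intro: continuous_on_subset[OF a])
    have "norm (cut a x) \<le> max A 0" for x using A[of x] by (auto simp: cut_def indicator_def)
    then show thesis by (rule that)
  qed
  have [measurable]: "cut a \<in> borel_measurable borel" "cut b \<in> borel_measurable borel" "cut K \<in> borel_measurable borel"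
    using int by auto
  have I: "integrable (lborel \<Otimes>\<^sub>M lborel) (\<lambda>(\<tau>, s). cut a (t - s) * (cut K (s - \<tau>) * cut b \<tau>))"
  proof (rule Bochner_Integration.integrable_bound)
    show "integrable (lborel \<Otimes>\<^sub>M lborel) (\<lambda>p. complex_of_real A * (case p of (\<tau>, s) \<Rightarrow> cut K (s - \<tau>) * cut b \<tau>))"
      by (intro integrable_mult_right integrable_convolution_pair int)
    have "0 \<le> A" using A[of 0] norm_ge_zero order_trans by blast
    then show "AE p in lborel \<Otimes>\<^sub>M lborel. norm (case p of (\<tau>, s) \<Rightarrow> cut a (t - s) * (cut K (s - \<tau>) * cut b \<tau>))
        \<le> norm (complex_of_real A * (case p of (\<tau>, s) \<Rightarrow> cut K (s - \<tau>) * cut b \<tau>))"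
      using A by (auto simp: norm_mult intro!: AE_I2 mult_right_mono)
  qed measurable
  have "conv a (conv K b) t = (\<integral>\<tau>. (\<integral>s. cut a (t - s) * (cut K (s - \<tau>) * cut b \<tau>) \<partial>lborel) \<partial>lborel)"
    unfolding eq using lborel_pair.Fubini_integral[OF I] by simp
  also have "\<dots> = (\<integral>\<tau>. (\<integral>\<sigma>. cut b \<tau> * (cut K ((t - \<tau>) - \<sigma>) * cut a \<sigma>) \<partial>lborel) \<partial>lborel)"
  proof (rule Bochner_Integration.integral_cong[OF refl])
    fix \<tau> :: real
    have "(\<integral>s. cut a (t - s) * (cut K (s - \<tau>) * cut b \<tau>) \<partial>lborel)
        = (\<integral>\<sigma>. cut a (t - (t - \<sigma>)) * (cut K ((t - \<sigma>) - \<tau>) * cut b \<tau>) \<partial>lborel)"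
      by (rule integral_reflect_lborel[symmetric])
    also have "\<dots> = (\<integral>\<sigma>. cut b \<tau> * (cut K ((t - \<tau>) - \<sigma>) * cut a \<sigma>) \<partial>lborel)"
      by (intro Bochner_Integration.integral_cong) (simp_all add: algebra_simps)
    finally show "(\<integral>s. cut a (t - s) * (cut K (s - \<tau>) * cut b \<tau>) \<partial>lborel)
      = (\<integral>\<sigma>. cut b \<tau> * (cut K ((t - \<tau>) - \<sigma>) * cut a \<sigma>) \<partial>lborel)" .
  qed
  also have "\<dots> = (\<integral>s. (\<integral>\<sigma>. cut b (t - s) * (cut K (s - \<sigma>) * cut a \<sigma>) \<partial>lborel) \<partial>lborel)"
    by (subst integral_reflect_lborel[symmetric, where t=t]) simp
  also have "\<dots> = conv b (conv K a) t" unfolding eq ..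
  finally show ?thesis .
qed

lemma conv_one:
  assumes "continuous_on {0..} b"
  shows "conv (\<lambda>_. 1) b t = integral {0..t} b"
proof -
  have "set_integrable lborel {0..t} b"
    using locally_integrable_continuous[OF assms] by (simp add: locally_integrable_def set_integrable_def)
  from set_borel_integral_eq_integral(2)[OF this] show ?thesis
    by (simp add: conv_def set_lebesgue_integral_def)
qed

lemma conv_one_deriv:
  assumes b: "continuous_on {0..} b" and t: "0 < t"
  shows "(conv (\<lambda>_. 1) b has_vector_derivative b t) (at t)"
proof -
  have "((\<lambda>u. integral {0..u} b) has_vector_derivative b t) (at t within {0..t+1})"
    using t by (intro integral_has_vector_derivative continuous_on_subset[OF b]) auto
  then have "((\<lambda>u. integral {0..u} b) has_vector_derivative b t) (at t)"
    using t at_within_interior[of t "{0..t+1}"] by (simp add: interior_atLeastAtMost_real)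
  then show ?thesis
    unfolding conv_one[OF b, abs_def] .
qed

lemma conv_one_continuous:
  assumes b: "continuous_on {0..} b"
  shows "continuous_on {0..} (conv (\<lambda>_. 1) b)"
proof -
  have "continuous_on {0..T} (\<lambda>t. integral {0..t} b)" for T
    by (intro indefinite_integral_continuous_1 integrable_continuous_interval continuous_on_subset[OF b]) auto
  then have *: "continuous_on {0..T} (conv (\<lambda>_. 1) b)" for T
    by (simp add: conv_one[OF b])
  show ?thesis
  proof (rule continuous_on_eq_continuous_within[THEN iffD2], rule ballI)
    fix t :: real assume "t \<in> {0..}"
    then have "continuous (at t within {0..t+1}) (conv (\<lambda>_. 1) b)"
      using *[of "t+1"] by (simp add: continuous_on_eq_continuous_within)
    moreover have "at t within {0..} = at t within {0..t+1}"
      by (rule at_within_nhd[of t "{..<t+1}"]) auto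
    ultimately show "continuous (at t within {0..}) (conv (\<lambda>_. 1) b)"
      by (simp add: continuous_within)
  qed
qed

lemma conv_one_eq_zero:
  assumes b: "continuous_on {0..} b" and z: "\<And>t. 0 \<le> t \<Longrightarrow> conv (\<lambda>_. 1) b t = 0" and "0 \<le> t"
  shows "b t = 0"
proof -
  have pos: "b t = 0" if "0 < t" for t
  proof -
    have "(conv (\<lambda>_. 1) b has_vector_derivative 0) (at t)"
      by (rule has_vector_derivative_transform_within[OF has_vector_derivative_const[of 0] that])
        (use z in \<open>auto simp: dist_real_def\<close>)
    then show ?thesis
      using conv_one_deriv[OF b that] vector_derivative_unique_at by blast
  qed
  show ?thesis
  proof (cases "t = 0")
    case True
    have "(b \<longlongrightarrow> b 0) (at 0 within {0..})" using b by (simp add: continuous_on_def)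
    then have "(b \<longlongrightarrow> b 0) (at_right 0)" by (rule tendsto_within_subset) auto
    moreover have "(b \<longlongrightarrow> 0) (at_right 0)"
      by (rule tendsto_eventually) (auto simp: eventually_at_filter pos)
    ultimately show ?thesis using True tendsto_unique trivial_limit_at_right_real by blast
  qed (use assms pos in auto)
qed

text \<open>Because \<open>h 0 = 0\<close>, the function \<open>h\<close> extends continuously to negative arguments by \<open>0\<close>, and the
  convolution becomes an integral over a domain that does not depend on \<open>t\<close>. Dominated convergence then
  applies even though \<open>K\<close> is unbounded.\<close>

lemma conv_continuous:
  assumes K: "locally_integrable K" and h: "continuous_on {0..} h" and h0: "h 0 = 0"
  shows "continuous_on {0..} (conv K h)"
proof -
  define h' where "h' x = h (max 0 x)" for x
  have h'c: "continuous_on UNIV h'"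
    unfolding h'_def by (intro continuous_on_compose2[OF h] continuous_intros) auto
  have [measurable]: "h' \<in> borel_measurable borel"
    by (rule borel_measurable_continuous_onI[OF h'c])
  have eq: "conv K h t = (\<integral>x. indicator {0..T} x *\<^sub>R (h' (t - x) * K x) \<partial>lborel)" if "t \<le> T" for t T
  proof -
    have "conv K h t = (\<integral>x. indicator {0..t} x *\<^sub>R (h (t - x) * K x) \<partial>lborel)"
      by (subst conv_commute) (simp add: conv_def)
    also have "\<dots> = (\<integral>x. indicator {0..T} x *\<^sub>R (h' (t - x) * K x) \<partial>lborel)"
      using that h0 by (intro Bochner_Integration.integral_cong) (auto simp: indicator_def h'_def max_def)
    finally show ?thesis .
  qed
  have "(conv K h \<longlongrightarrow> conv K h t) (at t within {0..})" if "t \<in> {0..}" for t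
  proof (rule tendsto_at_iff_sequentially[THEN iffD2], intro allI impI)
    fix X :: "nat \<Rightarrow> real"
    assume X: "\<forall>i. X i \<in> {0..} - {t}" "X \<longlonglongrightarrow> t"
    obtain T where T: "\<And>i. X i \<le> T" "t \<le> T"
    proof -
      obtain T where "\<And>i. norm (X i) \<le> T"
        using convergent_imp_Bseq[OF convergentI[OF X(2)]] by (auto simp: Bseq_def)
      then have "\<And>i. X i \<le> T" by (metis abs_le_D1 real_norm_def)
      then have "\<And>i. X i \<le> max T t" by (simp add: le_max_iff_disj)
      then show thesis using that[of "max T t"] by auto
    qed
    obtain B where B: "\<And>x. x \<le> T \<Longrightarrow> norm (h' x) \<le> B"
    proof -
      obtain B where B: "\<And>x. x \<in> {0..max 0 T} \<Longrightarrow> norm (h x) \<le> B"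
        by (rule continuous_Icc_bound[of 0 "max 0 T" h]) (auto intro: continuous_on_subset[OF h])
      show thesis by (rule that[of B]) (use B in \<open>auto simp: h'_def\<close>)
    qed
    have Ki: "integrable lborel (\<lambda>x. indicator {0..T} x *\<^sub>R K x)"
      using K by (simp add: locally_integrable_def)
    then have [measurable]: "(\<lambda>x. indicator {0..T} x *\<^sub>R K x) \<in> borel_measurable borel" by auto
    have sw: "indicator {0..T} x *\<^sub>R (h' (s - x) * K x) = h' (s - x) * (indicator {0..T} x *\<^sub>R K x)" for s x
      by simp
    have "(\<lambda>i. \<integral>x. indicator {0..T} x *\<^sub>R (h' (X i - x) * K x) \<partial>lborel) \<longlonglongrightarrow> (\<integral>x. indicator {0..T} x *\<^sub>R (h' (t - x) * K x) \<partial>lborel)"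
      unfolding sw
    proof (rule integral_dominated_convergence[where w="\<lambda>x. B * norm (indicator {0..T} x *\<^sub>R K x)"])
      show "integrable lborel (\<lambda>x. B * norm (indicator {0..T} x *\<^sub>R K x))"
        by (intro integrable_mult_right integrable_norm Ki)
      show "AE x in lborel. (\<lambda>i. h' (X i - x) * (indicator {0..T} x *\<^sub>R K x)) \<longlonglongrightarrow> h' (t - x) * (indicator {0..T} x *\<^sub>R K x)"
      proof (intro AE_I2 tendsto_mult tendsto_const)
        fix x :: real
        have "isCont h' (t - x)" using h'c by (simp add: continuous_on_eq_continuous_at)
        then show "(\<lambda>i. h' (X i - x)) \<longlonglongrightarrow> h' (t - x)"
          by (rule isCont_tendsto_compose) (intro tendsto_diff X tendsto_const)
      qed
      show "AE x in lborel. norm (h' (X i - x) * (indicator {0..T} x *\<^sub>R K x)) \<le> B * norm (indicator {0..T} x *\<^sub>R K x)" for i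
      proof (rule AE_I2)
        fix x
        show "norm (h' (X i - x) * (indicator {0..T} x *\<^sub>R K x)) \<le> B * norm (indicator {0..T} x *\<^sub>R K x)"
        proof (cases "x \<in> {0..T}")
          case True
          then have "norm (h' (X i - x)) \<le> B" using T(1)[of i] by (intro B) auto
          then show ?thesis unfolding norm_mult by (intro mult_right_mono) auto
        qed simp
      qed
    qed measurable
    then show "(conv K h \<circ> X) \<longlonglongrightarrow> conv K h t"
      unfolding comp_def eq[OF T(1)] eq[OF T(2)] .
  qed
  then show ?thesis by (simp add: continuous_on_def)
qed

definition has_laplace :: "(real \<Rightarrow> complex) \<Rightarrow> real \<Rightarrow> complex \<Rightarrow> bool" where
  "has_laplace g x y \<longleftrightarrow>
    has_bochner_integral lborel (\<lambda>t. indicator {0..} t *\<^sub>R (complex_of_real (exp (- x * t)) * g t)) y"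

lemma has_laplace_add:
  assumes "has_laplace f x p" "has_laplace g x q"
  shows "has_laplace (\<lambda>t. f t + g t) x (p + q)"
  using has_bochner_integral_add[OF assms[unfolded has_laplace_def]]
  by (simp add: has_laplace_def distrib_left scaleR_add_right)

lemma has_laplace_diff:
  assumes "has_laplace f x p" "has_laplace g x q"
  shows "has_laplace (\<lambda>t. f t - g t) x (p - q)"
  using has_bochner_integral_diff[OF assms[unfolded has_laplace_def]]
  by (simp add: has_laplace_def right_diff_distrib scaleR_diff_right)

lemma has_laplace_cmult:
  assumes "has_laplace f x p"
  shows "has_laplace (\<lambda>t. c * f t) x (c * p)"
  using has_bochner_integral_mult_right[where c=c, OF assms[unfolded has_laplace_def]]
  by (simp add: has_laplace_def ac_simps)

lemma has_laplace_conv: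
  assumes K: "has_laplace K x p" and b: "has_laplace b x q"
  shows "has_laplace (conv K b) x (p * q)"
proof -
  define w where "w g t = indicator {0..} t *\<^sub>R (complex_of_real (exp (- x * t)) * g t)" for g :: "real \<Rightarrow> complex" and t
  have "w (conv K b) t = (\<integral>\<tau>. w K (t - \<tau>) * w b \<tau> \<partial>lborel)" for t
  proof (cases "0 \<le> t")
    case True
    have "w (conv K b) t = (\<integral>\<tau>. complex_of_real (exp (- x * t)) * (indicator {0..t} \<tau> *\<^sub>R (K (t - \<tau>) * b \<tau>)) \<partial>lborel)"
      using True unfolding w_def conv_def integral_mult_right_zero by simp
    also have "\<dots> = (\<integral>\<tau>. w K (t - \<tau>) * w b \<tau> \<partial>lborel)"
    proof (rule Bochner_Integration.integral_cong[OF refl])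
      fix \<tau> :: real
      have "complex_of_real (exp (- x * t)) = complex_of_real (exp (- x * (t - \<tau>))) * complex_of_real (exp (- x * \<tau>))"
        unfolding of_real_mult[symmetric] exp_add[symmetric] by (simp add: algebra_simps)
      then show "complex_of_real (exp (- x * t)) * (indicator {0..t} \<tau> *\<^sub>R (K (t - \<tau>) * b \<tau>)) = w K (t - \<tau>) * w b \<tau>"
        by (auto simp: w_def indicator_def)
    qed
    finally show ?thesis .
  next
    case False
    then have "w K (t - \<tau>) * w b \<tau> = 0" for \<tau> by (auto simp: w_def indicator_def)
    then show ?thesis using False by (simp only: integral_zero) (simp add: w_def)
  qed
  then show ?thesis
    using integral_convolution[of "w K" "w b"] K b
    unfolding has_laplace_def w_def[symmetric] by (simp add: has_bochner_integral_iff)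
qed

text \<open>Lerch's theorem. In the variable \<open>x = exp (- t)\<close>, the hypothesis says that \<open>exp (- 2 t) (g t)\<close> is
  orthogonal to all polynomials in \<open>x\<close>; by the Weierstrass approximation theorem it is orthogonal to all
  continuous functions of \<open>x\<close>, and one of these is chosen so that the integrand is a positive multiple of
  \<open>(g t)\<^sup>2\<close>. The weight \<open>exp (- 2 t)\<close> compensates for the growth of \<open>g\<close>.\<close>

lemma real_laplace_injective:
  fixes g :: "real \<Rightarrow> real"
  assumes cont: "continuous_on {0..} g" and bound: "\<And>t. 0 \<le> t \<Longrightarrow> \<bar>g t\<bar> \<le> C * exp t"
    and zero: "\<And>n::nat. (\<integral>t. indicator {0..} t *\<^sub>R (exp (- real (n + 2) * t) * g t) \<partial>lborel) = 0"
    and "0 \<le> t"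
  shows "g t = 0"
proof -
  have C0: "0 \<le> C" using bound[of 0] by simp
  have [measurable]: "(\<lambda>t. indicator {0..} t *\<^sub>R g t) \<in> borel_measurable borel"
    by (subst borel_measurable_restrict_space_iff[symmetric])
      (auto intro: borel_measurable_continuous_on_restrict cont)
  have expint: "integrable lborel (\<lambda>t::real. indicator {0..} t *\<^sub>R exp (- t))"
    using integrable_exp_decay[of 1] by simp
  have ind: "indicator {0..} t *\<^sub>R (a * g t) = a * (indicator {0..} t *\<^sub>R g t)" for a t by simp
  define F where "F p t = indicator {0..} t *\<^sub>R (p (exp (- t)) * (exp (- 2 * t) * g t))" for p :: "real \<Rightarrow> real" and t
  have F_int: "integrable lborel (F p)" if p: "continuous_on {0..1} p" for p
  proof -
    obtain B where B: "\<And>x. x \<in> {0..1} \<Longrightarrow> \<bar>p x\<bar> \<le> B"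
      using continuous_Icc_bound[OF p] by (metis real_norm_def)
    have m: "(\<lambda>t. indicator {0..} t *\<^sub>R p (exp (- t))) \<in> borel_measurable borel"
      by (subst borel_measurable_restrict_space_iff[symmetric])
        (auto intro!: borel_measurable_continuous_on_restrict continuous_on_compose2[OF p] continuous_intros)
    have Feq: "F p = (\<lambda>t. (indicator {0..} t *\<^sub>R p (exp (- t))) * (exp (- 2 * t) * (indicator {0..} t *\<^sub>R g t)))"
      by (auto simp: F_def indicator_def)
    show ?thesis
    proof (rule Bochner_Integration.integrable_bound[OF integrable_mult_right[OF expint, of "B * C"]])
      show "F p \<in> borel_measurable lborel" unfolding Feq using m by measurable
      show "AE t in lborel. norm (F p t) \<le> norm (B * C * (indicator {0..} t *\<^sub>R exp (- t)))"
      proof (rule AE_I2)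
        fix t :: real
        show "norm (F p t) \<le> norm (B * C * (indicator {0..} t *\<^sub>R exp (- t)))"
        proof (cases "0 \<le> t")
          case True
          have "0 \<le> B" using B[of 0] by simp
          then have "\<bar>p (exp (- t))\<bar> * (exp (- 2 * t) * \<bar>g t\<bar>) \<le> B * (exp (- 2 * t) * (C * exp t))"
            using True by (intro mult_mono B bound) auto
          also have "\<dots> = B * C * exp (- t)"
            using exp_add[of "-2 * t" t] by simp
          finally show ?thesis using True C0 \<open>0 \<le> B\<close> by (simp add: F_def abs_mult)
        qed (simp add: F_def)
      qed
    qed
  qed
  have F_poly: "integral\<^sup>L lborel (F p) = 0" if "real_polynomial_function p" for p
  proof -
    obtain a n where p: "p = (\<lambda>x. \<Sum>i\<le>n. a i * x ^ i)"
      using \<open>real_polynomial_function p\<close> real_polynomial_function_iff_sum by metis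
    have Fi: "F (\<lambda>x. x ^ i) t = indicator {0..} t *\<^sub>R (exp (- real (i + 2) * t) * g t)" for i t
    proof -
      have "exp (- t) ^ i * exp (- 2 * t) = exp (- real (i + 2) * t)"
        by (simp add: exp_of_nat_mult[symmetric] exp_add[symmetric] algebra_simps)
      then show ?thesis by (simp add: F_def mult.assoc[symmetric])
    qed
    have "F p = (\<lambda>t. \<Sum>i\<le>n. a i * F (\<lambda>x. x ^ i) t)"
      unfolding p F_def by (auto simp: fun_eq_iff sum_distrib_right sum_distrib_left ac_simps indicator_def)
    moreover have "integral\<^sup>L lborel (F (\<lambda>x. x ^ i)) = 0" for i
      unfolding Fi[abs_def] by (rule zero)
    moreover have "integrable lborel (F (\<lambda>x. x ^ i))" for i
      by (intro F_int continuous_intros)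
    ultimately show ?thesis by simp
  qed
  \<comment> \<open>The test function that turns \<^term>\<open>F p\<close> into \<open>exp (- 4 t) (g t)\<^sup>2\<close>; it extends continuously to \<open>0\<close>.\<close>
  define p where "p x = (if x = 0 then 0 else x\<^sup>2 * g (- ln x))" for x
  have p_cont: "continuous_on {0..1} p"
  proof -
    have "(p \<longlongrightarrow> p x) (at x within {0..1})" if "x \<in> {0..1}" for x
    proof (cases "x = 0")
      case True
      have "(p \<longlongrightarrow> 0) (at 0 within {0..1})"
      proof (rule Lim_null_comparison)
        show "\<forall>\<^sub>F y in at 0 within {0..1}. norm (p y) \<le> C * y"
          unfolding eventually_at_filter
        proof (intro always_eventually allI impI)
          fix y :: real assume y: "y \<noteq> 0" "y \<in> {0..1}"
          have "\<bar>g (- ln y)\<bar> \<le> C * exp (- ln y)" using y by (intro bound) auto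
          then have "y\<^sup>2 * \<bar>g (- ln y)\<bar> \<le> y\<^sup>2 * (C * exp (- ln y))" by (intro mult_left_mono) auto
          also have "\<dots> = C * y" using y by (simp add: exp_minus power2_eq_square)
          finally show "norm (p y) \<le> C * y" using y by (simp add: p_def abs_mult)
        qed
        have "((\<lambda>y. C * y) \<longlongrightarrow> C * 0) (at 0 within {0..1})" by (intro tendsto_intros)
        then show "((\<lambda>y. C * y) \<longlongrightarrow> 0) (at 0 within {0..1})" by simp
      qed
      then show ?thesis using True by (simp add: p_def)
    next
      case False
      have "continuous_on {0<..1} (\<lambda>x. x\<^sup>2 * g (- ln x))"
        by (intro continuous_intros continuous_on_compose2[OF cont]) auto
      then have "((\<lambda>x. x\<^sup>2 * g (- ln x)) \<longlongrightarrow> x\<^sup>2 * g (- ln x)) (at x within {0<..1})"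
        using False that by (simp add: continuous_on_def)
      moreover have "at x within {0<..1} = at x within {0..1}"
        using False that by (intro at_within_nhd[of x "{0<..}"]) auto
      ultimately have *: "((\<lambda>x. x\<^sup>2 * g (- ln x)) \<longlongrightarrow> p x) (at x within {0..1})"
        using False by (simp add: p_def)
      have "\<forall>\<^sub>F y in at x within {0..1}. x\<^sup>2 * g (- ln x) = x\<^sup>2 * g (- ln x) \<and> y \<noteq> 0"
        using False by (auto simp: eventually_at_filter intro!: eventually_mono[OF t1_space_nhds[of x 0]])
      then have "\<forall>\<^sub>F y in at x within {0..1}. y\<^sup>2 * g (- ln y) = p y"
        by eventually_elim (simp add: p_def)
      from tendsto_cong[THEN iffD1, OF this *] show ?thesis .
    qed
    then show ?thesis by (simp add: continuous_on_def)
  qed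
  have small: "\<bar>integral\<^sup>L lborel (F p)\<bar> \<le> \<epsilon> * (C * (\<integral>t. indicator {0..} t *\<^sub>R exp (- t) \<partial>lborel))" if "0 < \<epsilon>" for \<epsilon>
  proof -
    obtain q where q: "real_polynomial_function q" "\<And>x. x \<in> {0..1} \<Longrightarrow> \<bar>p x - q x\<bar> < \<epsilon>"
      using Stone_Weierstrass_real_polynomial_function[OF _ p_cont \<open>0 < \<epsilon>\<close>] by auto
    have qc: "continuous_on {0..1} q"
      using q(1) by (simp add: continuous_on_polymonial_function real_polynomial_function_eq)
    have "integral\<^sup>L lborel (F p) = integral\<^sup>L lborel (F p) - integral\<^sup>L lborel (F q)"
      using F_poly[OF q(1)] by simp
    also have "\<dots> = (\<integral>t. F p t - F q t \<partial>lborel)"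
      using F_int[OF p_cont] F_int[OF qc] by simp
    also have "\<bar>\<dots>\<bar> \<le> (\<integral>t. \<bar>F p t - F q t\<bar> \<partial>lborel)"
      using integral_norm_bound[of lborel "\<lambda>t. F p t - F q t"] by simp
    also have "\<dots> \<le> (\<integral>t. \<epsilon> * (C * (indicator {0..} t *\<^sub>R exp (- t))) \<partial>lborel)"
    proof (rule integral_mono)
      show "integrable lborel (\<lambda>t. \<bar>F p t - F q t\<bar>)"
        using F_int[OF p_cont] F_int[OF qc] by auto
      show "integrable lborel (\<lambda>t. \<epsilon> * (C * (indicator {0..} t *\<^sub>R exp (- t))))"
        using expint by (intro integrable_mult_right)
      fix t :: real
      show "\<bar>F p t - F q t\<bar> \<le> \<epsilon> * (C * (indicator {0..} t *\<^sub>R exp (- t)))"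
      proof (cases "0 \<le> t")
        case True
        have "F p t - F q t = (p (exp (- t)) - q (exp (- t))) * (exp (- 2 * t) * g t)"
          using True by (simp add: F_def left_diff_distrib)
        then have "\<bar>F p t - F q t\<bar> = \<bar>p (exp (- t)) - q (exp (- t))\<bar> * (exp (- 2 * t) * \<bar>g t\<bar>)"
          by (simp add: abs_mult)
        also have "\<dots> \<le> \<epsilon> * (exp (- 2 * t) * (C * exp t))"
          using True q(2)[of "exp (- t)"] bound[of t] \<open>0 < \<epsilon>\<close> by (intro mult_mono) auto
        also have "\<dots> = \<epsilon> * (C * exp (- t))"
          using exp_add[of "-2 * t" t] by simp
        finally show ?thesis using True by simp
      qed (simp add: F_def)
    qed
    also have "\<dots> = \<epsilon> * (C * (\<integral>t. indicator {0..} t *\<^sub>R exp (- t) \<partial>lborel))"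
      by simp
    finally show ?thesis .
  qed
  have Fp: "F p t = indicator {0..} t *\<^sub>R (exp (- 4 * t) * (g t)\<^sup>2)" for t
  proof (cases "0 \<le> t")
    case True
    have "exp (- 4 * t) = (exp (- t))\<^sup>2 * exp (- 2 * t)"
      by (simp add: power2_eq_square exp_add[symmetric])
    then show ?thesis using True by (simp add: F_def p_def power2_eq_square)
  qed (simp add: F_def)
  define E where "E = (\<integral>t. indicator {0..} t *\<^sub>R exp (- t) \<partial>lborel :: real)"
  have E0: "0 \<le> E" unfolding E_def by simp
  have "\<bar>integral\<^sup>L lborel (F p)\<bar> \<le> \<delta>" if "0 < \<delta>" for \<delta>
  proof -
    have "\<bar>integral\<^sup>L lborel (F p)\<bar> \<le> \<delta> / (C * E + 1) * (C * E)"
      using small[of "\<delta> / (C * E + 1)"] that C0 E0 by (simp add: E_def add_nonneg_pos)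
    also have "\<dots> \<le> \<delta>"
      using that C0 E0 by (simp add: divide_le_eq add_nonneg_pos mult_left_mono)
    finally show ?thesis .
  qed
  then have I0: "integral\<^sup>L lborel (F p) = 0"
    by (metis abs_le_zero_iff abs_ge_zero dense_ge)
  have "AE t in lborel. F p t = 0"
    using I0 by (subst (asm) integral_nonneg_eq_0_iff_AE[OF F_int[OF p_cont]]) (auto simp: Fp)
  have "integral {0..t + 1} (\<lambda>t. exp (- 4 * t) * (g t)\<^sup>2) = 0"
  proof -
    have c: "continuous_on {0..t + 1} (\<lambda>t. exp (- 4 * t) * (g t)\<^sup>2)"
      by (intro continuous_intros continuous_on_subset[OF cont]) auto
    have si: "set_integrable lborel {0..t + 1} (\<lambda>t. exp (- 4 * t) * (g t)\<^sup>2)"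
      unfolding set_integrable_def by (intro borel_integrable_compact c) auto
    have "integral {0..t + 1} (\<lambda>t. exp (- 4 * t) * (g t)\<^sup>2) = (LBINT t:{0..t + 1}. exp (- 4 * t) * (g t)\<^sup>2)"
      using set_borel_integral_eq_integral(2)[OF si] by simp
    also have "\<dots> = (\<integral>x. 0 \<partial>(lborel :: real measure))"
      unfolding set_lebesgue_integral_def
    proof (rule integral_cong_AE)
      show "AE x in lborel. indicator {0..t + 1} x *\<^sub>R (exp (- 4 * x) * (g x)\<^sup>2) = 0"
        using \<open>AE t in lborel. F p t = 0\<close> by eventually_elim (auto simp: Fp indicator_def)
    qed (use si in \<open>auto simp: set_integrable_def\<close>)
    finally show ?thesis by simp
  qed
  then have "exp (- 4 * t) * (g t)\<^sup>2 = 0"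
    using \<open>0 \<le> t\<close> by (subst (asm) integral_eq_0_iff)
      (auto intro!: continuous_intros continuous_on_subset[OF cont])
  then show ?thesis by simp
qed

lemma laplace_injective:
  assumes cont: "continuous_on {0..} G" and bound: "\<And>t. 0 \<le> t \<Longrightarrow> norm (G t) \<le> C * exp t"
    and zero: "\<And>n::nat. has_laplace G (real (n + 2)) 0" and t: "0 \<le> t"
  shows "G t = 0"
proof -
  have "\<pi> (G t) = 0" if \<pi>: "bounded_linear \<pi>" "\<And>w. \<bar>\<pi> w\<bar> \<le> cmod w" "\<And>r w. \<pi> (complex_of_real r * w) = r * \<pi> w"
    for \<pi> :: "complex \<Rightarrow> real"
  proof (rule real_laplace_injective[OF _ _ _ t, where C=C])
    show "continuous_on {0..} (\<lambda>t. \<pi> (G t))" by (rule bounded_linear.continuous_on[OF \<pi>(1) cont])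
    show "\<bar>\<pi> (G t)\<bar> \<le> C * exp t" if "0 \<le> t" for t
      using bound[OF that] \<pi>(2)[of "G t"] by linarith
    show "(\<integral>t. indicator {0..} t *\<^sub>R (exp (- real (n + 2) * t) * \<pi> (G t)) \<partial>lborel) = 0" for n :: nat
      using has_bochner_integral_bounded_linear[OF \<pi>(1) zero[of n, unfolded has_laplace_def]]
        bounded_linear.linear[OF \<pi>(1)]
      by (simp add: has_bochner_integral_iff linear_scale linear_0 \<pi>(3) del: of_nat_add)
  qed
  from this[OF bounded_linear_Re abs_Re_le_cmod] this[OF bounded_linear_Im abs_Im_le_cmod]
  show ?thesis by (simp add: complex_eq_iff)
qed

section \<open>The scalar relaxation equation\<close>

lemma le_exp_mult:
  assumes "x \<le> T" "0 \<le> (a::real)"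
  shows "a \<le> exp T * (exp (- x) * a)"
proof -
  have "1 \<le> exp T * exp (- x)" using assms by (simp flip: exp_add)
  from mult_right_mono[OF this assms(2)] show ?thesis by (simp add: mult.assoc)
qed

context subordinated
begin

abbreviation tail :: "real \<Rightarrow> complex" where "tail \<equiv> \<lambda>x. complex_of_real (levy_tail \<nu> x)"

definition tail_integral :: "real \<Rightarrow> real" where
  "tail_integral t = (\<integral>x. indicator {0..t} x *\<^sub>R levy_tail \<nu> x \<partial>lborel)"

lemma levy_tail_integrable: "integrable lborel (\<lambda>x. indicator {0..T} x *\<^sub>R levy_tail \<nu> x)"
proof (rule Bochner_Integration.integrable_bound)
  have [measurable]: "levy_tail \<nu> \<in> borel_measurable borel" by (rule borel_measurable_levy_tail[OF levy])
  show "integrable lborel (\<lambda>x. exp T * (exp (- 1 * x) * levy_tail \<nu> x))"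
    using laplace_transform_levy_tail[OF levy, of 1] by (intro integrable_mult_right) (auto simp: has_bochner_integral_iff)
  show "(\<lambda>x. indicator {0..T} x *\<^sub>R levy_tail \<nu> x) \<in> borel_measurable lborel" by measurable
  have "levy_tail \<nu> x \<le> exp T * (exp (- x) * levy_tail \<nu> x)" if "x \<le> T" for x
    using that by (intro le_exp_mult) auto
  then show "AE x in lborel. norm (indicator {0..T} x *\<^sub>R levy_tail \<nu> x) \<le> norm (exp T * (exp (- 1 * x) * levy_tail \<nu> x))"
    by (intro AE_I2) (auto simp: indicator_def)
qed

lemma locally_integrable_tail: "locally_integrable tail"
  unfolding locally_integrable_def
proof
  fix T
  have "integrable lborel (\<lambda>x. complex_of_real (indicator {0..T} x *\<^sub>R levy_tail \<nu> x))"
    by (intro integrable_of_real levy_tail_integrable)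
  then show "integrable lborel (\<lambda>x. indicator {0..T} x *\<^sub>R tail x)"
    by (simp add: scaleR_conv_of_real)
qed

lemma tail_integral_nonneg: "0 \<le> tail_integral t"
  unfolding tail_integral_def by simp

lemma tail_integral_le: "tail_integral t \<le> exp t * \<Phi> 1"
proof -
  have i: "has_bochner_integral lborel (\<lambda>x. exp (- 1 * x) * levy_tail \<nu> x) (\<Phi> 1 / 1)"
    by (rule laplace_transform_levy_tail[OF levy]) simp
  have le: "levy_tail \<nu> x \<le> exp t * (exp (- x) * levy_tail \<nu> x)" if "x \<le> t" for x
    using that by (intro le_exp_mult) auto
  have "tail_integral t \<le> (\<integral>x. exp t * (exp (- 1 * x) * levy_tail \<nu> x) \<partial>lborel)"
    unfolding tail_integral_def
  proof (rule integral_mono[OF levy_tail_integrable])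
    show "integrable lborel (\<lambda>x. exp t * (exp (- 1 * x) * levy_tail \<nu> x))"
      using i by (intro integrable_mult_right) (auto simp: has_bochner_integral_iff)
    show "indicator {0..t} x *\<^sub>R levy_tail \<nu> x \<le> exp t * (exp (- 1 * x) * levy_tail \<nu> x)" for x
      using le[of x] by (auto simp: indicator_def)
  qed
  also have "\<dots> = exp t * \<Phi> 1"
    using has_bochner_integral_integral_eq[OF i] by simp
  finally show ?thesis .
qed

lemma norm_conv_tail_le:
  assumes b: "\<And>s. 0 \<le> s \<Longrightarrow> s \<le> t \<Longrightarrow> norm (b s) \<le> B"
  shows "norm (conv tail b t) \<le> B * tail_integral t"
proof -
  have "norm (conv tail b t) = norm (\<integral>x. indicator {0..t} x *\<^sub>R (b (t - x) * tail x) \<partial>lborel)"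
    by (subst conv_commute) (simp add: conv_def)
  also have "\<dots> \<le> (\<integral>x. B * (indicator {0..t} x *\<^sub>R levy_tail \<nu> x) \<partial>lborel)"
  proof (cases "integrable lborel (\<lambda>x. indicator {0..t} x *\<^sub>R (b (t - x) * tail x))")
    case True
    have B: "norm (b (t - x)) * levy_tail \<nu> x \<le> B * levy_tail \<nu> x" if "x \<in> {0..t}" for x
      using b[of "t - x"] that by (intro mult_right_mono) auto
    show ?thesis
      using True B by (intro Bochner_Integration.integral_norm_bound_integral integrable_mult_right levy_tail_integrable)
        (auto simp: indicator_def norm_mult)
  next
    case False
    have "0 \<le> B * tail_integral t"
    proof (cases "0 \<le> t")
      case True
      then have "0 \<le> B" using b[of 0] norm_ge_zero order_trans by blast
      then show ?thesis by (simp add: tail_integral_nonneg)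
    qed (simp add: tail_integral_def)
    then show ?thesis using not_integrable_integral_eq[OF False] by (simp add: tail_integral_def)
  qed
  also have "\<dots> = B * tail_integral t" by (simp add: tail_integral_def)
  finally show ?thesis .
qed

lemma laplace_one:
  assumes "0 < (x::real)"
  shows "has_laplace (\<lambda>_. 1) x (complex_of_real (1 / x))"
proof -
  have "integrable lborel (\<lambda>t. complex_of_real (indicator {0..} t *\<^sub>R exp (- x * t)))"
    by (intro integrable_of_real integrable_exp_decay assms)
  moreover have "(\<integral>t. indicator {0..} t *\<^sub>R exp ((0 - complex_of_real x) * complex_of_real t) \<partial>lborel) = 1 / (complex_of_real x - 0)"
    using assms by (intro integral_exp_decay) simp
  moreover have "exp ((0 - complex_of_real x) * complex_of_real t) = complex_of_real (exp (- x * t)) * 1" for t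
    by (simp flip: exp_of_real)
  ultimately show ?thesis
    unfolding has_laplace_def has_bochner_integral_iff by (simp only: scaleR_conv_of_real of_real_mult of_real_divide mult_1_right) simp
qed

lemma e_measurable_half_line:
  assumes "Re z \<le> 0"
  shows "(\<lambda>t. indicator {0..} t *\<^sub>R e t z) \<in> borel_measurable borel"
  by (subst borel_measurable_restrict_space_iff[symmetric])
    (auto intro: borel_measurable_continuous_on_restrict e_continuous assms)

lemma has_laplace_e:
  assumes "0 < x" "Re z \<le> 0"
  shows "has_laplace (\<lambda>t. e t z) x (complex_of_real (\<Phi> x) / (complex_of_real x * (complex_of_real (\<Phi> x) - z)))"
proof -
  let ?g = "\<lambda>t. indicator {0..} t *\<^sub>R (complex_of_real (exp (- x * t)) * e t z)"
  have eq: "?g t = complex_of_real (exp (- x * t)) * (indicator {0..} t *\<^sub>R e t z)" for t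
    by simp
  have "integrable lborel ?g"
  proof (rule Bochner_Integration.integrable_bound[OF integrable_exp_decay[OF assms(1)]])
    show "?g \<in> borel_measurable lborel"
      unfolding eq using e_measurable_half_line[OF assms(2)] by measurable
    show "AE t in lborel. norm (?g t) \<le> norm (indicator {0..} t *\<^sub>R exp (- x * t))"
      using norm_e_le_1[OF assms(2)] by (auto simp: norm_mult indicator_def)
  qed
  moreover have "(\<integral>t. ?g t \<partial>lborel) = (complex_of_real (\<Phi> x) / (complex_of_real (\<Phi> x) - z)) / complex_of_real x"
  proof -
    have *: "complex_of_real x * (\<integral>t. ?g t \<partial>lborel)
        = (\<integral>t. indicator {0..} t *\<^sub>R (complex_of_real (x * exp (- x * t)) * e t z) \<partial>lborel)"
      by (subst integral_mult_right_zero[symmetric]) (simp add: mult.assoc)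
    then show ?thesis
      unfolding laplace_e[OF assms, symmetric] *[symmetric] using assms(1) by simp
  qed
  ultimately show ?thesis by (simp add: has_laplace_def has_bochner_integral_iff mult.commute)
qed

lemma has_laplace_tail:
  assumes "0 < x"
  shows "has_laplace tail x (complex_of_real (\<Phi> x / x))"
proof -
  have "has_bochner_integral lborel (\<lambda>t. complex_of_real (exp (- x * t) * levy_tail \<nu> t)) (complex_of_real (\<Phi> x / x))"
    by (rule has_bochner_integral_of_real[OF laplace_transform_levy_tail[OF levy assms]])
  moreover have "complex_of_real (exp (- x * t) * levy_tail \<nu> t) = indicator {0..} t *\<^sub>R (complex_of_real (exp (- x * t)) * tail t)" for t
    using levy_tail_nonpos[OF levy, of t] by (auto simp: indicator_def)
  ultimately show ?thesis by (simp add: has_laplace_def)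
qed

text \<open>The Laplace transforms of the two sides agree at every positive point, by
  \<open>F/X (1/X - F/(X (F - z))) + z (1/X) F/(X (F - z)) = 0\<close> with \<open>X = x\<close> and \<open>F = \<Phi> x\<close>. Both sides are continuous
  and of exponential growth, so they are equal.\<close>

theorem e_relaxation_equation:
  assumes z: "Re z \<le> 0" and t: "0 \<le> t"
  shows "conv tail (\<lambda>s. 1 - e s z) t = - z * conv (\<lambda>_. 1) (\<lambda>s. e s z) t"
proof -
  define h where "h s = 1 - e s z" for s
  define G where "G t = conv tail h t + z * conv (\<lambda>_. 1) (\<lambda>s. e s z) t" for t
  have hc: "continuous_on {0..} h" unfolding h_def by (intro continuous_intros e_continuous z)
  have h0: "h 0 = 0" by (simp add: h_def e_zero)
  have Gc: "continuous_on {0..} G"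
    unfolding G_def
    by (intro continuous_intros conv_continuous[OF locally_integrable_tail hc h0] conv_one_continuous e_continuous z)
  have G_bound: "norm (G t) \<le> (2 * \<Phi> 1 + norm z) * exp t" if "0 \<le> t" for t
  proof -
    have h2: "norm (h s) \<le> 2" for s
      unfolding h_def using norm_triangle_ineq4[of 1 "e s z"] norm_e_le_1[OF z, of s] by simp
    then have 1: "norm (conv tail h t) \<le> 2 * (exp t * \<Phi> 1)"
      using norm_conv_tail_le[of t h 2, OF h2] tail_integral_le[of t] by linarith
    have "norm (conv (\<lambda>_. 1) (\<lambda>s. e s z) t) \<le> 1 * (t - 0)"
      unfolding conv_one[OF e_continuous[OF z]]
      using that norm_e_le_1[OF z] by (intro integral_bound) (auto intro: continuous_on_subset[OF e_continuous[OF z]])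
    also have "1 * (t - 0) \<le> exp t" by (rule order_trans[OF _ exp_ge_add_one_self]) simp
    finally have "norm (z * conv (\<lambda>_. 1) (\<lambda>s. e s z) t) \<le> norm z * exp t"
      unfolding norm_mult by (intro mult_left_mono) auto
    then show ?thesis
      unfolding G_def using 1 norm_triangle_ineq[of "conv tail h t" "z * conv (\<lambda>_. 1) (\<lambda>s. e s z) t"]
      by (simp add: algebra_simps)
  qed
  have lap: "has_laplace G x 0" if x: "0 < x" for x
  proof -
    define X where "X = complex_of_real x"
    define F where "F = complex_of_real (\<Phi> x)"
    have X0: "X \<noteq> 0" using x by (simp add: X_def)
    have "0 < \<Phi> x" by (rule laplace_exponent_pos[OF levy x])
    then have Fz: "F - z \<noteq> 0" using z by (auto simp: F_def complex_eq_iff)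
    have E: "has_laplace (\<lambda>t. e t z) x (F / (X * (F - z)))"
      unfolding X_def F_def by (rule has_laplace_e[OF x z])
    have O: "has_laplace (\<lambda>_. 1) x (1 / X)" and T: "has_laplace tail x (F / X)"
      using laplace_one[OF x] has_laplace_tail[OF x] by (simp_all add: X_def F_def)
    have "has_laplace h x (1 / X - F / (X * (F - z)))"
      unfolding h_def by (rule has_laplace_diff[OF O E])
    then have "has_laplace G x (F / X * (1 / X - F / (X * (F - z))) + z * (1 / X * (F / (X * (F - z)))))"
      unfolding G_def by (intro has_laplace_add has_laplace_cmult has_laplace_conv T E O)
    moreover have "F / X * (1 / X - F / (X * (F - z))) + z * (1 / X * (F / (X * (F - z)))) = 0"
      using X0 Fz by (simp add: field_simps)
    ultimately show ?thesis by simp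
  qed
  have "G t = 0"
    by (rule laplace_injective[OF Gc G_bound lap t]) simp_all
  then have "conv tail h t = - z * conv (\<lambda>_. 1) (\<lambda>s. e s z) t"
    by (simp add: G_def eq_neg_iff_add_eq_0)
  then show ?thesis by (simp only: h_def[abs_def])
qed

text \<open>In the relaxation equation \<open>tail * (1 - er) = c (1 * er)\<close> the left-hand side is at most the integral of
  the tail, because \<open>0 \<le> er \<le> 1\<close>; the right-hand side is at least \<open>c t (er t)\<close>, because \<open>er\<close> decreases in
  time. The bound is uniform in \<open>c\<close>.\<close>

lemma er_decay:
  assumes c: "0 \<le> c" and t: "0 < t"
  shows "c * er t c \<le> tail_integral t / t"
proof -
  define z where "z = - complex_of_real c"
  have z: "Re z \<le> 0" using c by (simp add: z_def)
  have ec: "continuous_on {0..} (\<lambda>s. er s c)"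
    using continuous_on_Re[OF e_continuous[OF z]] by (simp add: z_def e_of_real)
  have "conv (\<lambda>_. 1) (\<lambda>s. e s z) t = complex_of_real (integral {0..t} (\<lambda>s. er s c))"
  proof -
    have "((\<lambda>s. complex_of_real (er s c)) has_integral complex_of_real (integral {0..t} (\<lambda>s. er s c))) {0..t}"
      by (intro has_integral_of_real integrable_integral integrable_continuous_interval continuous_on_subset[OF ec]) auto
    then show ?thesis
      unfolding conv_one[OF e_continuous[OF z]] by (simp add: z_def e_of_real integral_unique)
  qed
  then have "conv tail (\<lambda>s. 1 - e s z) t = complex_of_real (c * integral {0..t} (\<lambda>s. er s c))"
    using e_relaxation_equation[OF z, of t] t by (simp add: z_def)
  moreover have "norm (conv tail (\<lambda>s. 1 - e s z) t) \<le> 1 * tail_integral t"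
  proof (rule norm_conv_tail_le)
    fix s
    have "1 - e s z = complex_of_real (1 - er s c)" by (simp add: z_def e_of_real)
    then show "norm (1 - e s z) \<le> 1"
      using er_nonneg[of s c] er_le_1[OF c, of s] by (simp only: norm_of_real)
  qed
  ultimately have "c * integral {0..t} (\<lambda>s. er s c) \<le> tail_integral t"
    by (simp only: norm_of_real)
  moreover have "t * er t c \<le> integral {0..t} (\<lambda>s. er s c)"
  proof -
    have "integral {0..t} (\<lambda>s. er t c) \<le> integral {0..t} (\<lambda>s. er s c)"
      using er_antimono[OF c] by (intro integral_le integrable_continuous_interval continuous_on_subset[OF ec]) auto
    then show ?thesis using t by simp
  qed
  ultimately have "c * (t * er t c) \<le> tail_integral t"
    using mult_left_mono[OF _ c] order_trans by blast
  then show ?thesis using t by (simp add: field_simps)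
qed

text \<open>Let \<open>W = 1 * w\<close> and let \<open>e\<close> be the relaxation function for an exponent \<open>y\<close>. Evaluating
  \<open>(1 - e) * tail * w\<close> with the equation for \<open>w\<close> and with the equation for \<open>e\<close> gives
  \<open>z (1 - e) * W = - y e * W\<close>. For \<open>y = z \<noteq> 0\<close> this is \<open>1 * W = 0\<close>, and \<open>w = 0\<close> follows by differentiating
  twice. If \<open>z = 0\<close>, then \<open>y = - c\<close> with \<open>c > 0\<close> gives \<open>e * W = 0\<close>, and \<open>e\<close> tends to \<open>1\<close> as \<open>c\<close> tends to
  \<open>0\<close>.\<close>

theorem relaxation_equation_unique:
  assumes z: "Re z \<le> 0" and w: "continuous_on {0..} w" "w 0 = 0"
    and eq: "\<And>t. 0 \<le> t \<Longrightarrow> conv tail w t = z * conv (\<lambda>_. 1) w t"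
    and t: "0 \<le> t"
  shows "w t = 0"
proof -
  define W where "W = conv (\<lambda>_. 1) w"
  have Wc: "continuous_on {0..} W" unfolding W_def by (rule conv_one_continuous[OF w(1)])
  have one: "locally_integrable (\<lambda>_. 1)" by (intro locally_integrable_continuous continuous_intros)
  have key: "z * conv (\<lambda>s. 1 - e s y) W t = - y * conv (\<lambda>s. e s y) W t" if "Re y \<le> 0" "0 \<le> t" for y t
  proof -
    have hc: "continuous_on {0..} (\<lambda>s. 1 - e s y)" by (intro continuous_intros e_continuous that)
    have "z * conv (\<lambda>s. 1 - e s y) W t = conv (\<lambda>s. 1 - e s y) (\<lambda>s. z * W s) t"
      by (rule conv_scale_right[symmetric])
    also have "\<dots> = conv (\<lambda>s. 1 - e s y) (conv tail w) t"
      by (rule conv_cong) (simp_all add: eq W_def)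
    also have "\<dots> = conv w (conv tail (\<lambda>s. 1 - e s y)) t"
      by (rule conv_swap[OF hc w(1) locally_integrable_tail])
    also have "\<dots> = conv w (\<lambda>s. - y * conv (\<lambda>_. 1) (\<lambda>s. e s y) s) t"
      by (rule conv_cong) (simp_all add: e_relaxation_equation[OF that(1)])
    also have "\<dots> = - y * conv w (conv (\<lambda>_. 1) (\<lambda>s. e s y)) t"
      by (rule conv_scale_right)
    also have "conv w (conv (\<lambda>_. 1) (\<lambda>s. e s y)) t = conv (\<lambda>s. e s y) W t"
      unfolding W_def by (rule conv_swap[OF w(1) e_continuous[OF that(1)] one])
    finally show ?thesis .
  qed
  have sum: "conv (\<lambda>s. 1 - a s) W t = conv (\<lambda>_. 1) W t - conv a W t" if a: "continuous_on {0..} a" for a t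
  proof -
    have i: "integrable lborel (\<lambda>\<tau>. indicator {0..t} \<tau> *\<^sub>R (a (t - \<tau>) * W \<tau>))"
      by (intro borel_integrable_compact continuous_intros continuous_on_compose2[OF a] continuous_on_subset[OF Wc]) auto
    moreover have "integrable lborel (\<lambda>\<tau>. indicator {0..t} \<tau> *\<^sub>R (1 * W \<tau>))"
      by (intro borel_integrable_compact continuous_intros continuous_on_subset[OF Wc]) auto
    ultimately show ?thesis
      unfolding conv_def
      by (subst Bochner_Integration.integral_diff[symmetric]) (simp_all add: algebra_simps)
  qed
  have WW: "conv (\<lambda>_. 1) W t = 0" if t: "0 \<le> t" for t
  proof (cases "z = 0")
    case False
    have "z * conv (\<lambda>_. 1) W t = 0"
      using key[OF z t] sum[OF e_continuous[OF z], of t] by (simp add: algebra_simps)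
    then show ?thesis using False by simp
  next
    case True
    define c where "c n = inverse (real (Suc n))" for n
    have c0: "0 < c n" for n by (simp add: c_def)
    have zero: "conv (\<lambda>s. complex_of_real (er s (c n))) W t = 0" for n
      using key[of "- complex_of_real (c n)" t] c0[of n] t True by (simp add: e_of_real)
    obtain B where B: "\<And>x. x \<in> {0..t} \<Longrightarrow> norm (W x) \<le> B"
      by (rule continuous_Icc_bound[of 0 t W]) (auto intro: continuous_on_subset[OF Wc])
    have "(\<lambda>n. conv (\<lambda>s. complex_of_real (er s (c n))) W t) \<longlonglongrightarrow> conv (\<lambda>_. 1) W t"
      unfolding conv_def
    proof (rule integral_dominated_convergence[where w="\<lambda>\<tau>. indicator {0..t} \<tau> *\<^sub>R B"])
      show "integrable lborel (\<lambda>\<tau>. indicator {0..t} \<tau> *\<^sub>R B)"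
        by (intro borel_integrable_compact continuous_intros) auto
      show "(\<lambda>\<tau>. indicator {0..t} \<tau> *\<^sub>R (1 * W \<tau>)) \<in> borel_measurable lborel"
        by (intro borel_measurable_integrable borel_integrable_compact continuous_intros continuous_on_subset[OF Wc]) auto
      show "(\<lambda>\<tau>. indicator {0..t} \<tau> *\<^sub>R (complex_of_real (er (t - \<tau>) (c n)) * W \<tau>)) \<in> borel_measurable lborel" for n
      proof (intro borel_measurable_integrable borel_integrable_compact continuous_intros continuous_on_subset[OF Wc])
        have "continuous_on {0..} (\<lambda>s. er s (c n))"
          using continuous_on_Re[OF e_continuous[of "- complex_of_real (c n)"]] c0[of n] by (simp add: e_of_real)
        then show "continuous_on {0..t} (\<lambda>\<tau>. er (t - \<tau>) (c n))"
          by (rule continuous_on_compose2) (auto intro!: continuous_intros)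
      qed auto
      show "AE \<tau> in lborel. (\<lambda>n. indicator {0..t} \<tau> *\<^sub>R (complex_of_real (er (t - \<tau>) (c n)) * W \<tau>)) \<longlonglongrightarrow> indicator {0..t} \<tau> *\<^sub>R (1 * W \<tau>)"
      proof (rule AE_I2)
        fix \<tau>
        have "(\<lambda>n. complex_of_real (er (t - \<tau>) (c n))) \<longlonglongrightarrow> complex_of_real 1"
          unfolding c_def by (intro tendsto_of_real er_tendsto_1)
        then have l: "(\<lambda>n. complex_of_real (er (t - \<tau>) (c n))) \<longlonglongrightarrow> 1" by (simp only: of_real_1)
        show "(\<lambda>n. indicator {0..t} \<tau> *\<^sub>R (complex_of_real (er (t - \<tau>) (c n)) * W \<tau>)) \<longlonglongrightarrow> indicator {0..t} \<tau> *\<^sub>R (1 * W \<tau>)"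
          by (intro tendsto_intros l)
      qed
      show "AE \<tau> in lborel. norm (indicator {0..t} \<tau> *\<^sub>R (complex_of_real (er (t - \<tau>) (c n)) * W \<tau>)) \<le> indicator {0..t} \<tau> *\<^sub>R B" for n
      proof (rule AE_I2)
        fix \<tau>
        have "\<bar>er (t - \<tau>) (c n)\<bar> * norm (W \<tau>) \<le> 1 * B" if "\<tau> \<in> {0..t}"
          using that er_nonneg[of "t - \<tau>" "c n"] er_le_1[of "c n" "t - \<tau>"] c0[of n] B[OF that] by (intro mult_mono) auto
        then show "norm (indicator {0..t} \<tau> *\<^sub>R (complex_of_real (er (t - \<tau>) (c n)) * W \<tau>)) \<le> indicator {0..t} \<tau> *\<^sub>R B"
          by (auto simp: indicator_def norm_mult)
      qed
    qed
    then show ?thesis unfolding zero using LIMSEQ_unique tendsto_const by blast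
  qed
  have "W t = 0" if "0 \<le> t" for t
    by (rule conv_one_eq_zero[OF Wc WW that])
  then show ?thesis unfolding W_def by (intro conv_one_eq_zero[OF w(1) _ t])
qed

end

section \<open>Coefficients of the nonlocal derivative\<close>

lemma has_vector_derivative_quotient:
  fixes g :: "real \<Rightarrow> 'a::real_normed_vector"
  shows "(g has_vector_derivative d) (at t) \<longleftrightarrow> ((\<lambda>h. (1 / h) *\<^sub>R (g (t + h) - g t)) \<longlongrightarrow> d) (at 0)"
proof -
  have "norm (g (t + h) - g t - h *\<^sub>R d) / norm h = norm ((1 / h) *\<^sub>R (g (t + h) - g t) - d)" if "h \<noteq> 0" for h
  proof -
    have "(1 / h) *\<^sub>R (g (t + h) - g t) - d = (1 / h) *\<^sub>R (g (t + h) - g t - h *\<^sub>R d)"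
      using that by (simp add: scaleR_diff_right)
    then show ?thesis by simp
  qed
  then have "\<forall>\<^sub>F h in at 0. norm (g (t + h) - g t - h *\<^sub>R d) / norm h = norm ((1 / h) *\<^sub>R (g (t + h) - g t) - d)"
    by (simp add: eventually_at_filter)
  from tendsto_cong[OF this, of 0] show ?thesis
    unfolding has_vector_derivative_def has_derivative_at tendsto_norm_zero_iff LIM_zero_iff
    by (simp add: bounded_linear_scaleR_left)
qed

lemma conv_integrable:
  assumes K: "locally_integrable K" and b: "continuous_on {0..} b"
  shows "integrable lborel (\<lambda>\<tau>. indicator {0..r} \<tau> *\<^sub>R (K (r - \<tau>) * b \<tau>))"
proof -
  obtain B where B: "\<And>x. x \<in> {0..r} \<Longrightarrow> norm (b x) \<le> B"
    by (rule continuous_Icc_bound[of 0 r b]) (auto intro: continuous_on_subset[OF b])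
  have K': "integrable lborel (\<lambda>\<tau>. indicator {0..r} (r - \<tau>) *\<^sub>R K (r - \<tau>))"
    using integrable_reflect_real[OF K[unfolded locally_integrable_def, rule_format, of r], of r] .
  have bi: "integrable lborel (\<lambda>\<tau>. indicator {0..r} \<tau> *\<^sub>R b \<tau>)"
    using locally_integrable_continuous[OF b] by (simp add: locally_integrable_def)
  have eq: "indicator {0..r} \<tau> *\<^sub>R (K (r - \<tau>) * b \<tau>) = (indicator {0..r} (r - \<tau>) *\<^sub>R K (r - \<tau>)) * (indicator {0..r} \<tau> *\<^sub>R b \<tau>)" for \<tau>
    by (auto simp: indicator_def)
  show ?thesis
    unfolding eq
  proof (rule Bochner_Integration.integrable_bound[OF integrable_mult_right[OF K', of "complex_of_real B"]])
    show "AE \<tau> in lborel. norm ((indicator {0..r} (r - \<tau>) *\<^sub>R K (r - \<tau>)) * (indicator {0..r} \<tau> *\<^sub>R b \<tau>))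
        \<le> norm (complex_of_real B * (indicator {0..r} (r - \<tau>) *\<^sub>R K (r - \<tau>)))"
    proof (rule AE_I2)
      fix \<tau> :: real
      show "norm ((indicator {0..r} (r - \<tau>) *\<^sub>R K (r - \<tau>)) * (indicator {0..r} \<tau> *\<^sub>R b \<tau>))
        \<le> norm (complex_of_real B * (indicator {0..r} (r - \<tau>) *\<^sub>R K (r - \<tau>)))"
      proof (cases "\<tau> \<in> {0..r}")
        case True
        then have "norm (b \<tau>) \<le> \<bar>B\<bar>" using B[OF True] by linarith
        from mult_right_mono[OF this, of "norm (K (r - \<tau>))"] show ?thesis
          using True by (simp add: norm_mult mult.commute)
      qed simp
    qed
  qed (rule borel_measurable_times[OF borel_measurable_integrable[OF K'] borel_measurable_integrable[OF bi]])
qed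

lemma conv_add_right:
  assumes K: "locally_integrable K" and a: "continuous_on {0..} a" and b: "continuous_on {0..} b"
  shows "conv K (\<lambda>s. a s + b s) t = conv K a t + conv K b t"
  unfolding conv_def
  by (subst Bochner_Integration.integral_add[symmetric, OF conv_integrable[OF K a] conv_integrable[OF K b]])
    (simp add: distrib_left scaleR_add_right)

lemma gen_eigenvalue_Re: "Re (gen_eigenvalue \<mu> l m) = - (real l * (real l + 1))"
  by (simp add: gen_eigenvalue_def)

lemma gen_eigenvalue_Re_nonpos: "Re (gen_eigenvalue \<mu> l m) \<le> 0"
  by (simp add: gen_eigenvalue_Re)

text \<open>Since \<open>|m| \<le> l \<le> l (l + 1)\<close>, the transport term is bounded by \<open>|\<mu>|\<close> times the real part of the
  eigenvalue.\<close>

lemma gen_eigenvalue_norm: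
  assumes "\<bar>m\<bar> \<le> int l"
  shows "cmod (gen_eigenvalue \<mu> l m) \<le> (1 + \<bar>\<mu>\<bar>) * (real l * (real l + 1))"
proof -
  have "cmod (gen_eigenvalue \<mu> l m) \<le> cmod (\<i> * of_real \<mu> * of_int m) + cmod (of_nat l * (of_nat l + 1))"
    unfolding gen_eigenvalue_def by (rule norm_triangle_ineq4)
  also have "cmod (of_nat l * (of_nat l + 1)) = real l * (real l + 1)"
    by (metis norm_of_nat of_nat_1 of_nat_add of_nat_mult)
  also have "cmod (\<i> * of_real \<mu> * of_int m) = \<bar>\<mu>\<bar> * real_of_int \<bar>m\<bar>"
    by (simp add: norm_mult)
  also have "\<bar>\<mu>\<bar> * real_of_int \<bar>m\<bar> \<le> \<bar>\<mu>\<bar> * (real l * (real l + 1))"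
  proof (rule mult_left_mono)
    have "real_of_int \<bar>m\<bar> \<le> real l" using assms by linarith
    also have "\<dots> \<le> real l * (real l + 1)" by (simp add: mult_le_cancel_left1)
    finally show "real_of_int \<bar>m\<bar> \<le> real l * (real l + 1)" .
  qed simp
  finally show ?thesis by (simp add: algebra_simps)
qed

lemma fl_coeff_sphere_gen:
  assumes "v \<in> sobolev 2" "\<bar>m\<bar> \<le> int l"
  shows "fl_coeff (sphere_gen \<mu> v) l m = gen_eigenvalue \<mu> l m * fl_coeff v l m"
proof -
  define c where "c l m = gen_eigenvalue \<mu> l m * fl_coeff v l m" for l m
  have "spec c l \<le> (2 * (1 + \<bar>\<mu>\<bar>))\<^sup>2 * (real l powr (2 * 2) * power_spectrum l v)" for l
  proof -
    have "spec c l \<le> ((1 + \<bar>\<mu>\<bar>) * (real l * (real l + 1)))\<^sup>2 * power_spectrum l v"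
      unfolding power_spectrum_spec
      by (rule spec_mono) (auto simp: c_def norm_mult intro!: mult_right_mono gen_eigenvalue_norm)
    also have "\<dots> \<le> (2 * (1 + \<bar>\<mu>\<bar>))\<^sup>2 * (real l powr (2 * 2)) * power_spectrum l v"
    proof (rule mult_right_mono)
      have "real l * (real l + 1) \<le> 2 * (real l)\<^sup>2"
        by (cases l) (simp_all add: power2_eq_square algebra_simps)
      then have "((1 + \<bar>\<mu>\<bar>) * (real l * (real l + 1)))\<^sup>2 \<le> ((1 + \<bar>\<mu>\<bar>) * (2 * (real l)\<^sup>2))\<^sup>2"
        by (intro power_mono mult_left_mono) auto
      also have "\<dots> = (2 * (1 + \<bar>\<mu>\<bar>))\<^sup>2 * (real l) ^ 4"
        by (simp add: power2_eq_square power4_eq_xxxx algebra_simps)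
      also have "real l ^ 4 = real l powr (2 * 2)"
        using powr_realpow'[of "real l" 4] by simp
      finally show "((1 + \<bar>\<mu>\<bar>) * (real l * (real l + 1)))\<^sup>2 \<le> (2 * (1 + \<bar>\<mu>\<bar>))\<^sup>2 * (real l powr (2 * 2))" .
    qed simp
    finally show ?thesis by (simp add: mult.assoc)
  qed
  then have "summable (spec c)"
    by (intro summable_comparison_test'[OF summable_mult[OF sobolev_summable[OF assms(1)]], of 0])
      (simp add: spec_nonneg)
  from fl_coeff_from_coeff[OF this assms(2)] show ?thesis
    by (simp add: sphere_gen_def from_coeff_def c_def)
qed

lemma continuous_on_in_fl_coeff:
  assumes "H_continuous_on s A v" "\<bar>m\<bar> \<le> int l"
  shows "continuous_on A (\<lambda>t. fl_coeff (v t) l m)"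
  using assms unfolding continuous_on_in_def continuous_on_def by (auto intro: tendsto_in_fl_coeff)

context subordinated
begin

lemma has_bochner_integral_lebesgue_conv:
  assumes b: "continuous_on {0..} b"
  shows "has_bochner_integral (lebesgue_on {0<..<r}) (\<lambda>\<tau>. levy_tail \<nu> (r - \<tau>) *\<^sub>R b \<tau>) (conv tail b r)"
proof -
  let ?f = "\<lambda>\<tau>. indicator {0..r} \<tau> *\<^sub>R (tail (r - \<tau>) * b \<tau>)"
  let ?g = "\<lambda>\<tau>. indicator {0<..<r} \<tau> *\<^sub>R (levy_tail \<nu> (r - \<tau>) *\<^sub>R b \<tau>)"
  have f: "integrable lborel ?f" by (rule conv_integrable[OF locally_integrable_tail b])
  have eq: "?g = (\<lambda>\<tau>. indicator {0<..<r} \<tau> *\<^sub>R ?f \<tau>)"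
    by (auto simp: indicator_def scaleR_conv_of_real)
  have gm: "?g \<in> borel_measurable lborel"
    unfolding eq using f by measurable
  have ae: "AE \<tau> in lborel. ?f \<tau> = ?g \<tau>"
    using AE_lborel_singleton[of 0] AE_lborel_singleton[of r]
    by eventually_elim (auto simp: indicator_def scaleR_conv_of_real)
  have "integrable lborel ?g" by (rule integrable_cong_AE_imp[OF f gm ae])
  moreover have "(\<integral>\<tau>. ?g \<tau> \<partial>lborel) = conv tail b r"
    unfolding conv_def by (rule integral_cong_AE) (use gm f ae in auto)
  ultimately have "integrable lebesgue ?g" "(\<integral>\<tau>. ?g \<tau> \<partial>lebesgue) = conv tail b r"
    using integrable_completion[OF gm] integral_completion[OF gm] by simp_all
  then show ?thesis
    by (simp add: has_bochner_integral_iff integrable_restrict_space integral_restrict_space)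
qed

lemma integrable_lebesgue_levy_tail: "integrable (lebesgue_on {0<..<r}) (\<lambda>\<tau>. levy_tail \<nu> (r - \<tau>))"
proof -
  have "integrable (lebesgue_on {0<..<r}) (\<lambda>\<tau>. levy_tail \<nu> (r - \<tau>) *\<^sub>R (1::complex))"
    using has_bochner_integral_lebesgue_conv[of "\<lambda>_. 1" r] by (simp add: has_bochner_integral_iff)
  from integrable_norm[OF this] show ?thesis by simp
qed

text \<open>Both the Bochner integral and the limit of the difference quotients commute with the coefficient
  functionals. This reduces nonlocal derivatives to scalar ones, for the solution and for any competitor.\<close>

lemma nonlocal_derivative_fl_coeff:
  assumes v: "H_continuous_on s {0..} v"
    and w: "has_nonlocal_derivative (sobolev s) (sobolev_norm s) \<nu> v w t" and t: "0 < t"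
    and m: "\<bar>m\<bar> \<le> int l"
  shows "(conv tail (\<lambda>\<tau>. fl_coeff (v \<tau>) l m - fl_coeff (v 0) l m) has_vector_derivative fl_coeff w l m) (at t)"
proof -
  obtain u0 J where u0: "H_tendsto s v u0 (at_right 0)"
    and J: "\<forall>\<^sub>F r in nhds t. has_bochner_integral_in (sobolev s) (sobolev_norm s) (lebesgue_on {0<..<r})
            (\<lambda>\<tau>. levy_tail \<nu> (r - \<tau>) *\<^sub>R (v \<tau> - u0)) (J r)"
    and lim: "H_tendsto s (\<lambda>h. (1 / h) *\<^sub>R (J (t + h) - J t)) w (at 0)"
    using w unfolding has_nonlocal_derivative_def by blast
  have "u0 = v 0"
    by (rule tendsto_in_unique[OF u0 H_continuous_on_at_right[OF v]]) simp
  define a where "a \<tau> = fl_coeff (v \<tau>) l m - fl_coeff (v 0) l m" for \<tau>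
  have a: "continuous_on {0..} a"
    unfolding a_def by (intro continuous_intros continuous_on_in_fl_coeff[OF v m])
  have fa: "fl_coeff (levy_tail \<nu> (r - \<tau>) *\<^sub>R (v \<tau> - u0)) l m = levy_tail \<nu> (r - \<tau>) *\<^sub>R a \<tau>" for r \<tau>
    by (simp add: a_def fl_coeff_scaleR fl_coeff_diff \<open>u0 = v 0\<close>)
  have J': "\<forall>\<^sub>F r in nhds t. fl_coeff (J r) l m = conv tail a r"
    using J
  proof eventually_elim
    case (elim r)
    have I: "has_bochner_integral (lebesgue_on {0<..<r}) (\<lambda>\<tau>. levy_tail \<nu> (r - \<tau>) *\<^sub>R a \<tau>) (conv tail a r)"
      by (rule has_bochner_integral_lebesgue_conv[OF a])
    then have "(\<lambda>\<tau>. fl_coeff (levy_tail \<nu> (r - \<tau>) *\<^sub>R (v \<tau> - u0)) l m) \<in> borel_measurable (lebesgue_on {0<..<r})"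
      unfolding fa by (auto elim: has_bochner_integral.cases)
    from has_bochner_integral_in_fl_coeff[OF elim m this] show ?case
      unfolding fa using I has_bochner_integral_eq by blast
  qed
  have "((\<lambda>h. (1 / h) *\<^sub>R (fl_coeff (J (t + h)) l m - fl_coeff (J t) l m)) \<longlongrightarrow> fl_coeff w l m) (at 0)"
    using tendsto_in_fl_coeff[OF lim m] by (simp add: fl_coeff_scaleR fl_coeff_diff)
  moreover have "\<forall>\<^sub>F h in at 0. (1 / h) *\<^sub>R (fl_coeff (J (t + h)) l m - fl_coeff (J t) l m) = (1 / h) *\<^sub>R (conv tail a (t + h) - conv tail a t)"
  proof -
    have "filterlim (\<lambda>h. t + h) (nhds t) (at 0)"
      using tendsto_add[OF tendsto_const tendsto_ident_at, of t 0 UNIV] by simp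
    from eventually_compose_filterlim[OF J' this]
    show ?thesis by eventually_elim (simp add: eventually_nhds_x_imp_x[OF J'])
  qed
  ultimately have "((\<lambda>h. (1 / h) *\<^sub>R (conv tail a (t + h) - conv tail a t)) \<longlongrightarrow> fl_coeff w l m) (at 0)"
    by (rule Lim_transform_eventually)
  then show ?thesis
    unfolding has_vector_derivative_quotient a_def .
qed

lemma nonlocal_derivative_eq:
  assumes v: "H_continuous_on s {0..} v"
    and w: "has_nonlocal_derivative (sobolev s) (sobolev_norm s) \<nu> v w t" and t: "0 < t"
  shows "nonlocal_derivative (sobolev s) (sobolev_norm s) \<nu> v t = w"
  unfolding nonlocal_derivative_def
proof (rule the_equality)
  show "has_nonlocal_derivative (sobolev s) (sobolev_norm s) \<nu> v w t" by (rule w)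
next
  fix w' assume w': "has_nonlocal_derivative (sobolev s) (sobolev_norm s) \<nu> v w' t"
  show "w' = w"
    by (rule l2_sphere_eqI)
      (rule vector_derivative_unique_at[OF nonlocal_derivative_fl_coeff[OF v w' t] nonlocal_derivative_fl_coeff[OF v w t]])
qed

lemma conv_tail_zero: "conv tail b 0 = 0"
proof -
  have "indicator {0..0} \<tau> *\<^sub>R (tail (0 - \<tau>) * b \<tau>) = 0" for \<tau> :: real
    using levy_tail_nonpos[OF levy, of 0] by (auto simp: indicator_def)
  then show ?thesis unfolding conv_def by (simp only: integral_zero)
qed

text \<open>Both sides are continuous on \<open>[0, \<infinity>)\<close>, vanish at \<open>0\<close>, and have the same derivative at positive
  times.\<close>

lemma conv_tail_eq_of_derivative:
  assumes a: "continuous_on {0..} a"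
    and deriv: "\<And>t. 0 < t \<Longrightarrow> (conv tail (\<lambda>\<tau>. a \<tau> - a 0) has_vector_derivative z * a t) (at t)"
    and t: "0 \<le> t"
  shows "conv tail (\<lambda>\<tau>. a \<tau> - a 0) t = z * conv (\<lambda>_. 1) a t"
proof -
  define g where "g t = conv tail (\<lambda>\<tau>. a \<tau> - a 0) t - z * conv (\<lambda>_. 1) a t" for t
  have gc: "continuous_on {0..} g"
    unfolding g_def by (intro continuous_intros conv_continuous locally_integrable_tail conv_one_continuous a) simp
  have g': "(g has_vector_derivative 0) (at s)" if "0 < s" for s
    using has_vector_derivative_diff[OF deriv[OF that] has_vector_derivative_mult_right[OF conv_one_deriv[OF a that], of z]]
    unfolding g_def by simp
  have "g 0 = 0"
  proof -
    have "conv (\<lambda>_. 1) a 0 = 0" using conv_one[OF a, of 0] by simp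
    then show ?thesis by (simp add: g_def conv_tail_zero)
  qed
  have "g t = g 0"
  proof (cases "t = 0")
    case False
    then have t: "0 < t" using t by simp
    have "continuous_on {0..t} g" by (rule continuous_on_subset[OF gc]) auto
    then show ?thesis
      by (rule has_derivative_zero_unique_strong_interval[where k="{0}" and a=0 and b=t and f=g and y="g 0", rotated 1])
        (use t g' in \<open>auto simp: has_vector_derivative_def intro: has_derivative_at_withinI\<close>)
  qed simp
  with \<open>g 0 = 0\<close> show ?thesis by (simp add: g_def)
qed

end

section \<open>The Cauchy problem on the sphere\<close>

locale sphere_cauchy_problem = subordinated \<nu> M S
  for \<nu> :: "real measure" and M :: "'w measure" and S :: "real \<Rightarrow> 'w \<Rightarrow> real" +
  fixes \<mu> s :: real and f :: l2_sphere
  assumes s0: "0 \<le> s" and f: "f \<in> sobolev s"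
begin

abbreviation z :: "nat \<Rightarrow> int \<Rightarrow> complex" where "z \<equiv> gen_eigenvalue \<mu>"

definition u :: "real \<Rightarrow> l2_sphere" where
  "u t = from_coeff (\<lambda>l m. fl_coeff f l m * e t (z l m))"

lemma norm_e_z: "cmod (e t (z l m)) \<le> 1"
  by (rule norm_e_le_1[OF gen_eigenvalue_Re_nonpos])

lemma e_z_continuous: "continuous_on {0..} (\<lambda>t. e t (z l m))"
  by (rule e_continuous[OF gen_eigenvalue_Re_nonpos])

lemma u_sobolev: "u t \<in> sobolev s"
  and fl_coeff_u: "\<bar>m\<bar> \<le> int l \<Longrightarrow> fl_coeff (u t) l m = fl_coeff f l m * e t (z l m)"
proof -
  have "cmod (fl_coeff f l m * e t (z l m)) \<le> 1 * cmod (fl_coeff f l m)" for l m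
    using mult_left_mono[OF norm_e_z[of t l m], of "cmod (fl_coeff f l m)"] by (simp add: norm_mult)
  from sobolev_coeffI[OF f this] show "u t \<in> sobolev s" "\<bar>m\<bar> \<le> int l \<Longrightarrow> fl_coeff (u t) l m = fl_coeff f l m * e t (z l m)"
    unfolding u_def by auto
qed

lemma u_zero: "u 0 = f"
  by (rule l2_sphere_eqI) (simp add: fl_coeff_u e_zero)

lemma e_decay:
  assumes "0 < a" "a \<le> t"
  shows "real l * (real l + 1) * cmod (e t (z l m)) \<le> tail_integral a / a"
proof -
  define c where "c = real l * (real l + 1)"
  have c: "0 \<le> c" by (simp add: c_def)
  have "cmod (e t (z l m)) \<le> er t c"
    using norm_e_le_er[of t "z l m"] by (simp add: gen_eigenvalue_Re c_def)
  also have "\<dots> \<le> er a c" by (rule er_antimono[OF c assms(2)])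
  finally have "c * cmod (e t (z l m)) \<le> c * er a c" using c by (rule mult_left_mono)
  also have "\<dots> \<le> tail_integral a / a" by (rule er_decay[OF c assms(1)])
  finally show ?thesis by (simp add: c_def)
qed

definition gen_bound :: "real \<Rightarrow> real" where
  "gen_bound a = (1 + \<bar>\<mu>\<bar>) * (tail_integral a / a)"

lemma gen_bound_nonneg: "0 < a \<Longrightarrow> 0 \<le> gen_bound a"
  by (simp add: gen_bound_def tail_integral_nonneg)

lemma z_e_bound:
  assumes "0 < a" "a \<le> t" "\<bar>m\<bar> \<le> int l"
  shows "cmod (z l m * e t (z l m)) \<le> gen_bound a"
proof -
  have "cmod (z l m * e t (z l m)) \<le> (1 + \<bar>\<mu>\<bar>) * (real l * (real l + 1)) * cmod (e t (z l m))"
    unfolding norm_mult by (intro mult_right_mono gen_eigenvalue_norm assms) simp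
  also have "\<dots> = (1 + \<bar>\<mu>\<bar>) * (real l * (real l + 1) * cmod (e t (z l m)))" by (simp only: mult.assoc)
  also have "\<dots> \<le> gen_bound a"
    unfolding gen_bound_def by (intro mult_left_mono e_decay assms) simp
  finally show ?thesis .
qed

text \<open>A fixed element of \<open>H\<^sup>s\<^sup>+\<^sup>2\<close>, with coefficients \<open>f\<^sub>l\<^sub>m / (1 + l (l + 1))\<close>, that dominates \<open>u t\<close>, up to
  a constant, for all \<open>t\<close> in \<open>[a, \<infinity>)\<close>, \<open>a > 0\<close>. It is what makes \<open>u\<close> continuous with values in \<open>H\<^sup>s\<^sup>+\<^sup>2\<close> at positive times.\<close>

definition f2 :: l2_sphere where
  "f2 = from_coeff (\<lambda>l m. fl_coeff f l m / of_real (1 + real l * (real l + 1)))"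

lemma f2_sobolev: "f2 \<in> sobolev (s + 2)"
  and fl_coeff_f2: "\<bar>m\<bar> \<le> int l \<Longrightarrow> fl_coeff f2 l m = fl_coeff f l m / of_real (1 + real l * (real l + 1))"
proof -
  define c where "c l m = fl_coeff f l m / complex_of_real (1 + real l * (real l + 1))" for l m
  have c: "spec c l \<le> (1 / (1 + real l * (real l + 1)))\<^sup>2 * power_spectrum l f" for l
    unfolding power_spectrum_spec
  proof (rule spec_mono)
    fix m
    have "cmod (complex_of_real (1 + real l * (real l + 1))) = 1 + real l * (real l + 1)"
      by (subst norm_of_real) simp
    then show "cmod (c l m) \<le> 1 / (1 + real l * (real l + 1)) * cmod (fl_coeff f l m)"
      unfolding c_def norm_divide by simp
  qed
  have l4: "real l ^ 4 * (1 / (1 + real l * (real l + 1)))\<^sup>2 \<le> 1" for l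
  proof -
    have "(real l)\<^sup>2 / (1 + real l * (real l + 1)) \<le> 1"
    proof -
      have q: "0 < 1 + real l * (real l + 1)" by (simp add: add_pos_nonneg)
      show ?thesis unfolding pos_divide_le_eq[OF q] by (simp add: power2_eq_square distrib_left)
    qed
    then have "((real l)\<^sup>2 / (1 + real l * (real l + 1)))\<^sup>2 \<le> 1\<^sup>2" by (intro power_mono) auto
    then show ?thesis by (simp add: power_divide flip: power_mult)
  qed
  have le1: "(1 / (1 + real l * (real l + 1)))\<^sup>2 \<le> 1" for l
  proof -
    have q: "0 < 1 + real l * (real l + 1)" by (simp add: add_pos_nonneg)
    have "1 / (1 + real l * (real l + 1)) \<le> 1" unfolding pos_divide_le_eq[OF q] by simp
    then show ?thesis by (intro power_le_one) auto
  qed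
  have "spec c l \<le> power_spectrum l f" for l
    using c[of l] mult_right_mono[OF le1[of l] power_spectrum_nonneg[of l f]] by linarith
  then have sc: "summable (spec c)"
    by (intro summable_comparison_test'[OF summable_power_spectrum[of f], of 0]) (simp add: spec_nonneg)
  have "real l powr (2 * (s + 2)) * spec c l \<le> real l powr (2 * s) * power_spectrum l f" for l
  proof -
    have p: "real l powr (2 * (s + 2)) = real l powr (2 * s) * real l ^ 4"
      using powr_realpow'[of "real l" 4] by (simp add: distrib_left powr_add)
    have "real l powr (2 * (s + 2)) * spec c l \<le> real l powr (2 * (s + 2)) * ((1 / (1 + real l * (real l + 1)))\<^sup>2 * power_spectrum l f)"
      by (intro mult_left_mono c) simp
    also have "\<dots> = (real l powr (2 * s) * power_spectrum l f) * (real l ^ 4 * (1 / (1 + real l * (real l + 1)))\<^sup>2)"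
      unfolding p by (simp only: ac_simps)
    also have "\<dots> \<le> (real l powr (2 * s) * power_spectrum l f) * 1"
      by (intro mult_left_mono l4) simp
    finally show ?thesis by simp
  qed
  then have "summable (\<lambda>l. real l powr (2 * (s + 2)) * spec c l)"
    by (intro summable_comparison_test'[OF sobolev_summable[OF f], of 0]) (simp add: spec_nonneg)
  from sobolevI_coeff[OF sc this] show "f2 \<in> sobolev (s + 2)" by (simp only: f2_def c_def[abs_def])
  show "\<bar>m\<bar> \<le> int l \<Longrightarrow> fl_coeff f2 l m = fl_coeff f l m / of_real (1 + real l * (real l + 1))"
    using fl_coeff_from_coeff[OF sc, of m l] by (simp only: f2_def c_def[abs_def])
qed

lemma u_dominated_f2:
  assumes "0 < a" "a \<le> t" "\<bar>m\<bar> \<le> int l"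
  shows "cmod (fl_coeff (u t) l m) \<le> (1 + tail_integral a / a) * cmod (fl_coeff f2 l m)"
proof -
  define q where "q = 1 + real l * (real l + 1)"
  have q: "0 < q" by (simp add: q_def add_pos_nonneg)
  have "q * cmod (e t (z l m)) \<le> 1 + tail_integral a / a"
    using e_decay[OF assms(1,2), of l m] norm_e_z[of t l m] by (simp add: q_def distrib_right)
  then have "cmod (e t (z l m)) \<le> (1 + tail_integral a / a) / q"
    using q by (simp add: le_divide_eq mult.commute)
  then have "cmod (fl_coeff f l m) * cmod (e t (z l m)) \<le> cmod (fl_coeff f l m) * ((1 + tail_integral a / a) / q)"
    by (intro mult_left_mono) auto
  moreover have "cmod (fl_coeff f2 l m) = cmod (fl_coeff f l m) / q"
    using q by (simp add: fl_coeff_f2[OF assms(3)] norm_divide del: of_real_add of_real_mult flip: q_def)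
  ultimately show ?thesis
    by (simp add: fl_coeff_u assms norm_mult mult.commute)
qed

lemma u_sobolev_2: "0 < t \<Longrightarrow> u t \<in> sobolev (s + 2)"
  by (rule sobolev_dominated(1)[OF f2_sobolev u_dominated_f2[of t t]])
    (auto simp: tail_integral_nonneg)

lemma u_continuous: "H_continuous_on s {0..} u"
proof (rule sobolev_continuousI[OF f])
  have "cmod (fl_coeff (u r) l m) \<le> 1 * cmod (fl_coeff f l m)" if "\<bar>m\<bar> \<le> int l" for r l m
    using mult_left_mono[OF norm_e_z[of r l m], of "cmod (fl_coeff f l m)"] that by (simp add: fl_coeff_u norm_mult)
  then show "\<exists>C\<ge>0. \<forall>\<^sub>F r in nhds t. r \<in> {0..} \<longrightarrow>
      (\<forall>l m. \<bar>m\<bar> \<le> int l \<longrightarrow> cmod (fl_coeff (u r) l m) \<le> C * cmod (fl_coeff f l m))" for t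
    by (intro exI[of _ 1] conjI always_eventually) auto
  show "continuous_on {0..} (\<lambda>t. fl_coeff (u t) l m)" if "\<bar>m\<bar> \<le> int l" for l m
    using that by (simp add: fl_coeff_u) (intro continuous_intros e_z_continuous)
qed

lemma eventually_gt_half: "0 < (t::real) \<Longrightarrow> \<forall>\<^sub>F r in nhds t. t / 2 < r"
  by (rule order_tendstoD(1)[OF filterlim_ident]) simp

lemma u_continuous_2: "H_continuous_on (s + 2) {0<..} u"
proof (rule sobolev_continuousI[OF f2_sobolev])
  fix t :: real assume "t \<in> {0<..}"
  then have t: "0 < t" by simp
  show "\<exists>C\<ge>0. \<forall>\<^sub>F r in nhds t. r \<in> {0<..} \<longrightarrow>
      (\<forall>l m. \<bar>m\<bar> \<le> int l \<longrightarrow> cmod (fl_coeff (u r) l m) \<le> C * cmod (fl_coeff f2 l m))"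
  proof (intro exI conjI)
    show "0 \<le> 1 + tail_integral (t/2) / (t/2)" using t tail_integral_nonneg[of "t/2"] by simp
    show "\<forall>\<^sub>F r in nhds t. r \<in> {0<..} \<longrightarrow> (\<forall>l m. \<bar>m\<bar> \<le> int l \<longrightarrow>
        cmod (fl_coeff (u r) l m) \<le> (1 + tail_integral (t/2) / (t/2)) * cmod (fl_coeff f2 l m))"
      using eventually_gt_half[OF t]
      by eventually_elim (intro impI allI u_dominated_f2, use t in auto)
  qed
next
  show "continuous_on {0<..} (\<lambda>t. fl_coeff (u t) l m)" if "\<bar>m\<bar> \<le> int l" for l m
    using that by (simp add: fl_coeff_u)
      (intro continuous_intros continuous_on_subset[OF e_z_continuous], auto)
qed

lemma fl_coeff_gen_u:
  assumes "0 < t" "\<bar>m\<bar> \<le> int l"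
  shows "fl_coeff (sphere_gen \<mu> (u t)) l m = fl_coeff f l m * (z l m * e t (z l m))"
  using fl_coeff_sphere_gen[OF sobolev_mono[OF u_sobolev_2[OF assms(1)], of 2] assms(2), of \<mu>] s0 assms
  by (simp add: fl_coeff_u)

lemma gen_u_dominated:
  assumes "0 < a" "a \<le> t" "\<bar>m\<bar> \<le> int l"
  shows "cmod (fl_coeff (sphere_gen \<mu> (u t)) l m) \<le> gen_bound a * cmod (fl_coeff f l m)"
  using mult_left_mono[OF z_e_bound[OF assms], of "cmod (fl_coeff f l m)"] assms
  by (simp add: fl_coeff_gen_u norm_mult mult.commute)

lemma gen_u_sobolev: "0 < t \<Longrightarrow> sphere_gen \<mu> (u t) \<in> sobolev s"
  by (rule sobolev_dominated(1)[OF f gen_u_dominated[of t t]]) (auto simp: gen_bound_nonneg)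

lemma gen_u_continuous: "H_continuous_on s {0<..} (\<lambda>t. sphere_gen \<mu> (u t))"
proof (rule sobolev_continuousI[OF f])
  fix t :: real assume "t \<in> {0<..}"
  then have t: "0 < t" by simp
  show "\<exists>C\<ge>0. \<forall>\<^sub>F r in nhds t. r \<in> {0<..} \<longrightarrow>
      (\<forall>l m. \<bar>m\<bar> \<le> int l \<longrightarrow> cmod (fl_coeff (sphere_gen \<mu> (u r)) l m) \<le> C * cmod (fl_coeff f l m))"
  proof (intro exI conjI)
    show "0 \<le> gen_bound (t/2)" using t by (simp add: gen_bound_nonneg)
    show "\<forall>\<^sub>F r in nhds t. r \<in> {0<..} \<longrightarrow> (\<forall>l m. \<bar>m\<bar> \<le> int l \<longrightarrow>
        cmod (fl_coeff (sphere_gen \<mu> (u r)) l m) \<le> gen_bound (t/2) * cmod (fl_coeff f l m))"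
      using eventually_gt_half[OF t]
      by eventually_elim (intro impI allI gen_u_dominated, use t in auto)
  qed
next
  fix l m assume m: "\<bar>m\<bar> \<le> int l"
  have "continuous_on {0<..} (\<lambda>t. fl_coeff f l m * (z l m * e t (z l m)))"
    by (intro continuous_intros continuous_on_subset[OF e_z_continuous]) auto
  then show "continuous_on {0<..} (\<lambda>t. fl_coeff (sphere_gen \<mu> (u t)) l m)"
    by (rule continuous_on_eq) (simp add: fl_coeff_gen_u m)
qed

abbreviation E :: "nat \<Rightarrow> int \<Rightarrow> real \<Rightarrow> complex" where
  "E l m \<equiv> conv (\<lambda>_. 1) (\<lambda>s. e s (z l m))"

text \<open>By the relaxation equation this is the convolution of the tail with \<open>u - f\<close>. In the present form the
  derivative of its coefficients is evident.\<close>

definition J :: "real \<Rightarrow> l2_sphere" where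
  "J r = from_coeff (\<lambda>l m. fl_coeff f l m * (z l m * E l m r))"

lemma z_E: "0 \<le> r \<Longrightarrow> z l m * E l m r = conv tail (\<lambda>s. e s (z l m) - 1) r"
  using e_relaxation_equation[OF gen_eigenvalue_Re_nonpos, of r \<mu> l m]
    conv_scale_right[of tail "-1" "\<lambda>s. 1 - e s (z l m)" r] by simp

lemma J_sobolev: "0 \<le> r \<Longrightarrow> J r \<in> sobolev s"
  and fl_coeff_J: "0 \<le> r \<Longrightarrow> \<bar>m\<bar> \<le> int l \<Longrightarrow> fl_coeff (J r) l m = fl_coeff f l m * (z l m * E l m r)"
proof -
  assume r: "0 \<le> r"
  have "cmod (z l m * E l m r) \<le> 2 * tail_integral r" for l m
    unfolding z_E[OF r]
  proof (rule norm_conv_tail_le)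
    show "cmod (e t (z l m) - 1) \<le> 2" for t
      using norm_triangle_ineq4[of "e t (z l m)" 1] norm_e_z[of t l m] by simp
  qed
  then have "cmod (fl_coeff f l m * (z l m * E l m r)) \<le> 2 * tail_integral r * cmod (fl_coeff f l m)" for l m
    using mult_left_mono[of "cmod (z l m * E l m r)" "2 * tail_integral r" "cmod (fl_coeff f l m)"]
    by (simp add: norm_mult mult.commute)
  from sobolev_coeffI[OF f this] tail_integral_nonneg[of r]
  show "J r \<in> sobolev s" "\<bar>m\<bar> \<le> int l \<Longrightarrow> fl_coeff (J r) l m = fl_coeff f l m * (z l m * E l m r)"
    unfolding J_def by auto
qed

lemma J_bochner:
  assumes r: "0 < r"
  shows "has_bochner_integral_in (sobolev s) (sobolev_norm s) (lebesgue_on {0<..<r})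
    (\<lambda>\<tau>. levy_tail \<nu> (r - \<tau>) *\<^sub>R (u \<tau> - f)) (J r)"
proof (rule has_bochner_integral_in_sobolevI[where f=f and k="\<lambda>\<tau>. 2 * levy_tail \<nu> (r - \<tau>)"])
  show "J r \<in> sobolev s" using r by (intro J_sobolev) simp
  show "levy_tail \<nu> (r - \<tau>) *\<^sub>R (u \<tau> - f) \<in> sobolev s" for \<tau>
    by (intro sobolev_scaleR sobolev_diff u_sobolev f)
  show "integrable (lebesgue_on {0<..<r}) (\<lambda>\<tau>. 2 * levy_tail \<nu> (r - \<tau>))"
    by (intro integrable_mult_right integrable_lebesgue_levy_tail)
  have coeff: "fl_coeff (levy_tail \<nu> (r - \<tau>) *\<^sub>R (u \<tau> - f)) l m = fl_coeff f l m * (levy_tail \<nu> (r - \<tau>) *\<^sub>R (e \<tau> (z l m) - 1))"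
    if "\<bar>m\<bar> \<le> int l" for \<tau> l m
    using that by (simp add: fl_coeff_scaleR fl_coeff_diff fl_coeff_u algebra_simps)
  show "cmod (fl_coeff (levy_tail \<nu> (r - \<tau>) *\<^sub>R (u \<tau> - f)) l m) \<le> 2 * levy_tail \<nu> (r - \<tau>) * cmod (fl_coeff f l m)"
    if m: "\<bar>m\<bar> \<le> int l" for \<tau> l m
  proof -
    have "cmod (e \<tau> (z l m) - 1) \<le> 2"
      using norm_triangle_ineq4[of "e \<tau> (z l m)" 1] norm_e_z[of \<tau> l m] by simp
    from mult_left_mono[OF this, of "cmod (fl_coeff f l m) * levy_tail \<nu> (r - \<tau>)"]
    show ?thesis unfolding coeff[OF m] by (simp add: norm_mult mult.assoc mult.left_commute mult.commute)
  qed
  show "has_bochner_integral (lebesgue_on {0<..<r}) (\<lambda>\<tau>. fl_coeff (levy_tail \<nu> (r - \<tau>) *\<^sub>R (u \<tau> - f)) l m) (fl_coeff (J r) l m)"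
    if m: "\<bar>m\<bar> \<le> int l" for l m
  proof -
    have "has_bochner_integral (lebesgue_on {0<..<r}) (\<lambda>\<tau>. levy_tail \<nu> (r - \<tau>) *\<^sub>R (e \<tau> (z l m) - 1)) (z l m * E l m r)"
      using r by (subst z_E) (auto intro!: has_bochner_integral_lebesgue_conv continuous_intros e_z_continuous)
    then show ?thesis
      unfolding coeff[OF m] fl_coeff_J[OF less_imp_le[OF r] m] by (rule has_bochner_integral_mult_right)
  qed
qed (use f in auto)

text \<open>The mean value inequality with the bound on \<open>z e\<close> that is uniform in \<open>l\<close> and \<open>m\<close>; it dominates the
  difference quotients of \<open>J\<close>.\<close>

lemma E_lipschitz:
  assumes a: "0 < a" and m: "\<bar>m\<bar> \<le> int l" and r: "a \<le> r" and t: "a \<le> t"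
  shows "cmod (z l m * E l m r - z l m * E l m t) \<le> gen_bound a * \<bar>r - t\<bar>"
proof -
  have "norm (z l m * E l m r - z l m * E l m t) \<le> gen_bound a * norm (r - t)"
  proof (rule differentiable_bound[of "{a..}" "\<lambda>x. z l m * E l m x" "\<lambda>x h. h *\<^sub>R (z l m * e x (z l m))"])
    fix x assume "x \<in> {a..}"
    then have x: "0 < x" "a \<le> x" using a by auto
    have "((\<lambda>x. z l m * E l m x) has_vector_derivative z l m * e x (z l m)) (at x)"
      by (intro has_vector_derivative_mult_right conv_one_deriv e_z_continuous x)
    then show "((\<lambda>x. z l m * E l m x) has_derivative (\<lambda>h. h *\<^sub>R (z l m * e x (z l m)))) (at x within {a..})"
      by (simp add: has_vector_derivative_def has_derivative_at_withinI)
    show "onorm (\<lambda>h. h *\<^sub>R (z l m * e x (z l m))) \<le> gen_bound a"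
      using z_e_bound[OF a x(2) m] by (intro onorm_le) (auto simp: mult.commute[of "gen_bound a"] intro: mult_left_mono)
  qed (use r t in auto)
  then show ?thesis by simp
qed

text \<open>The coefficients of the difference quotients of \<open>J\<close> converge by the fundamental theorem of calculus, to
  \<open>f\<^sub>l\<^sub>m z (e t)\<close>, and they are dominated by a multiple of those of \<open>f\<close>.\<close>

lemma u_nonlocal_derivative:
  assumes t: "0 < t"
  shows "has_nonlocal_derivative (sobolev s) (sobolev_norm s) \<nu> u (sphere_gen \<mu> (u t)) t"
  unfolding has_nonlocal_derivative_def
proof (intro exI conjI)
  show "H_tendsto s u f (at_right 0)"
    using H_continuous_on_at_right[OF u_continuous] u_zero by simp
  have "\<forall>\<^sub>F r in nhds t. 0 < r" using t by (rule eventually_nhds_in_open[OF open_greaterThan, of t 0, simplified])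
  then show "\<forall>\<^sub>F r in nhds t. has_bochner_integral_in (sobolev s) (sobolev_norm s) (lebesgue_on {0<..<r})
      (\<lambda>\<tau>. levy_tail \<nu> (r - \<tau>) *\<^sub>R (u \<tau> - f)) (J r)"
    by eventually_elim (rule J_bochner)
  have ev: "\<forall>\<^sub>F h in at 0. t / 2 < t + h \<and> h \<noteq> 0"
  proof -
    have "\<forall>\<^sub>F h in at 0. t / 2 < t + h"
      using t by (intro order_tendstoD(1)[where y="t + 0"] tendsto_intros) simp
    moreover have "\<forall>\<^sub>F h::real in at 0. h \<noteq> 0" by (simp add: eventually_at_filter)
    ultimately show ?thesis by (rule eventually_conj)
  qed
  show "H_tendsto s (\<lambda>h. (1 / h) *\<^sub>R (J (t + h) - J t)) (sphere_gen \<mu> (u t)) (at 0)"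
  proof (rule sobolev_tendstoI[OF f gen_u_sobolev[OF t], where C="2 * gen_bound (t/2)"])
    show "\<forall>\<^sub>F h in at 0. (1 / h) *\<^sub>R (J (t + h) - J t) \<in> sobolev s"
      using ev by eventually_elim (use t in \<open>auto intro!: sobolev_scaleR sobolev_diff J_sobolev\<close>)
    have coeff: "fl_coeff ((1 / h) *\<^sub>R (J (t + h) - J t)) l m = fl_coeff f l m * ((1 / h) *\<^sub>R (z l m * E l m (t + h) - z l m * E l m t))"
      if "t / 2 < t + h" "\<bar>m\<bar> \<le> int l" for h l m
      using that t by (simp add: fl_coeff_scaleR fl_coeff_diff fl_coeff_J right_diff_distrib)
    show "\<forall>\<^sub>F h in at 0. \<forall>l m. \<bar>m\<bar> \<le> int l \<longrightarrow>
        cmod (fl_coeff ((1 / h) *\<^sub>R (J (t + h) - J t)) l m - fl_coeff (sphere_gen \<mu> (u t)) l m) \<le> 2 * gen_bound (t/2) * cmod (fl_coeff f l m)"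
      using ev
    proof eventually_elim
      case (elim h)
      show ?case
      proof (intro allI impI)
        fix l m assume m: "\<bar>m\<bar> \<le> int l"
        have "cmod (z l m * E l m (t + h) - z l m * E l m t) \<le> gen_bound (t/2) * \<bar>t + h - t\<bar>"
          using t elim by (intro E_lipschitz m) auto
        then have "cmod ((1 / h) *\<^sub>R (z l m * E l m (t + h) - z l m * E l m t)) \<le> gen_bound (t/2)"
          using elim by (simp add: divide_le_eq)
        from mult_left_mono[OF this, of "cmod (fl_coeff f l m)"]
        have "cmod (fl_coeff ((1 / h) *\<^sub>R (J (t + h) - J t)) l m) \<le> gen_bound (t/2) * cmod (fl_coeff f l m)"
          using elim m by (simp only: coeff norm_mult) (simp add: mult.commute)
        moreover have "cmod (fl_coeff (sphere_gen \<mu> (u t)) l m) \<le> gen_bound (t/2) * cmod (fl_coeff f l m)"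
          using t m by (intro gen_u_dominated) auto
        ultimately show "cmod (fl_coeff ((1 / h) *\<^sub>R (J (t + h) - J t)) l m - fl_coeff (sphere_gen \<mu> (u t)) l m) \<le> 2 * gen_bound (t/2) * cmod (fl_coeff f l m)"
          using norm_triangle_ineq4[of "fl_coeff ((1 / h) *\<^sub>R (J (t + h) - J t)) l m" "fl_coeff (sphere_gen \<mu> (u t)) l m"] by linarith
      qed
    qed
    show "((\<lambda>h. fl_coeff ((1 / h) *\<^sub>R (J (t + h) - J t)) l m) \<longlongrightarrow> fl_coeff (sphere_gen \<mu> (u t)) l m) (at 0)"
      if m: "\<bar>m\<bar> \<le> int l" for l m
    proof (rule tendsto_cong[THEN iffD1])
      have "((\<lambda>x. z l m * E l m x) has_vector_derivative z l m * e t (z l m)) (at t)"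
        by (intro has_vector_derivative_mult_right conv_one_deriv e_z_continuous t)
      then have "((\<lambda>h. (1 / h) *\<^sub>R (z l m * E l m (t + h) - z l m * E l m t)) \<longlongrightarrow> z l m * e t (z l m)) (at 0)"
        by (simp add: has_vector_derivative_quotient)
      then show "((\<lambda>h. fl_coeff f l m * ((1 / h) *\<^sub>R (z l m * E l m (t + h) - z l m * E l m t))) \<longlongrightarrow> fl_coeff (sphere_gen \<mu> (u t)) l m) (at 0)"
        unfolding fl_coeff_gen_u[OF t m] by (rule tendsto_mult_left)
      show "\<forall>\<^sub>F h in at 0. fl_coeff f l m * ((1 / h) *\<^sub>R (z l m * E l m (t + h) - z l m * E l m t)) = fl_coeff ((1 / h) *\<^sub>R (J (t + h) - J t)) l m"
        using ev by eventually_elim (use m in \<open>simp only: coeff\<close>)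
    qed
  qed
qed

lemma nonlocal_derivative_u:
  "0 < t \<Longrightarrow> nonlocal_derivative (sobolev s) (sobolev_norm s) \<nu> u t = sphere_gen \<mu> (u t)"
  by (rule nonlocal_derivative_eq[OF u_continuous u_nonlocal_derivative])

lemma u_strong_solution: "strong_solution \<nu> \<mu> s f u"
  unfolding strong_solution_def
proof (intro conjI allI impI u_continuous u_continuous_2 u_zero nonlocal_derivative_u)
  show "\<exists>w. has_nonlocal_derivative (sobolev s) (sobolev_norm s) \<nu> u w t" if "0 < t" for t
    using u_nonlocal_derivative[OF that] by blast
  show "H_continuous_on s {0<..} (nonlocal_derivative (sobolev s) (sobolev_norm s) \<nu> u)"
    by (rule continuous_on_in_cong[OF gen_u_continuous]) (simp add: nonlocal_derivative_u)
qed auto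

text \<open>A coefficient \<open>a\<close> of a strong solution satisfies the integrated scalar equation, and so does
  \<open>c e\<close> with \<open>c = f\<^sub>l\<^sub>m\<close>. Their difference vanishes at \<open>0\<close>, hence everywhere.\<close>

lemma strong_solution_unique:
  assumes v: "strong_solution \<nu> \<mu> s f v" and t: "0 \<le> t"
  shows "v t = u t"
proof (rule l2_sphere_eqI)
  fix l m assume m: "\<bar>m\<bar> \<le> int l"
  have vc: "H_continuous_on s {0..} v" and v0: "v 0 = f"
    using v by (auto simp: strong_solution_def)
  define a where "a \<tau> = fl_coeff (v \<tau>) l m" for \<tau>
  define c where "c = fl_coeff f l m"
  have a0: "a 0 = c" by (simp add: a_def c_def v0)
  have ac: "continuous_on {0..} a" unfolding a_def by (rule continuous_on_in_fl_coeff[OF vc m])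
  have "(conv tail (\<lambda>\<tau>. a \<tau> - a 0) has_vector_derivative z l m * a r) (at r)" if r: "0 < r" for r
  proof -
    obtain w where w: "has_nonlocal_derivative (sobolev s) (sobolev_norm s) \<nu> v w r"
      using v r by (auto simp: strong_solution_def)
    have "w = sphere_gen \<mu> (v r)"
      using nonlocal_derivative_eq[OF vc w r] v r by (auto simp: strong_solution_def)
    moreover have "v r \<in> sobolev 2"
      using v r s0 by (intro sobolev_mono[of "v r" "s + 2" 2]) (auto simp: strong_solution_def continuous_on_in_def)
    ultimately have "fl_coeff w l m = z l m * a r"
      by (simp add: fl_coeff_sphere_gen m a_def)
    then show ?thesis
      using nonlocal_derivative_fl_coeff[OF vc w r m] by (simp add: a_def)
  qed
  then have eq: "conv tail (\<lambda>\<tau>. a \<tau> - a 0) r = z l m * conv (\<lambda>_. 1) a r" if "0 \<le> r" for r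
    using conv_tail_eq_of_derivative[OF ac _ that] by blast
  define w where "w \<tau> = a \<tau> - c * e \<tau> (z l m)" for \<tau>
  have "w t = 0"
  proof (rule relaxation_equation_unique[OF gen_eigenvalue_Re_nonpos _ _ _ t])
    show "continuous_on {0..} w" unfolding w_def by (intro continuous_intros ac e_z_continuous)
    show "w 0 = 0" by (simp add: w_def a0 e_zero)
    fix r :: real assume r: "0 \<le> r"
    have one: "locally_integrable (\<lambda>_. 1)" by (intro locally_integrable_continuous continuous_intros)
    have "conv tail w r = conv tail (\<lambda>\<tau>. (a \<tau> - a 0) + (- c) * (e \<tau> (z l m) - 1)) r"
      by (rule conv_cong) (simp_all add: w_def a0 algebra_simps)
    also have "\<dots> = conv tail (\<lambda>\<tau>. a \<tau> - a 0) r + conv tail (\<lambda>\<tau>. (- c) * (e \<tau> (z l m) - 1)) r"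
      by (intro conv_add_right locally_integrable_tail continuous_intros ac e_z_continuous)
    also have "conv tail (\<lambda>\<tau>. (- c) * (e \<tau> (z l m) - 1)) r = (- c) * (z l m * E l m r)"
      by (simp only: conv_scale_right z_E[OF r])
    also have "conv tail (\<lambda>\<tau>. a \<tau> - a 0) r + (- c) * (z l m * E l m r)
        = z l m * (conv (\<lambda>_. 1) a r + (- c) * E l m r)"
      by (simp add: eq[OF r] algebra_simps)
    also have "conv (\<lambda>_. 1) a r + (- c) * E l m r = conv (\<lambda>_. 1) (\<lambda>\<tau>. a \<tau> + (- c) * e \<tau> (z l m)) r"
      by (simp only: conv_scale_right[symmetric])
        (rule conv_add_right[symmetric, OF one ac], intro continuous_intros e_z_continuous)
    also have "\<dots> = conv (\<lambda>_. 1) w r" by (simp add: w_def[abs_def])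
    finally show "conv tail w r = z l m * conv (\<lambda>_. 1) w r" .
  qed
  then show "fl_coeff (v t) l m = fl_coeff (u t) l m"
    by (simp add: w_def a_def c_def fl_coeff_u m)
qed

lemma u_series:
  "H_tendsto s
    (\<lambda>n. \<Sum>l<n. \<Sum>m\<in>{- int l..int l}. (fl_coeff f l m * e t (z l m)) *\<^sub>C sph_harm l m) (u t) sequentially"
proof -
  have "harm_sum (fl_coeff (u t)) {..<n} = (\<Sum>l<n. \<Sum>m\<in>{- int l..int l}. (fl_coeff f l m * e t (z l m)) *\<^sub>C sph_harm l m)" for n
    unfolding harm_sum_def by (intro sum.cong refl) (simp add: fl_coeff_u abs_le_iff)
  then show ?thesis using harm_sum_tendsto[OF u_sobolev[of t]] by simp
qed

end

theorem theorem3p1: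
  fixes \<mu> s :: real
    and f :: l2_sphere
    and \<nu> :: "real measure"
    and M :: "'w measure"
    and S :: "real \<Rightarrow> 'w \<Rightarrow> real"
  assumes "levy_measure \<nu>"
    and "subordinator M S (laplace_exponent \<nu>)"
    and "s > 1"
    and "f \<in> sobolev s"
  shows "\<exists>u. strong_solution \<nu> \<mu> s f u
    \<and> (\<forall>v. strong_solution \<nu> \<mu> s f v \<longrightarrow> (\<forall>t\<ge>0. v t = u t))
    \<and> (\<forall>t\<ge>0. tendsto_in (sobolev s) (sobolev_norm s)
          (\<lambda>n. \<Sum>l<n. \<Sum>m\<in>{- int l..int l}.
            (fl_coeff f l m * e_fun M S t (gen_eigenvalue \<mu> l m)) *\<^sub>C sph_harm l m)
          (u t) sequentially)"
proof -
  interpret sphere_cauchy_problem \<nu> M S \<mu> s f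
    by unfold_locales (use assms in auto)
  show ?thesis
    using u_strong_solution strong_solution_unique u_series by blast
qed

end
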